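(* Let $n\in\mathbb{N}$, $n\ge 1$. The monotonic rearrangement operator $\varphi\mapsto\varphi^*$ acts from the dyadic space $\mathrm{BMO}^d([0,1]^n)$ to $\mathrm{BMO}([0,1])$ (that is, $\varphi^*\in \mathrm{BMO}([0,1])$ for every $\varphi\in \mathrm{BMO}^d([0,1]^n)$), and its norm, i.e. the least constant $c$ such that $\|\varphi^*\|_{\mathrm{BMO}([0,1])}\le c\,\|\varphi\|_{\mathrm{BMO}^d([0,1]^n)}$ for all $\varphi\in \mathrm{BMO}^d([0,1]^n)$, equals $$\frac{1+2^n}{2^{1+n/2}}.$$
   Context: For an integrable function $f$ and a set $I$ of positive finite Lebesgue measure, $\langle f\rangle_I=\frac{1}{|I|}\int_I f$ denotes the average of $f$ over $I$. Let $\mathcal{D}$ be the set of all dyadic subcubes of $[0,1]^n$ (including $[0,1]^n$ itself). The dyadic $\mathrm{BMO}$ space with quadratic seminorm is $$\mathrm{BMO}^d([0,1]^n)=\Big\{\varphi\in L^1([0,1]^n)\colon \|\varphi\|^2_{\mathrm{BMO}^d([0,1]^n)}=\sup_{I\in\mathcal{D}}\big(\langle\varphi^2\rangle_I-\langle\varphi\rangle_I^2\big)<+\infty\Big\},$$ where the functions are real-valued. The space $\mathrm{BMO}([0,1])$ is the space of $\varphi\in L^1([0,1])$ with finite quadratic seminorm $\|\varphi\|^2_{\mathrm{BMO}([0,1])}=\sup_{I}(\langle\varphi^2\rangle_I-\langle\varphi\rangle_I^2)$, the supremum being taken over all subintervals $I\subset[0,1]$. The monotonic rearrangement of a function $\varphi$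 on $[0,1]^n$ is the monotone non-increasing function $\varphi^*$ on $[0,1]$ with the same distribution (with respect to Lebesgue measure) as $\varphi$. The (non-linear) operator $\varphi\mapsto\varphi^*$ is called the monotonic rearrangement operator. *)

theory Defs
  imports "HOL-Analysis.Analysis" "HOL-Probability.Weak_Convergence"
begin

definition average :: "('a::euclidean_space \<Rightarrow> real) \<Rightarrow> 'a set \<Rightarrow> real" where
  "average \<phi> I = (\<integral>x. \<phi> x \<partial>lebesgue_on I) / measure lebesgue I"

text \<open>The average of the square of an integrable function may be infinite, so it is
  taken in the extended reals (a Bochner integral would be 0 in that case).\<close>

definition average_sq :: "('a::euclidean_space \<Rightarrow> real) \<Rightarrow> 'a set \<Rightarrow> ereal" where
  "average_sq \<phi> I =
     enn2ereal (\<integral>\<^sup>+x. ennreal ((\<phi> x)\<^sup>2) \<partial>lebesgue_on I) / ereal (measure lebesgue I)"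

definition bmo_sup :: "'a::euclidean_space set set \<Rightarrow> ('a \<Rightarrow> real) \<Rightarrow> ereal" where
  "bmo_sup \<I> \<phi> = (SUP I\<in>\<I>. average_sq \<phi> I - ereal ((average \<phi> I)\<^sup>2))"

definition bmo_space :: "'a::euclidean_space set \<Rightarrow> 'a set set \<Rightarrow> ('a \<Rightarrow> real) set" where
  "bmo_space Q \<I> = {\<phi>. integrable (lebesgue_on Q) \<phi> \<and> bmo_sup \<I> \<phi> < \<infinity>}"

definition bmo_seminorm :: "'a::euclidean_space set set \<Rightarrow> ('a \<Rightarrow> real) \<Rightarrow> real" where
  "bmo_seminorm \<I> \<phi> = sqrt (real_of_ereal (bmo_sup \<I> \<phi>))"

definition unit_cube :: "(real^'n) set" where
  "unit_cube = cbox 0 1"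

definition dyadic_cubes :: "(real^'n) set set" where
  "dyadic_cubes =
     {cbox (\<chi> i. real (k i) / 2 ^ m) (\<chi> i. (real (k i) + 1) / 2 ^ m) | (k :: 'n \<Rightarrow> nat) m.
        \<forall>i. k i < 2 ^ m}"

definition BMO_dyadic :: "(real^'n \<Rightarrow> real) set" where
  "BMO_dyadic = bmo_space unit_cube dyadic_cubes"

definition unit_subintervals :: "real set set" where
  "unit_subintervals = {I. is_interval I \<and> I \<subseteq> {0..1} \<and> 0 < measure lebesgue I}"

definition BMO_unit :: "(real \<Rightarrow> real) set" where
  "BMO_unit = bmo_space {0..1} unit_subintervals"

text \<open>Monotonicity is required on the open interval only: if \<open>\<phi>\<close> is unbounded from above
  (below), a non-increasing function with the same distribution has no real value at 0 (at 1).\<close>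

definition is_monotonic_rearrangement :: "(real^'n \<Rightarrow> real) \<Rightarrow> (real \<Rightarrow> real) \<Rightarrow> bool" where
  "is_monotonic_rearrangement \<phi> g \<longleftrightarrow>
     antimono_on {0<..<1} g \<and>
     distr (lebesgue_on {0..1}) borel g = distr (lebesgue_on unit_cube) borel \<phi>"

text \<open>A monotonic rearrangement exists for every integrable \<open>\<phi>\<close> (proved below). It is unique up
  to its values on a countable set, on which the averages do not depend.\<close>

definition monotonic_rearrangement :: "(real^'n \<Rightarrow> real) \<Rightarrow> real \<Rightarrow> real" where
  "monotonic_rearrangement \<phi> = (SOME g. is_monotonic_rearrangement \<phi> g)"

lemma emeasure_lebesgue_unit_cube: "emeasure lebesgue (unit_cube :: (real^'n) set) = 1"
proof -
  have "emeasure lborel (cbox 0 (1::real^'n)) = 1"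
    by (subst emeasure_lborel_cbox_eq)
       (auto simp: Basis_vec_def inner_axis axis_index intro!: prod.neutral)
  then show ?thesis by (simp add: unit_cube_def)
qed

lemma ex_monotonic_rearrangement:
  fixes \<phi> :: "real^'n \<Rightarrow> real"
  assumes \<phi>: "\<phi> \<in> borel_measurable (lebesgue_on unit_cube)"
  shows "\<exists>g. is_monotonic_rearrangement \<phi> g"
proof -
  let ?L = "lebesgue_on (unit_cube :: (real^'n) set)"
  let ?R = "restrict_space lborel {0<..<1::real}"
  define M where "M = distr ?L borel (\<lambda>x. - \<phi> x)"
  have meas: "(\<lambda>x. - \<phi> x) \<in> borel_measurable ?L"
    using \<phi> by simp
  have cube: "(unit_cube :: (real^'n) set) \<in> sets lebesgue"
    by (simp add: unit_cube_def)
  interpret L: prob_space ?L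
    by (rule prob_spaceI)
       (use cube in \<open>simp add: space_restrict_space emeasure_restrict_space
          emeasure_lebesgue_unit_cube\<close>)
  interpret M: cdf_distribution M
    unfolding cdf_distribution_def M_def using meas by (rule L.real_distribution_distr)
  define g where "g s = - M.I s" for s
  have anti: "antimono_on {0<..<1} g"
    using M.mono_I by (auto simp: g_def monotone_on_def)
  have g_open: "g \<in> borel_measurable ?R"
  proof -
    have "M.I \<in> borel_measurable ?R"
      using M.measurable_CI
      by (simp cong: measurable_cong_sets sets_restrict_space_cong)
    then show ?thesis unfolding g_def by simp
  qed
  have "distr ?R borel g = distr (distr ?R borel M.I) borel uminus"
    using g_open M.measurable_CI
    by (subst distr_distr)
       (auto simp: g_def[abs_def] comp_def cong: measurable_cong_sets sets_restrict_space_cong)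
  also have "\<dots> = distr M borel uminus"
    by (simp add: M.distr_I_eq_M)
  also have "\<dots> = distr ?L borel \<phi>"
    unfolding M_def using meas by (subst distr_distr) (auto simp: comp_def)
  finally have R: "distr ?R borel g = distr ?L borel \<phi>" .
  have pre_open: "g -` A \<inter> {0<..<1} \<in> sets lborel" if "A \<in> sets borel" for A
  proof -
    have "g -` A \<inter> space ?R \<in> sets ?R"
      using g_open that by (rule measurable_sets)
    then show ?thesis
      by (auto simp: space_restrict_space sets_restrict_space_iff)
  qed
  define B where "B A = g -` A \<inter> {0, 1}" for A
  have B_null: "B A \<in> null_sets lborel" for A
    by (rule finite_imp_null_set_lborel) (simp add: B_def)
  have split: "g -` A \<inter> {0..1} = (g -` A \<inter> {0<..<1}) \<union> B A" for A
    by (auto simp: B_def)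
  have pre: "g -` A \<inter> {0..1} \<in> sets lborel" if "A \<in> sets borel" for A
    unfolding split using pre_open[OF that] B_null[of A] by blast
  have g_closed: "g \<in> borel_measurable (lebesgue_on {0..1})"
    using pre by (intro measurableI) (auto simp: sets_restrict_space_iff)
  have "distr (lebesgue_on {0..1}) borel g = distr ?R borel g"
  proof (rule measure_eqI)
    fix A assume "A \<in> sets (distr (lebesgue_on {0..1}) borel g)"
    then have A: "A \<in> sets borel" by simp
    have "emeasure (distr (lebesgue_on {0..1}) borel g) A = emeasure lborel (g -` A \<inter> {0..1})"
      using pre[OF A] by (simp add: emeasure_distr g_closed A emeasure_restrict_space)
    also have "\<dots> = emeasure lborel (g -` A \<inter> {0<..<1})"
      unfolding split using pre_open[OF A] B_null[of A] by (rule emeasure_Un_null_set)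
    also have "\<dots> = emeasure (distr ?R borel g) A"
      by (simp add: emeasure_distr g_open A emeasure_restrict_space space_restrict_space)
    finally show "emeasure (distr (lebesgue_on {0..1}) borel g) A = emeasure (distr ?R borel g) A" .
  qed simp
  with R anti show ?thesis
    unfolding is_monotonic_rearrangement_def by auto
qed

lemma monotonic_rearrangement:
  fixes \<phi> :: "real^'n \<Rightarrow> real"
  assumes "integrable (lebesgue_on unit_cube) \<phi>"
  shows "is_monotonic_rearrangement \<phi> (monotonic_rearrangement \<phi>)"
  unfolding monotonic_rearrangement_def
  using ex_monotonic_rearrangement[OF borel_measurable_integrable[OF assms]]
  by (rule someI_ex)

end

theory Submission
  imports Defs
begin

text \<open>
  Put \<open>N = 2 ^ CARD('n)\<close> and \<open>\<alpha> = 1 / N\<close>. The square of the claimed norm is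
  \<open>(1 + \<alpha>)\<^sup>2 / (4 * \<alpha>)\<close>. Let \<open>e\<close> be the squared dyadic seminorm of \<open>\<phi>\<close>. Restricting the
  rearrangement of \<open>\<phi>\<close> to an interval amounts to cutting the distribution of \<open>\<phi>\<close> at two
  quantiles, so the upper bound says that every such slice of the distribution has
  variance at most \<open>K = (1 + \<alpha>)\<^sup>2 / (4 * \<alpha>) * e\<close>.

  The heart of the matter is \<open>slices_le_add\<close>: if all slices of two distributions have
  variance at most \<open>K\<close>, and so do all mixtures of the two distributions themselves, then all
  slices of their sum have variance at most \<open>K\<close>. In the plane of pairs (mean, second moment)
  variance at most \<open>K\<close> means lying in the strip between two parabolas; when the top of both
  distributions is cut off at a common level, the segment between the two moment points
  moves, and it cannot leave the strip unless one of the two points leaves it at some level.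

  A cube is merged from its \<open>N\<close> children by adding them one at a time. The order can be chosen
  such that all partial sums have variance at most \<open>e\<close> (\<open>remove_piece\<close>), and each step mixes two
  parts of weight at least \<open>\<alpha>\<close>. A chord with endpoints in the strip of height \<open>e\<close>, and with
  an intermediate point at relative position between \<open>\<alpha>\<close> and \<open>1 - \<alpha>\<close> in that strip, stays in the
  strip of height \<open>K\<close> (\<open>chord_bound\<close>): this is where the constant comes from. Induction along the
  dyadic tree (\<open>slices_le_tree\<close>) settles functions that are constant on the cubes of some
  generation, in particular the conditional expectations \<open>dyadic_step m \<phi>\<close>, which inherit the
  oscillation bound from \<open>\<phi>\<close>. They converge to \<open>\<phi>\<close> in \<open>L\<^sup>1\<close>, hence their rearrangements converge
  to that of \<open>\<phi>\<close> at every point of continuity, and Fatou's lemma carries the variance bound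
  to the limit (\<open>rearrangement_variance_le\<close>).

  Equality in \<open>chord_bound\<close> occurs when one end of the chord has variance \<open>0\<close>, the other one has
  weight \<open>\<alpha>\<close> and variance \<open>e\<close>, and the mixture has variance \<open>e\<close>. The function \<open>extremal\<close> realises
  this configuration with \<open>e = 1\<close>: it vanishes off one child of the unit cube and takes the values
  \<open>sqrt N + 1\<close> and \<open>sqrt N - 1\<close> on the two halves of that child. The maximum along the chord is
  the variance of its rearrangement on \<open>{0..2 / (1 + N)}\<close>.
\<close>

section \<open>Variance and cuts of weighted families\<close>

text \<open>
  A family \<open>X i\<close> with weights \<open>p i\<close> stands for a finite measure on the line. Since the mean minimises
  the mean square deviation, bounding the deviation from some point is the same as bounding the
  variance. This form is linear in \<open>p\<close>, involves no division by the total mass, and holds trivially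
  for mass zero.
\<close>

definition var_le :: "'i set \<Rightarrow> ('i \<Rightarrow> real) \<Rightarrow> real \<Rightarrow> ('i \<Rightarrow> real) \<Rightarrow> bool" where
  "var_le T X K p \<longleftrightarrow> (\<exists>\<tau>. (\<Sum>i\<in>T. p i * ((X i - \<tau>)\<^sup>2 - K)) \<le> 0)"

text \<open>
  A cut keeps the low values and drops the high ones; only the members at the threshold may be
  kept partially, as needed for quantiles inside an atom. Members with equal values may be
  kept in different proportions.
\<close>

definition lower_cut :: "'i set \<Rightarrow> ('i \<Rightarrow> real) \<Rightarrow> ('i \<Rightarrow> real) \<Rightarrow> bool" where
  "lower_cut T X w \<longleftrightarrow> (\<forall>i\<in>T. 0 \<le> w i \<and> w i \<le> 1) \<and>
     (\<forall>i\<in>T. \<forall>j\<in>T. X i < X j \<longrightarrow> 0 < w j \<longrightarrow> w i = 1)"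

definition upper_cut :: "'i set \<Rightarrow> ('i \<Rightarrow> real) \<Rightarrow> ('i \<Rightarrow> real) \<Rightarrow> bool" where
  "upper_cut T X w \<longleftrightarrow> lower_cut T (\<lambda>i. - X i) w"

definition slices_le :: "'i set \<Rightarrow> ('i \<Rightarrow> real) \<Rightarrow> real \<Rightarrow> ('i \<Rightarrow> real) \<Rightarrow> bool" where
  "slices_le T X K p \<longleftrightarrow>
     (\<forall>w w'. lower_cut T X w \<longrightarrow> upper_cut T X w' \<longrightarrow> var_le T X K (\<lambda>i. p i * w i * w' i))"

lemma lower_cutD:
  assumes "lower_cut T X w" "i \<in> T"
  shows "0 \<le> w i" "w i \<le> 1" "j \<in> T \<Longrightarrow> X i < X j \<Longrightarrow> 0 < w j \<Longrightarrow> w i = 1"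
    "j \<in> T \<Longrightarrow> X i < X j \<Longrightarrow> w i < 1 \<Longrightarrow> w j = 0"
proof -
  show "0 \<le> w i" "w i \<le> 1" using assms by (auto simp: lower_cut_def)
  show "w i = 1" if "j \<in> T" "X i < X j" "0 < w j"
    using assms that by (auto simp: lower_cut_def)
  show "w j = 0" if "j \<in> T" "X i < X j" "w i < 1"
    using assms that unfolding lower_cut_def by (metis less_eq_real_def order_less_irrefl)
qed

lemma sum_diff_const:
  fixes p f :: "'i \<Rightarrow> real"
  shows "(\<Sum>i\<in>T. p i * (f i - c)) = (\<Sum>i\<in>T. p i * f i) - c * sum p T"
  by (simp add: right_diff_distrib sum_subtractf sum_distrib_left mult.commute)

lemma sum_sq_shift:
  fixes p X :: "'i \<Rightarrow> real"
  shows "(\<Sum>i\<in>T. p i * ((X i - \<sigma>)\<^sup>2 - K)) = (\<Sum>i\<in>T. p i * ((X i - \<tau>)\<^sup>2 - K))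
    + 2 * (\<tau> - \<sigma>) * (\<Sum>i\<in>T. p i * (X i - \<tau>)) + (\<tau> - \<sigma>)\<^sup>2 * (\<Sum>i\<in>T. p i)"
  unfolding sum_distrib_left sum.distrib[symmetric]
  by (rule sum.cong) (auto simp: power2_eq_square algebra_simps)

text \<open>The mean is the best choice of centre.\<close>

lemma var_le_centred:
  assumes "var_le T X K p" "0 \<le> (\<Sum>i\<in>T. p i)" "(\<Sum>i\<in>T. p i * (X i - \<tau>)) = 0"
  shows "(\<Sum>i\<in>T. p i * ((X i - \<tau>)\<^sup>2 - K)) \<le> 0"
proof -
  obtain \<sigma> where "(\<Sum>i\<in>T. p i * ((X i - \<sigma>)\<^sup>2 - K)) \<le> 0"
    using assms(1) by (auto simp: var_le_def)
  then show ?thesis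
    using sum_sq_shift[of p X \<sigma> K T \<tau>] assms(2,3) by (smt (verit) mult_nonneg_nonneg zero_le_power2 mult_eq_0_iff)
qed

lemma var_le_cong:
  "(\<And>i. i \<in> T \<Longrightarrow> p i = q i) \<Longrightarrow> var_le T X K p = var_le T X K q"
  unfolding var_le_def by (simp cong: sum.cong)

lemma var_le_reflect: "var_le T (\<lambda>i. - X i) K p \<longleftrightarrow> var_le T X K p"
proof -
  have "var_le T (\<lambda>i. - X i) K p" if "var_le T X K p" for X
  proof -
    obtain \<tau> where "(\<Sum>i\<in>T. p i * ((X i - \<tau>)\<^sup>2 - K)) \<le> 0"
      using \<open>var_le T X K p\<close> by (auto simp: var_le_def)
    moreover have "(- X i - (-\<tau>))\<^sup>2 = (X i - \<tau>)\<^sup>2" for i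
      by (simp add: power2_eq_square algebra_simps)
    ultimately have "(\<Sum>i\<in>T. p i * ((- X i - (-\<tau>))\<^sup>2 - K)) \<le> 0" by (simp only:)
    then show ?thesis unfolding var_le_def by blast
  qed
  from this[of X] this[of "\<lambda>i. - X i"] show ?thesis by auto
qed

text \<open>A continuous family of lower cuts that sweeps over the values in increasing order; it serves to
  reach a prescribed mean by the intermediate value theorem.\<close>

definition rank_cut :: "'i set \<Rightarrow> ('i \<Rightarrow> real) \<Rightarrow> real \<Rightarrow> 'i \<Rightarrow> real" where
  "rank_cut T X r i = max 0 (min 1 (r - real (card {v \<in> X ` T. v < X i})))"

lemma rank_cut_continuous: "continuous_on A (\<lambda>r. rank_cut T X r i)"
  unfolding rank_cut_def by (intro continuous_intros)

lemma lower_cut_rank_cut: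
  assumes "finite T" shows "lower_cut T X (rank_cut T X r)"
proof -
  have "rank_cut T X r i = 1" if "i \<in> T" "j \<in> T" "X i < X j" "0 < rank_cut T X r j" for i j
  proof -
    have "card {v \<in> X ` T. v < X i} < card {v \<in> X ` T. v < X j}"
      using assms that by (intro psubset_card_mono) auto
    then show ?thesis using that(4) by (auto simp: rank_cut_def)
  qed
  then show ?thesis by (auto simp: lower_cut_def rank_cut_def)
qed

lemma rank_cut_0: "rank_cut T X 0 i = 0"
  by (simp add: rank_cut_def)

lemma rank_cut_full:
  assumes "finite T" "real (card (X ` T)) \<le> r - 1"
  shows "rank_cut T X r i = 1"
proof -
  have "card {v \<in> X ` T. v < X i} \<le> card (X ` T)"
    using assms by (intro card_mono) auto
  then show ?thesis using assms(2) by (auto simp: rank_cut_def)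
qed

text \<open>At this parameter the sweep has collected exactly the values below \<open>\<tau>\<close>.\<close>

lemma rank_cut_below:
  assumes "finite T" "i \<in> T"
  shows "rank_cut T X (real (card {v \<in> X ` T. v < \<tau>})) i = (if X i < \<tau> then 1 else 0)"
proof (cases "X i < \<tau>")
  case True
  have "card {v \<in> X ` T. v < X i} < card {v \<in> X ` T. v < \<tau>}"
    using assms True by (intro psubset_card_mono) auto
  then show ?thesis using True by (auto simp: rank_cut_def)
next
  case False
  have "card {v \<in> X ` T. v < \<tau>} \<le> card {v \<in> X ` T. v < X i}"
    using assms False by (intro card_mono) auto
  then show ?thesis using False by (auto simp: rank_cut_def)
qed

lemma rank_cut_mono: "r \<le> s \<Longrightarrow> rank_cut T X r i \<le> rank_cut T X s i"
  by (auto simp: rank_cut_def)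

lemma lower_cut_mult:
  assumes "lower_cut T X v" "lower_cut T X w"
  shows "lower_cut T X (\<lambda>i. v i * w i)"
  using assms unfolding lower_cut_def
  by (auto simp: mult_le_one zero_less_mult_iff)

text \<open>The union of two cuts, used to enlarge a given cut continuously.\<close>

lemma lower_cut_max:
  assumes "lower_cut T X v" "lower_cut T X w"
  shows "lower_cut T X (\<lambda>i. max (v i) (w i))"
proof -
  have "max (v i) (w i) = 1" if "i \<in> T" "j \<in> T" "X i < X j" "0 < max (v j) (w j)" for i j
  proof -
    have "v i = 1 \<or> w i = 1"
      using that lower_cutD(3)[OF assms(1) that(1-3)] lower_cutD(3)[OF assms(2) that(1-3)]
      by (auto simp: max_def split: if_splits)
    then show ?thesis
      using lower_cutD(2)[OF assms(1) that(1)] lower_cutD(2)[OF assms(2) that(1)] by auto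
  qed
  then show ?thesis
    using assms by (auto simp: lower_cut_def le_max_iff_disj)
qed

section \<open>Slices of mixtures\<close>

text \<open>Suppose that the part of \<open>q\<close> kept by \<open>w\<close> has mean above \<open>\<tau>\<close> and mean square deviation
  \<open>K + \<kappa>\<close> from \<open>\<tau>\<close>. Then the threshold lies beyond the band of radius \<open>sqrt (K + \<kappa>)\<close> around \<open>\<tau>\<close>. Otherwise
  lower the threshold until the mean is \<open>\<tau>\<close>: this only removes values inside the band, hence keeps
  the mean square deviation at \<open>K + \<kappa>\<close> or more, and the resulting cut has too large a variance.\<close>

lemma cut_support_far:
  assumes fin: "finite T" and q: "\<And>i. i \<in> T \<Longrightarrow> 0 \<le> q i"
    and cuts: "\<And>w. lower_cut T X w \<Longrightarrow> var_le T X K (\<lambda>i. q i * w i)"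
    and w: "lower_cut T X w"
    and K: "0 \<le> K" "0 < \<kappa>"
    and eq: "(\<Sum>i\<in>T. q i * w i * ((X i - \<tau>)\<^sup>2 - K)) = \<kappa> * (\<Sum>i\<in>T. q i * w i)"
    and mass: "0 < (\<Sum>i\<in>T. q i * w i)"
    and right: "0 < (\<Sum>i\<in>T. q i * w i * (X i - \<tau>))"
    and i: "i \<in> T" "w i < 1"
  shows "\<tau> + sqrt (K + \<kappa>) \<le> X i"
proof (rule ccontr)
  assume "\<not> ?thesis"
  then have Xi: "X i < \<tau> + sqrt (K + \<kappa>)" by simp
  let ?s = "sqrt (K + \<kappa>)"
  have s2: "?s\<^sup>2 = K + \<kappa>" using K by simp
  have sum_ex: "(\<Sum>i\<in>T. q i * w i * ((X i - \<tau>)\<^sup>2 - (K + \<kappa>))) = 0"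
    using eq by (simp add: algebra_simps sum.distrib sum_distrib_left sum_subtractf)
  have nn: "0 \<le> q j * w j" if "j \<in> T" for j
    using q[OF that] lower_cutD(1)[OF w that] by simp
  have supp: "X j < \<tau> + ?s" if "j \<in> T" "q j * w j \<noteq> 0" for j
    using lower_cutD(4)[OF w i(1) that(1) _ i(2)] that Xi by fastforce
  have near: "(X j - \<tau>)\<^sup>2 - (K + \<kappa>) < 0" if "j \<in> T" "q j * w j \<noteq> 0" "\<tau> \<le> X j" for j
  proof -
    have "(X j - \<tau>)\<^sup>2 < ?s\<^sup>2"
      using supp[OF that(1,2)] that(3) K by (intro power_strict_mono) auto
    then show ?thesis using s2 by simp
  qed
  define c where "c r = rank_cut T X r" for r
  define r0 where "r0 = real (card {v \<in> X ` T. v < \<tau>})"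
  define r1 where "r1 = r0 + real (card (X ` T)) + 1"
  define f where "f r = (\<Sum>j\<in>T. q j * w j * c r j * (X j - \<tau>))" for r
  have c0: "c r0 j = (if X j < \<tau> then 1 else 0)" if "j \<in> T" for j
    unfolding c_def r0_def using rank_cut_below[OF fin that] .
  \<comment> \<open>Otherwise all the mass lies in the band, and its mean square deviation is below \<open>K + \<kappa>\<close>.\<close>
  have left: "\<exists>j\<in>T. q j * w j \<noteq> 0 \<and> X j < \<tau>"
  proof (rule ccontr)
    assume "\<not> ?thesis"
    then have a: "q j * w j * ((X j - \<tau>)\<^sup>2 - (K + \<kappa>)) \<le> 0"
       and b: "q j * w j \<noteq> 0 \<Longrightarrow> q j * w j * ((X j - \<tau>)\<^sup>2 - (K + \<kappa>)) < 0" if "j \<in> T" for j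
      using near[OF that] nn[OF that] that
      by (smt (verit) mult_less_0_iff mult_eq_0_iff)+
    obtain j where "j \<in> T" "q j * w j \<noteq> 0" using mass
      by (metis (no_types, lifting) less_numeral_extra(3) sum.neutral)
    then have "(\<Sum>i\<in>T. q i * w i * ((X i - \<tau>)\<^sup>2 - (K + \<kappa>))) < (\<Sum>i\<in>T. 0)"
      using a b fin by (intro sum_strict_mono_ex1) auto
    then show False using sum_ex by simp
  qed
  then obtain l where l: "l \<in> T" "q l * w l \<noteq> 0" "X l < \<tau>" by blast
  have "f r0 \<le> 0"
    unfolding f_def by (rule sum_nonpos) (use nn c0 in \<open>auto simp: mult_nonneg_nonpos\<close>)
  moreover have "f r1 \<ge> 0"
  proof -
    have "f r1 = (\<Sum>i\<in>T. q i * w i * (X i - \<tau>))"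
      unfolding f_def c_def r1_def r0_def by (rule sum.cong) (auto simp: rank_cut_full fin)
    then show ?thesis using right by simp
  qed
  moreover have "r0 \<le> r1" by (simp add: r1_def)
  moreover have "continuous_on {r0..r1} f"
    unfolding f_def c_def by (intro continuous_intros rank_cut_continuous)
  ultimately obtain r where r: "r0 \<le> r" "f r = 0"
    using IVT'[of f r0 0 r1] by auto
  have c_left: "c r j = 1" if "j \<in> T" "X j < \<tau>" for j
    using c0[OF that(1)] that rank_cut_mono[OF r(1), of T X j] lower_cutD(2)[OF lower_cut_rank_cut[OF fin] that(1), of X r]
    by (simp add: c_def)
  have c01: "0 \<le> c r j" "c r j \<le> 1" if "j \<in> T" for j
    using lower_cutD(1,2)[OF lower_cut_rank_cut[OF fin] that] by (auto simp: c_def)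
  have "var_le T X K (\<lambda>j. q j * (w j * c r j))"
    using cuts lower_cut_mult[OF w lower_cut_rank_cut[OF fin]] by (simp add: c_def)
  then have v: "var_le T X K (\<lambda>j. q j * w j * c r j)" by (simp add: mult.assoc)
  have nnc: "0 \<le> q j * w j * c r j" if "j \<in> T" for j using nn c01 that by simp
  have "(\<Sum>j\<in>T. q j * w j * c r j * ((X j - \<tau>)\<^sup>2 - K)) \<le> 0"
    using var_le_centred[OF v] nnc r(2) unfolding f_def by (simp add: sum_nonneg)
  moreover have "0 < (\<Sum>j\<in>T. q j * w j * c r j)"
  proof (rule sum_pos2[OF fin l(1)])
    show "0 < q l * w l * c r l"
      unfolding c_left[OF l(1,3)] using l(2) nn[OF l(1)] by linarith
  qed (use nnc in auto)
  moreover have "0 \<le> (\<Sum>j\<in>T. q j * w j * c r j * ((X j - \<tau>)\<^sup>2 - (K + \<kappa>)))"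
  proof -
    have "(\<Sum>j\<in>T. q j * w j * (1 - c r j) * ((X j - \<tau>)\<^sup>2 - (K + \<kappa>))) \<le> 0"
    proof (rule sum_nonpos)
      fix j assume j: "j \<in> T"
      show "q j * w j * (1 - c r j) * ((X j - \<tau>)\<^sup>2 - (K + \<kappa>)) \<le> 0"
      proof (cases "X j < \<tau> \<or> q j * w j = 0")
        case True then show ?thesis using c_left[OF j] by auto
      next
        case False
        then show ?thesis using near[OF j] nn[OF j] c01[OF j]
          by (intro mult_nonneg_nonpos) auto
      qed
    qed
    then show ?thesis using sum_ex
      by (simp add: algebra_simps sum.distrib sum_subtractf)
  qed
  ultimately show False
    using K(2) by (simp add: right_diff_distrib distrib_left sum.distrib sum_subtractf sum_distrib_right[symmetric])
      (smt (verit) mult_pos_pos)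
qed


text \<open>If the cut-off parts of \<open>p\<close> and \<open>q\<close> had the same mean square deviation \<open>K + \<kappa>\<close> from a point \<open>\<tau>\<close> strictly
  between their means, some mixture of them would violate the bound \<open>K\<close>. This cannot happen. By
  \<open>cut_support_far\<close> everything that \<open>w\<close> removes is farther from \<open>\<tau>\<close> than \<open>sqrt (K + \<kappa>)\<close>, so putting it back keeps the
  mean square deviations at \<open>K + \<kappa>\<close> or more. If the mean of all of \<open>p\<close> is still at most \<open>\<tau>\<close>, some
  mixture of \<open>p\<close> and \<open>q\<close> has mean \<open>\<tau>\<close> and too large a variance; otherwise an intermediate cut of \<open>p\<close> does.\<close>

lemma cut_no_balance:
  assumes fin: "finite T" and K: "0 \<le> K" "0 < \<kappa>"
    and p: "\<And>i. i \<in> T \<Longrightarrow> 0 \<le> p i" and q: "\<And>i. i \<in> T \<Longrightarrow> 0 \<le> q i"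
    and pc: "\<And>w. lower_cut T X w \<Longrightarrow> var_le T X K (\<lambda>i. p i * w i)"
    and qc: "\<And>w. lower_cut T X w \<Longrightarrow> var_le T X K (\<lambda>i. q i * w i)"
    and mix: "\<And>s t. 0 \<le> s \<Longrightarrow> 0 \<le> t \<Longrightarrow> var_le T X K (\<lambda>i. s * p i + t * q i)"
    and w: "lower_cut T X w"
    and eqp: "(\<Sum>i\<in>T. p i * w i * ((X i - \<tau>)\<^sup>2 - K)) = \<kappa> * (\<Sum>i\<in>T. p i * w i)"
    and eqq: "(\<Sum>i\<in>T. q i * w i * ((X i - \<tau>)\<^sup>2 - K)) = \<kappa> * (\<Sum>i\<in>T. q i * w i)"
    and massp: "0 < (\<Sum>i\<in>T. p i * w i)" and massq: "0 < (\<Sum>i\<in>T. q i * w i)"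
    and left: "(\<Sum>i\<in>T. p i * w i * (X i - \<tau>)) < 0"
    and right: "0 < (\<Sum>i\<in>T. q i * w i * (X i - \<tau>))"
  shows False
proof -
  let ?s = "sqrt (K + \<kappa>)"
  have far: "\<tau> + ?s \<le> X i" if "i \<in> T" "w i < 1" for i
    using cut_support_far[OF fin q qc w K eqq massq right that] by simp
  have spos: "0 < ?s" using K by simp
  have far0: "\<tau> \<le> X i" if "i \<in> T" "w i < 1" for i
    using far[OF that] spos by linarith
  have far2: "\<kappa> \<le> (X i - \<tau>)\<^sup>2 - K" if "i \<in> T" "w i < 1" for i
  proof -
    have "?s\<^sup>2 \<le> (X i - \<tau>)\<^sup>2"
      using far[OF that] spos by (intro power_mono) auto
    then show ?thesis using K by simp
  qed
  have w01: "0 \<le> w i" "w i \<le> 1" if "i \<in> T" for i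
    using lower_cutD(1,2)[OF w that] by auto
  have grow: "\<kappa> * (\<Sum>i\<in>T. r i * v i) \<le> (\<Sum>i\<in>T. r i * v i * ((X i - \<tau>)\<^sup>2 - K))"
    if r: "\<And>i. i \<in> T \<Longrightarrow> 0 \<le> r i"
      and eq: "(\<Sum>i\<in>T. r i * w i * ((X i - \<tau>)\<^sup>2 - K)) = \<kappa> * (\<Sum>i\<in>T. r i * w i)"
      and v: "\<And>i. i \<in> T \<Longrightarrow> w i \<le> v i" "\<And>i. i \<in> T \<Longrightarrow> v i \<le> 1" for r v
  proof -
    have "0 \<le> (\<Sum>i\<in>T. r i * (v i - w i) * ((X i - \<tau>)\<^sup>2 - K - \<kappa>))"
    proof (rule sum_nonneg)
      fix i assume i: "i \<in> T"
      show "0 \<le> r i * (v i - w i) * ((X i - \<tau>)\<^sup>2 - K - \<kappa>)"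
      proof (cases "w i < 1")
        case True then show ?thesis using far2[OF i] r[OF i] v(1)[OF i] by simp
      next
        case False
        then have "v i = w i" using v[OF i] w01[OF i] by simp
        then show ?thesis by simp
      qed
    qed
    then show ?thesis using eq
      by (simp add: algebra_simps sum.distrib sum_subtractf sum_distrib_left)
  qed
  \<comment> \<open>A measure with mean \<open>\<tau>\<close> and mean square deviation at least \<open>K + \<kappa>\<close> violates the bound \<open>K\<close>.\<close>
  have no: False
    if r: "\<And>i. i \<in> T \<Longrightarrow> 0 \<le> r i" and v: "var_le T X K r"
      and z: "(\<Sum>i\<in>T. r i * (X i - \<tau>)) = 0" and m: "0 < sum r T"
      and big: "\<kappa> * sum r T \<le> (\<Sum>i\<in>T. r i * ((X i - \<tau>)\<^sup>2 - K))" for r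
    using var_le_centred[OF v _ z] big m K(2) mult_pos_pos[OF K(2) m] by linarith
  have full_mass: "(\<Sum>i\<in>T. r i * w i) \<le> sum r T" if "\<And>i. i \<in> T \<Longrightarrow> 0 \<le> r i" for r
    using that w01 by (intro sum_mono) (simp add: mult_left_le)
  have Bq: "0 < (\<Sum>i\<in>T. q i * (X i - \<tau>))"
  proof -
    have "(\<Sum>i\<in>T. q i * w i * (X i - \<tau>)) \<le> (\<Sum>i\<in>T. q i * (X i - \<tau>))"
    proof (rule sum_mono)
      fix i assume i: "i \<in> T"
      show "q i * w i * (X i - \<tau>) \<le> q i * (X i - \<tau>)"
      proof (cases "w i < 1")
        case True
        then show ?thesis using far0[OF i] q[OF i] w01[OF i]
          by (intro mult_right_mono) (auto simp: mult_left_le)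
      next
        case False then show ?thesis using w01[OF i] by simp
      qed
    qed
    then show ?thesis using right by simp
  qed
  define b where "b = (\<Sum>i\<in>T. p i * (X i - \<tau>))"
  show False
  proof (cases "b \<le> 0")
    case True
    define s where "s = (\<Sum>i\<in>T. q i * (X i - \<tau>))"
    have s: "0 < s" using Bq by (simp add: s_def)
    \<comment> \<open>The weights that balance the first moments of \<open>p\<close> and \<open>q\<close> about \<open>\<tau>\<close>.\<close>
    let ?r = "\<lambda>i. s * p i + (- b) * q i"
    have gp: "\<kappa> * sum p T \<le> (\<Sum>i\<in>T. p i * ((X i - \<tau>)\<^sup>2 - K))"
      using grow[OF p eqp, of "\<lambda>_. 1"] w01 by simp
    have gq: "\<kappa> * sum q T \<le> (\<Sum>i\<in>T. q i * ((X i - \<tau>)\<^sup>2 - K))"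
      using grow[OF q eqq, of "\<lambda>_. 1"] w01 by simp
    show False
    proof (rule no[of ?r])
      show "var_le T X K ?r" using mix[of s "-b"] s True by simp
      show "0 \<le> ?r i" if "i \<in> T" for i
        using p[OF that] q[OF that] s True by (intro add_nonneg_nonneg mult_nonneg_nonneg) auto
      have "(\<Sum>i\<in>T. ?r i * (X i - \<tau>)) =
          s * (\<Sum>i\<in>T. p i * (X i - \<tau>)) + (- b) * (\<Sum>i\<in>T. q i * (X i - \<tau>))"
        unfolding sum_distrib_left sum.distrib[symmetric]
        by (rule sum.cong) (auto simp: algebra_simps)
      also have "\<dots> = s * b + (- b) * s" by (simp only: s_def[symmetric] b_def[symmetric])
      finally have "(\<Sum>i\<in>T. ?r i * (X i - \<tau>)) = s * b + (- b) * s" .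
      then show "(\<Sum>i\<in>T. ?r i * (X i - \<tau>)) = 0" by simp
      have m: "sum ?r T = s * sum p T + (- b) * sum q T"
        unfolding sum_distrib_left sum.distrib[symmetric] by simp
      have "0 < sum p T" "0 \<le> sum q T"
        using full_mass[of p] p massp q by (auto simp: sum_nonneg)
      then show "0 < sum ?r T"
        unfolding m using s True by (intro add_pos_nonneg mult_pos_pos mult_nonneg_nonneg) auto
      have "(\<Sum>i\<in>T. ?r i * ((X i - \<tau>)\<^sup>2 - K)) =
          s * (\<Sum>i\<in>T. p i * ((X i - \<tau>)\<^sup>2 - K)) + (- b) * (\<Sum>i\<in>T. q i * ((X i - \<tau>)\<^sup>2 - K))"
        unfolding sum_distrib_left sum.distrib[symmetric]
        by (rule sum.cong) (auto simp: algebra_simps)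
      moreover have "s * (\<kappa> * sum p T) + (- b) * (\<kappa> * sum q T) \<le> \<dots>"
        using gp gq s True by (intro add_mono mult_left_mono) auto
      ultimately show "\<kappa> * sum ?r T \<le> (\<Sum>i\<in>T. ?r i * ((X i - \<tau>)\<^sup>2 - K))"
        unfolding m by (simp add: algebra_simps)
    qed
  next
    case False
    define v where "v r i = max (w i) (rank_cut T X r i)" for r i
    define f where "f r = (\<Sum>i\<in>T. p i * v r i * (X i - \<tau>))" for r
    define R where "R = real (card (X ` T)) + 1"
    have v01: "w i \<le> v r i" "v r i \<le> 1" if "i \<in> T" for r i
      using w01[OF that] lower_cutD(2)[OF lower_cut_rank_cut[OF fin] that] by (auto simp: v_def)
    have "f 0 \<le> 0"
    proof -
      have "f 0 = (\<Sum>i\<in>T. p i * w i * (X i - \<tau>))"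
        unfolding f_def v_def rank_cut_0 by (intro sum.cong refl) (simp add: max_absorb1 w01)
      then show ?thesis using left by simp
    qed
    moreover have "0 \<le> f R"
    proof -
      have "f R = b"
        unfolding f_def v_def b_def R_def by (intro sum.cong refl) (simp add: max_absorb2 w01 rank_cut_full fin)
      then show ?thesis using False by simp
    qed
    moreover have "0 \<le> R" by (simp add: R_def)
    moreover have "continuous_on {0..R} f"
      unfolding f_def v_def by (intro continuous_intros rank_cut_continuous)
    ultimately obtain r where r: "f r = 0"
      using IVT'[of f 0 0 R] by auto
    show False
    proof (rule no[of "\<lambda>i. p i * v r i"])
      show "var_le T X K (\<lambda>i. p i * v r i)"
        unfolding v_def by (intro pc lower_cut_max w lower_cut_rank_cut fin)
      show "0 \<le> p i * v r i" if "i \<in> T" for i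
        using p[OF that] v01[OF that] w01[OF that] by (metis mult_nonneg_nonneg order_trans)
      show "(\<Sum>i\<in>T. p i * v r i * (X i - \<tau>)) = 0" using r by (simp add: f_def)
      have "(\<Sum>i\<in>T. p i * w i) \<le> (\<Sum>i\<in>T. p i * v r i)"
        by (intro sum_mono mult_left_mono v01 p)
      then show "0 < (\<Sum>i\<in>T. p i * v r i)" using massp by simp
      show "\<kappa> * (\<Sum>i\<in>T. p i * v r i) \<le> (\<Sum>i\<in>T. p i * v r i * ((X i - \<tau>)\<^sup>2 - K))"
        using grow[OF p eqp, of "v r"] v01 by simp
    qed
  qed
qed

text \<open>If a mixture of the two cut-off parts had variance above \<open>K\<close>, the difference \<open>D\<close> of their normalised
  deviations would be an affine function of the centre with opposite signs at the two means. Its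
  zero is a point strictly between the means from which both parts have the same mean square
  deviation, and that deviation exceeds \<open>K\<close>. This is excluded by \<open>cut_no_balance\<close>.\<close>

lemma lower_cut_segment:
  assumes fin: "finite T" and K: "0 \<le> K"
    and p: "\<And>i. i \<in> T \<Longrightarrow> 0 \<le> p i" and q: "\<And>i. i \<in> T \<Longrightarrow> 0 \<le> q i"
    and pc: "\<And>w. lower_cut T X w \<Longrightarrow> var_le T X K (\<lambda>i. p i * w i)"
    and qc: "\<And>w. lower_cut T X w \<Longrightarrow> var_le T X K (\<lambda>i. q i * w i)"
    and mix: "\<And>s t. 0 \<le> s \<Longrightarrow> 0 \<le> t \<Longrightarrow> var_le T X K (\<lambda>i. s * p i + t * q i)"
    and w: "lower_cut T X w" and st: "0 \<le> s" "0 \<le> t"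
  shows "var_le T X K (\<lambda>i. s * (p i * w i) + t * (q i * w i))"
proof (rule ccontr)
  assume bad: "\<not> ?thesis"
  define a where "a = (\<Sum>i\<in>T. p i * w i)"
  define b where "b = (\<Sum>i\<in>T. q i * w i)"
  define P where "P \<tau> = (\<Sum>i\<in>T. p i * w i * ((X i - \<tau>)\<^sup>2 - K))" for \<tau>
  define Q where "Q \<tau> = (\<Sum>i\<in>T. q i * w i * ((X i - \<tau>)\<^sup>2 - K))" for \<tau>
  have pos: "0 < s * P \<tau> + t * Q \<tau>" for \<tau>
  proof -
    have "(\<Sum>i\<in>T. (s * (p i * w i) + t * (q i * w i)) * ((X i - \<tau>)\<^sup>2 - K)) = s * P \<tau> + t * Q \<tau>"
      unfolding P_def Q_def sum_distrib_left sum.distrib[symmetric]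
      by (rule sum.cong) (auto simp: algebra_simps)
    moreover have "0 < (\<Sum>i\<in>T. (s * (p i * w i) + t * (q i * w i)) * ((X i - \<tau>)\<^sup>2 - K))"
      using bad unfolding var_le_def by (simp add: not_le)
    ultimately show ?thesis by simp
  qed
  have wnn: "0 \<le> w i" if "i \<in> T" for i using lower_cutD(1)[OF w that] .
  have pw: "0 \<le> p i * w i" and qw: "0 \<le> q i * w i" if "i \<in> T" for i
    using p[OF that] q[OF that] wnn[OF that] by auto
  obtain \<tau>1 where \<tau>1: "P \<tau>1 \<le> 0" using pc[OF w] by (auto simp: var_le_def P_def)
  obtain \<tau>2 where \<tau>2: "Q \<tau>2 \<le> 0" using qc[OF w] by (auto simp: var_le_def Q_def)
  have a: "0 < a"
  proof (rule ccontr)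
    assume "\<not> 0 < a"
    then have "a = 0" using sum_nonneg[of T "\<lambda>i. p i * w i"] pw by (simp add: a_def)
    then have "\<forall>i\<in>T. p i * w i = 0"
      unfolding a_def using sum_nonneg_eq_0_iff[OF fin, of "\<lambda>i. p i * w i"] pw by blast
    then have "P \<tau>2 = 0" unfolding P_def by (intro sum.neutral) simp
    then show False using pos[of \<tau>2] mult_nonneg_nonpos[OF st(2) \<tau>2] by simp
  qed
  have b: "0 < b"
  proof (rule ccontr)
    assume "\<not> 0 < b"
    then have "b = 0" using sum_nonneg[of T "\<lambda>i. q i * w i"] qw by (simp add: b_def)
    then have "\<forall>i\<in>T. q i * w i = 0"
      unfolding b_def using sum_nonneg_eq_0_iff[OF fin, of "\<lambda>i. q i * w i"] qw by blast
    then have "Q \<tau>1 = 0" unfolding Q_def by (intro sum.neutral) simp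
    then show False using pos[of \<tau>1] mult_nonneg_nonpos[OF st(1) \<tau>1] by simp
  qed
  define x where "x = (\<Sum>i\<in>T. p i * w i * X i) / a"
  define y where "y = (\<Sum>i\<in>T. q i * w i * X i) / b"
  have Bp: "(\<Sum>i\<in>T. p i * w i * (X i - \<tau>)) = a * (x - \<tau>)" for \<tau>
  proof -
    have "(\<Sum>i\<in>T. p i * w i * (X i - \<tau>)) = a * x - a * \<tau>"
      using a unfolding x_def by (simp add: right_diff_distrib sum_subtractf sum_distrib_right[symmetric] a_def[symmetric])
    then show ?thesis by (simp add: algebra_simps)
  qed
  have Bq: "(\<Sum>i\<in>T. q i * w i * (X i - \<tau>)) = b * (y - \<tau>)" for \<tau>
  proof -
    have "(\<Sum>i\<in>T. q i * w i * (X i - \<tau>)) = b * y - b * \<tau>"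
      using b unfolding y_def by (simp add: right_diff_distrib sum_subtractf sum_distrib_right[symmetric] b_def[symmetric])
    then show ?thesis by (simp add: algebra_simps)
  qed
  have P: "P \<tau> = P x + a * (x - \<tau>)\<^sup>2" for \<tau>
    using sum_sq_shift[of "\<lambda>i. p i * w i" X \<tau> K T x] Bp[of x] by (simp add: P_def a_def algebra_simps)
  have Q: "Q \<tau> = Q y + b * (y - \<tau>)\<^sup>2" for \<tau>
    using sum_sq_shift[of "\<lambda>i. q i * w i" X \<tau> K T y] Bq[of y] by (simp add: Q_def b_def algebra_simps)
  have Px: "P x \<le> 0" using P[of \<tau>1] \<tau>1 a by (smt (verit) mult_nonneg_nonneg zero_le_power2)
  have Qy: "Q y \<le> 0" using Q[of \<tau>2] \<tau>2 b by (smt (verit) mult_nonneg_nonneg zero_le_power2)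
  have Qx: "0 < Q x"
    using pos[of x] mult_nonneg_nonpos[OF st(1) Px] mult_nonneg_nonpos[OF st(2), of "Q x"] by linarith
  have Py: "0 < P y"
    using pos[of y] mult_nonneg_nonpos[OF st(2) Qy] mult_nonneg_nonpos[OF st(1), of "P y"] by linarith
  have xy: "x \<noteq> y" using Px Py by auto
  define D where "D \<tau> = b * P \<tau> - a * Q \<tau>" for \<tau>
  \<comment> \<open>The quadratic terms cancel.\<close>
  have D: "D \<tau> = D x + 2 * a * b * (y - x) * (\<tau> - x)" for \<tau>
    unfolding D_def P[of \<tau>] Q[of \<tau>] Q[of x] by (simp add: power2_eq_square algebra_simps)
  have Dx: "D x < 0" unfolding D_def using Px Qx a b
    by (smt (verit) mult_nonneg_nonpos mult_pos_pos)
  have Dy: "0 < D y" unfolding D_def using Py Qy a b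
    by (smt (verit) mult_nonneg_nonpos mult_pos_pos)
  obtain \<theta> where \<theta>: "0 < \<theta>" "\<theta> < 1" "D (x + \<theta> * (y - x)) = 0"
  proof
    define c where "c = 2 * a * b * (y - x) * (y - x)"
    have line: "D (x + \<rho> * (y - x)) = D x + \<rho> * c" for \<rho>
      by (subst D) (simp add: c_def)
    then have c: "D y = D x + c" using line[of 1] by simp
    then have c0: "0 < c" using Dx Dy by simp
    show "0 < - D x / c" using Dx c0 by (simp add: divide_neg_pos)
    show "- D x / c < 1" unfolding divide_less_eq_1_pos[OF c0] using c Dy by linarith
    show "D (x + - D x / c * (y - x)) = 0" unfolding line using c0 by simp
  qed
  define \<tau> where "\<tau> = x + \<theta> * (y - x)"
  define \<kappa> where "\<kappa> = P \<tau> / a"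
  have eqp: "P \<tau> = \<kappa> * a" using a by (simp add: \<kappa>_def)
  have eqq: "Q \<tau> = \<kappa> * b"
    using \<theta>(3) a unfolding D_def \<kappa>_def \<tau>_def[symmetric] by (simp add: field_simps)
  have \<kappa>: "0 < \<kappa>"
  proof -
    have "0 < \<kappa> * (s * a + t * b)" using pos[of \<tau>] unfolding eqp eqq by (simp add: algebra_simps)
    then show ?thesis using a b st
      by (smt (verit) mult_nonneg_nonneg zero_less_mult_iff)
  qed
  have sx: "x - \<tau> = - (\<theta> * (y - x))" "y - \<tau> = (1 - \<theta>) * (y - x)"
    by (auto simp: \<tau>_def algebra_simps)
  show False
  proof (cases "x < y")
    case True
    show False
    proof (rule cut_no_balance[OF fin K \<kappa> p q pc qc mix w])
      show "(\<Sum>i\<in>T. p i * w i * (X i - \<tau>)) < 0" "0 < (\<Sum>i\<in>T. q i * w i * (X i - \<tau>))"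
        unfolding Bp Bq sx using a b \<theta> True by (auto simp: mult_pos_neg)
    qed (use eqp eqq a b in \<open>auto simp: P_def Q_def a_def b_def\<close>)
  next
    case False
    then have yx: "y < x" using xy by simp
    show False
    proof (rule cut_no_balance[OF fin K \<kappa> q p qc pc _ w])
      show "var_le T X K (\<lambda>i. s * q i + t * p i)" if "0 \<le> s" "0 \<le> t" for s t
        using mix[OF that(2,1)] by (simp add: add.commute)
      show "(\<Sum>i\<in>T. q i * w i * (X i - \<tau>)) < 0" "0 < (\<Sum>i\<in>T. p i * w i * (X i - \<tau>))"
        unfolding Bp Bq sx using a b \<theta> yx by (auto simp: mult_pos_neg mult_neg_pos zero_less_mult_iff mult_less_0_iff)
    qed (use eqp eqq a b in \<open>auto simp: P_def Q_def a_def b_def\<close>)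
  qed
qed

text \<open>A slice arises from a lower cut followed by an upper cut. After the lower cut the hypotheses of
  \<open>lower_cut_segment\<close> hold again for the reflected family \<open>- X\<close>, for which the upper cut is a lower cut.\<close>

lemma slices_le_add:
  assumes fin: "finite T" and K: "0 \<le> K"
    and p: "\<And>i. i \<in> T \<Longrightarrow> 0 \<le> p i" and q: "\<And>i. i \<in> T \<Longrightarrow> 0 \<le> q i"
    and ps: "slices_le T X K p" and qs: "slices_le T X K q"
    and mix: "\<And>s t. 0 \<le> s \<Longrightarrow> 0 \<le> t \<Longrightarrow> var_le T X K (\<lambda>i. s * p i + t * q i)"
  shows "slices_le T X K (\<lambda>i. p i + q i)"
  unfolding slices_le_def
proof (intro allI impI)
  fix w w' assume w: "lower_cut T X w" and w': "upper_cut T X w'"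
  have one: "upper_cut T X (\<lambda>_. 1)" by (auto simp: upper_cut_def lower_cut_def)
  have pc: "var_le T X K (\<lambda>i. p i * v i)" and qc: "var_le T X K (\<lambda>i. q i * v i)"
    if "lower_cut T X v" for v
    using ps qs that one unfolding slices_le_def by (metis (no_types, lifting) mult.right_neutral var_le_cong)+
  have half: "var_le T X K (\<lambda>i. s * (p i * w i) + t * (q i * w i))" if "0 \<le> s" "0 \<le> t" for s t
    using lower_cut_segment[OF fin K p q pc qc mix w that] by simp
  have "var_le T (\<lambda>i. - X i) K (\<lambda>i. 1 * (p i * w i * w' i) + 1 * (q i * w i * w' i))"
  proof (rule lower_cut_segment[OF fin K])
    show "0 \<le> p i * w i" "0 \<le> q i * w i" if "i \<in> T" for i
      using p[OF that] q[OF that] lower_cutD(1)[OF w that] by auto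
    show "var_le T (\<lambda>i. - X i) K (\<lambda>i. p i * w i * v i)"
         "var_le T (\<lambda>i. - X i) K (\<lambda>i. q i * w i * v i)" if "lower_cut T (\<lambda>i. - X i) v" for v
      unfolding var_le_reflect using ps qs w that unfolding slices_le_def upper_cut_def by blast+
    show "var_le T (\<lambda>i. - X i) K (\<lambda>i. s * (p i * w i) + t * (q i * w i))" if "0 \<le> s" "0 \<le> t" for s t
      unfolding var_le_reflect using half[OF that] .
    show "lower_cut T (\<lambda>i. - X i) w'" using w' by (simp add: upper_cut_def)
  qed auto
  then show "var_le T X K (\<lambda>i. (p i + q i) * w i * w' i)"
    unfolding var_le_reflect by (simp add: algebra_simps)
qed

section \<open>Merging pieces of equal weight\<close>

lemma slices_le_cong:
  "(\<And>i. i \<in> T \<Longrightarrow> p i = q i) \<Longrightarrow> slices_le T X K p = slices_le T X K q"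
  unfolding slices_le_def by (simp cong: var_le_cong)

text \<open>The variance along a chord between moment points at horizontal distance \<open>sqrt D\<close>, with variances
  \<open>u\<close> and \<open>v\<close> at its ends, is \<open>(1 - \<theta>) * u + \<theta> * v + \<theta> * (1 - \<theta>) * D\<close>. For \<open>\<beta> \<le> \<theta>\<close> the hypothesis at \<open>\<beta>\<close>
  bounds this by an expression that decreases in \<open>u\<close> and increases in \<open>v\<close>; the worst case \<open>u = 0\<close>, \<open>v = e\<close>
  gives \<open>\<theta> * (1 + \<beta> - \<theta>) / \<beta> * e\<close>, which is maximal at \<open>\<theta> = (1 + \<beta>) / 2\<close>. The maximum decreases in \<open>\<beta>\<close>.\<close>

lemma chord_bound:
  fixes \<alpha> \<beta> \<theta> u v D e :: real
  assumes u: "0 \<le> u" "u \<le> e" and v: "0 \<le> v" "v \<le> e"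
    and \<alpha>: "0 < \<alpha>" "\<alpha> \<le> \<beta>" "\<alpha> \<le> 1 - \<beta>"
    and chord: "(1 - \<beta>) * u + \<beta> * v + \<beta> * (1 - \<beta>) * D \<le> e"
    and \<theta>: "0 \<le> \<theta>" "\<theta> \<le> 1"
  shows "(1 - \<theta>) * u + \<theta> * v + \<theta> * (1 - \<theta>) * D \<le> (1 + \<alpha>)\<^sup>2 / (4 * \<alpha>) * e"
proof -
  have right: "(1 - \<theta>) * u + \<theta> * v + \<theta> * (1 - \<theta>) * D \<le> (1 + \<alpha>)\<^sup>2 / (4 * \<alpha>) * e"
    if u: "0 \<le> u" and v: "v \<le> e" "0 \<le> e" and \<beta>: "\<alpha> \<le> \<beta>" "\<beta> < 1"
      and chord: "(1 - \<beta>) * u + \<beta> * v + \<beta> * (1 - \<beta>) * D \<le> e"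
      and \<theta>: "\<beta> \<le> \<theta>" "\<theta> \<le> 1" for u v \<beta> \<theta>
  proof -
    have \<beta>0: "0 < \<beta>" using \<alpha> \<beta> by simp
    have "\<theta> * (1 - \<theta>) * ((1 - \<beta>) * u + \<beta> * v + \<beta> * (1 - \<beta>) * D) \<le> \<theta> * (1 - \<theta>) * e"
      using \<theta> \<beta>0 by (intro mult_left_mono chord) auto
    moreover have "0 \<le> (1 - \<beta>) * (1 - \<theta>) * (\<theta> - \<beta>) * u"
      using \<theta> \<beta> u by simp
    moreover have "\<beta> * \<theta> * (\<theta> - \<beta>) * v \<le> \<beta> * \<theta> * (\<theta> - \<beta>) * e"
      using \<theta> \<beta>0 v by (intro mult_left_mono) auto
    ultimately have "\<beta> * (1 - \<beta>) * ((1 - \<theta>) * u + \<theta> * v + \<theta> * (1 - \<theta>) * D)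
        \<le> (1 - \<beta>) * (\<theta> * (1 + \<beta> - \<theta>) * e)"
      by (simp add: algebra_simps power2_eq_square)
    then have "(1 - \<beta>) * (\<beta> * ((1 - \<theta>) * u + \<theta> * v + \<theta> * (1 - \<theta>) * D))
        \<le> (1 - \<beta>) * (\<theta> * (1 + \<beta> - \<theta>) * e)"
      by (simp add: mult.assoc mult.left_commute)
    then have "\<beta> * ((1 - \<theta>) * u + \<theta> * v + \<theta> * (1 - \<theta>) * D) \<le> \<theta> * (1 + \<beta> - \<theta>) * e"
      using \<beta> by simp
    also have "\<dots> \<le> (1 + \<beta>)\<^sup>2 / 4 * e"
    proof (rule mult_right_mono)
      have "0 \<le> (1 + \<beta> - 2 * \<theta>)\<^sup>2" by simp
      then show "\<theta> * (1 + \<beta> - \<theta>) \<le> (1 + \<beta>)\<^sup>2 / 4"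
        by (simp add: power2_eq_square algebra_simps)
    qed (use v in auto)
    finally have 1: "(1 - \<theta>) * u + \<theta> * v + \<theta> * (1 - \<theta>) * D \<le> (1 + \<beta>)\<^sup>2 / (4 * \<beta>) * e"
      using \<beta>0 by (simp add: field_simps)
    have "0 \<le> (\<beta> - \<alpha>) * (1 - \<alpha> * \<beta>)"
      using \<alpha> \<beta> by (simp add: mult_le_one)
    then have "(1 + \<beta>)\<^sup>2 * \<alpha> \<le> (1 + \<alpha>)\<^sup>2 * \<beta>"
      by (simp add: power2_eq_square algebra_simps)
    then have "(1 + \<beta>)\<^sup>2 / (4 * \<beta>) \<le> (1 + \<alpha>)\<^sup>2 / (4 * \<alpha>)"
      using \<alpha>(1) \<beta>0 by (simp add: field_simps)
    then show ?thesis using 1 v(2) mult_right_mono order_trans by blast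
  qed
  show ?thesis
  proof (cases "\<beta> \<le> \<theta>")
    case True
    then show ?thesis using right[of u v \<beta> \<theta>] u v \<alpha> chord \<theta> by auto
  next
    case False
    then have "(1 - (1 - \<theta>)) * v + (1 - \<theta>) * u + (1 - \<theta>) * (1 - (1 - \<theta>)) * D \<le> (1 + \<alpha>)\<^sup>2 / (4 * \<alpha>) * e"
      by (intro right[of v u "1 - \<beta>" "1 - \<theta>"]) (use u v \<alpha> chord \<theta> in \<open>auto simp: algebra_simps\<close>)
    then show ?thesis by (simp add: algebra_simps)
  qed
qed

lemma var_le_merge:
  assumes p: "\<And>i. i \<in> T \<Longrightarrow> 0 \<le> p i" and q: "\<And>i. i \<in> T \<Longrightarrow> 0 \<le> q i"
    and a: "0 < sum p T" and b: "0 < sum q T"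
    and vp: "var_le T X e p" and vq: "var_le T X e q" and vpq: "var_le T X e (\<lambda>i. p i + q i)"
    and \<alpha>: "0 < \<alpha>" "\<alpha> * (sum p T + sum q T) \<le> sum p T" "\<alpha> * (sum p T + sum q T) \<le> sum q T"
    and st: "0 \<le> s" "0 \<le> t"
  shows "var_le T X ((1 + \<alpha>)\<^sup>2 / (4 * \<alpha>) * e) (\<lambda>i. s * p i + t * q i)"
proof -
  define a b where "a = sum p T" and "b = sum q T"
  define x y where "x = (\<Sum>i\<in>T. p i * X i) / a" and "y = (\<Sum>i\<in>T. q i * X i) / b"
  define u v where "u = (\<Sum>i\<in>T. p i * (X i - x)\<^sup>2) / a" and "v = (\<Sum>i\<in>T. q i * (X i - y)\<^sup>2) / b"
  have ab: "0 < a" "0 < b" using assms by (auto simp: a_def b_def)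
  have Bp: "(\<Sum>i\<in>T. p i * (X i - x)) = 0"
    using ab unfolding sum_diff_const by (simp add: x_def a_def[symmetric])
  have Bq: "(\<Sum>i\<in>T. q i * (X i - y)) = 0"
    using ab unfolding sum_diff_const by (simp add: y_def b_def[symmetric])
  have P: "(\<Sum>i\<in>T. p i * ((X i - \<tau>)\<^sup>2 - K)) = a * (u + (x - \<tau>)\<^sup>2 - K)" for \<tau> K
  proof -
    have "(\<Sum>i\<in>T. p i * ((X i - x)\<^sup>2 - K)) = a * u - a * K"
      using ab unfolding sum_diff_const by (simp add: u_def a_def[symmetric])
    then show ?thesis
      using sum_sq_shift[of p X \<tau> K T x] Bp by (simp add: a_def[symmetric] algebra_simps)
  qed
  have Q: "(\<Sum>i\<in>T. q i * ((X i - \<tau>)\<^sup>2 - K)) = b * (v + (y - \<tau>)\<^sup>2 - K)" for \<tau> K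
  proof -
    have "(\<Sum>i\<in>T. q i * ((X i - y)\<^sup>2 - K)) = b * v - b * K"
      using ab unfolding sum_diff_const by (simp add: v_def b_def[symmetric])
    then show ?thesis
      using sum_sq_shift[of q X \<tau> K T y] Bq by (simp add: b_def[symmetric] algebra_simps)
  qed
  have R: "(\<Sum>i\<in>T. (s * p i + t * q i) * ((X i - \<tau>)\<^sup>2 - K)) =
      s * (a * (u + (x - \<tau>)\<^sup>2 - K)) + t * (b * (v + (y - \<tau>)\<^sup>2 - K))" for s t \<tau> K
    unfolding P[symmetric] Q[symmetric] sum_distrib_left sum.distrib[symmetric]
    by (rule sum.cong) (auto simp: algebra_simps)
  have "u \<le> e"
    using var_le_centred[OF vp _ Bp] ab P[of x e] by (simp add: a_def[symmetric] mult_le_0_iff)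
  moreover have "v \<le> e"
    using var_le_centred[OF vq _ Bq] ab Q[of y e] by (simp add: b_def[symmetric] mult_le_0_iff)
  moreover have "0 \<le> u" "0 \<le> v"
    unfolding u_def v_def using p q ab by (auto intro!: divide_nonneg_pos sum_nonneg)
  moreover have mean: "s * a * u + t * b * v + (s * a) * (t * b) / (s * a + t * b) * (y - x)\<^sup>2 - K * (s * a + t * b) =
      (\<Sum>i\<in>T. (s * p i + t * q i) * ((X i - \<tau>)\<^sup>2 - K))"
    if "0 < s * a + t * b" "\<tau> = (s * a * x + t * b * y) / (s * a + t * b)" for s t \<tau> K
  proof -
    \<comment> \<open>Distances from the two means to the mean \<open>\<tau>\<close> of the mixture.\<close>
    have 1: "x - \<tau> = - (t * b / (s * a + t * b) * (y - x))" "y - \<tau> = s * a / (s * a + t * b) * (y - x)"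
      using that by (auto simp: field_simps)
    have "s * a * (t * b / (s * a + t * b))\<^sup>2 + t * b * (s * a / (s * a + t * b))\<^sup>2 = (s * a) * (t * b) / (s * a + t * b)"
    proof -
      have "A * (B / (A + B))\<^sup>2 + B * (A / (A + B))\<^sup>2 = A * B / (A + B)" if "0 < A + B" for A B :: real
      proof -
        have "A * (B / (A + B))\<^sup>2 + B * (A / (A + B))\<^sup>2 = (A * B) * (A + B) / (A + B)\<^sup>2"
          by (simp add: power_divide power2_eq_square add_divide_distrib[symmetric] algebra_simps)
        then show ?thesis using that by (simp add: power2_eq_square)
      qed
      then show ?thesis using that(1) by blast
    qed
    then have "s * a * (x - \<tau>)\<^sup>2 + t * b * (y - \<tau>)\<^sup>2 = (s * a) * (t * b) / (s * a + t * b) * (y - x)\<^sup>2"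
      unfolding 1 power2_minus power_mult_distrib mult.assoc[symmetric] by (metis (no_types) distrib_right)
    then show ?thesis unfolding R by (simp add: algebra_simps)
  qed
  moreover have "(1 - b / (a + b)) * u + b / (a + b) * v + b / (a + b) * (1 - b / (a + b)) * (y - x)\<^sup>2 \<le> e"
  proof -
    let ?\<tau> = "(a * x + b * y) / (a + b)"
    have "(\<Sum>i\<in>T. (p i + q i) * (X i - ?\<tau>)) = (\<Sum>i\<in>T. p i * X i) + (\<Sum>i\<in>T. q i * X i) - (a + b) * ?\<tau>"
      unfolding a_def b_def sum.distrib[symmetric] sum_distrib_right sum_subtractf[symmetric]
      by (rule sum.cong) (auto simp: algebra_simps)
    also have "\<dots> = 0" using ab by (simp add: x_def y_def)
    finally have z: "(\<Sum>i\<in>T. (p i + q i) * (X i - ?\<tau>)) = 0" .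
    have "(\<Sum>i\<in>T. (p i + q i) * ((X i - ?\<tau>)\<^sup>2 - e)) \<le> 0"
      by (rule var_le_centred[OF vpq _ z]) (use p q in \<open>auto intro: sum_nonneg\<close>)
    then have "a * u + b * v + a * b / (a + b) * (y - x)\<^sup>2 - e * (a + b) \<le> 0"
      using mean[of 1 1 ?\<tau> e] ab by simp
    moreover have "1 - b / (a + b) = a / (a + b)" using ab by (simp add: field_simps)
    ultimately show ?thesis using ab
      by (simp add: divide_simps) (simp add: algebra_simps)
  qed
  moreover have "\<alpha> \<le> b / (a + b)" "\<alpha> \<le> 1 - b / (a + b)"
    using \<alpha> ab by (auto simp: a_def[symmetric] b_def[symmetric] field_simps)
  ultimately have chord: "(1 - \<theta>) * u + \<theta> * v + \<theta> * (1 - \<theta>) * (y - x)\<^sup>2 \<le> (1 + \<alpha>)\<^sup>2 / (4 * \<alpha>) * e"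
    if "0 \<le> \<theta>" "\<theta> \<le> 1" for \<theta>
    using that \<alpha>(1) by (intro chord_bound[of u e v \<alpha> "b / (a + b)"]) auto
  show ?thesis
  proof (cases "s * a + t * b = 0")
    case True
    then have "s = 0 \<and> t = 0" using ab st
      by (smt (verit) mult_nonneg_nonneg mult_pos_pos)
    then show ?thesis by (auto simp: var_le_def)
  next
    case False
    let ?m = "s * a + t * b"
    have m: "0 < ?m" using False ab st by (smt (verit) mult_nonneg_nonneg)
    have t01: "0 \<le> t * b / ?m" "t * b / ?m \<le> 1" using m ab st by (auto simp: field_simps)
    have 1: "1 - t * b / ?m = s * a / ?m" using m by (simp add: field_simps)
    have "s * a * u + t * b * v + (s * a) * (t * b) / ?m * (y - x)\<^sup>2
        = ?m * ((1 - t * b / ?m) * u + t * b / ?m * v + t * b / ?m * (1 - t * b / ?m) * (y - x)\<^sup>2)"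
    proof -
      have "A * u + B * v + A * B / n * d = n * (A / n * u + B / n * v + B / n * (A / n) * d)"
        if "n \<noteq> 0" for A B n d :: real
        using that by (simp add: distrib_left)
      then show ?thesis unfolding 1 using m by simp
    qed
    also have "\<dots> \<le> ?m * ((1 + \<alpha>)\<^sup>2 / (4 * \<alpha>) * e)"
      using m by (intro mult_left_mono chord t01) auto
    finally show ?thesis
      using mean[OF m refl, of "(1 + \<alpha>)\<^sup>2 / (4 * \<alpha>) * e"] unfolding var_le_def
      by (intro exI[of _ "(s * a * x + t * b * y) / ?m"]) (simp add: mult.commute)
  qed
qed

text \<open>The sum over \<open>j\<close> of the totals without the \<open>j\<close>-th piece is \<open>card J - 1\<close> times the total. As the
  bound with a fixed centre \<open>\<tau>\<close> is linear in the weights, it cannot fail for all of them.\<close>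

lemma remove_piece:
  assumes J: "finite J" "1 < card J"
    and P: "\<And>j i. j \<in> J \<Longrightarrow> i \<in> T \<Longrightarrow> 0 \<le> P j i"
    and v: "var_le T X e (\<lambda>i. \<Sum>j\<in>J. P j i)"
  shows "\<exists>j\<in>J. var_le T X e (\<lambda>i. \<Sum>l\<in>J - {j}. P l i)"
proof (rule ccontr)
  assume bad: "\<not> ?thesis"
  obtain \<tau> where \<tau>: "(\<Sum>i\<in>T. (\<Sum>j\<in>J. P j i) * ((X i - \<tau>)\<^sup>2 - e)) \<le> 0"
    using v by (auto simp: var_le_def)
  define F where "F j = (\<Sum>i\<in>T. P j i * ((X i - \<tau>)\<^sup>2 - e))" for j
  have F: "(\<Sum>i\<in>T. (\<Sum>j\<in>A. P j i) * ((X i - \<tau>)\<^sup>2 - e)) = sum F A" for A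
    unfolding F_def sum_distrib_right by (rule sum.swap)
  have "0 < sum F J - F j" if "j \<in> J" for j
  proof -
    have "0 < sum F (J - {j})"
    proof -
      have "\<not> (\<Sum>i\<in>T. (\<Sum>l\<in>J - {j}. P l i) * ((X i - \<tau>)\<^sup>2 - e)) \<le> 0"
        using bad that unfolding var_le_def by blast
      then show ?thesis unfolding F by simp
    qed
    then show ?thesis using that J(1) by (simp add: sum_diff1)
  qed
  then have "0 < (\<Sum>j\<in>J. sum F J - F j)"
    using J by (intro sum_pos) auto
  also have "\<dots> = (real (card J) - 1) * sum F J"
    by (simp add: sum_subtractf algebra_simps)
  finally show False using \<tau> J F[of J] by (simp add: zero_less_mult_iff)
qed

text \<open>Split off one piece such that the rest still has variance at most \<open>e\<close>. As there are at most \<open>N\<close>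
  pieces of equal mass, both parts have at least \<open>1 / N\<close> of the total mass, so that
  \<open>var_le_merge\<close> controls all their mixtures and \<open>slices_le_add\<close> applies.\<close>

lemma slices_le_combine:
  fixes P :: "'j \<Rightarrow> 'i \<Rightarrow> real" and N :: nat
  assumes fin: "finite T" and e: "0 \<le> e" and M: "0 < M"
    and K: "K = (1 + 1 / real N)\<^sup>2 / (4 * (1 / real N)) * e"
    and J: "finite J" "J \<noteq> {}" "card J \<le> N"
    and P: "\<And>j i. j \<in> J \<Longrightarrow> i \<in> T \<Longrightarrow> 0 \<le> P j i"
    and mass: "\<And>j. j \<in> J \<Longrightarrow> sum (P j) T = M"
    and vj: "\<And>j. j \<in> J \<Longrightarrow> var_le T X e (P j)"
    and sj: "\<And>j. j \<in> J \<Longrightarrow> slices_le T X K (P j)"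
    and v: "var_le T X e (\<lambda>i. \<Sum>j\<in>J. P j i)"
  shows "slices_le T X K (\<lambda>i. \<Sum>j\<in>J. P j i)"
  using J P mass vj sj v
proof (induction "card J" arbitrary: J)
  case 0
  then show ?case by simp
next
  case (Suc n)
  have K0: "0 \<le> K" unfolding K using e by simp
  show ?case
  proof (cases "n = 0")
    case True
    then obtain j where "J = {j}" using Suc.hyps(2) by (metis One_nat_def card_1_singletonE)
    then show ?thesis using Suc.prems(7) by simp
  next
    case False
    then have c: "1 < card J" using Suc.hyps(2) by simp
    obtain j where j: "j \<in> J" and vr: "var_le T X e (\<lambda>i. \<Sum>l\<in>J - {j}. P l i)"
      using remove_piece[OF Suc.prems(1) c Suc.prems(4,8)] by blast
    let ?q = "\<lambda>i. \<Sum>l\<in>J - {j}. P l i"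
    have cn: "card (J - {j}) = n" using Suc.hyps(2) j by simp
    have sr: "slices_le T X K ?q"
    proof (rule Suc.hyps(1))
      show "n = card (J - {j})" using cn by simp
      show "J - {j} \<noteq> {}" using cn False by (metis card.empty)
      show "card (J - {j}) \<le> N" using cn Suc.hyps(2) Suc.prems(3) by simp
    qed (use Suc.prems vr in auto)
    have massq: "sum ?q T = real n * M"
    proof -
      have "sum ?q T = (\<Sum>l\<in>J - {j}. sum (P l) T)" by (rule sum.swap)
      also have "\<dots> = (\<Sum>l\<in>J - {j}. M)" using Suc.prems(5) by (intro sum.cong) auto
      finally show ?thesis using cn by simp
    qed
    have split: "(\<Sum>l\<in>J. P l i) = P j i + ?q i" for i
      using Suc.prems(1) j by (simp add: sum.remove)
    have nN: "real n + 1 \<le> real N" "1 \<le> real n" using Suc.hyps(2) Suc.prems(3) False by auto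
    have nNM: "(1 + real n) * M \<le> real N * M" "M \<le> real n * M" 
      using nN M by (auto intro!: mult_right_mono)
    have "slices_le T X K (\<lambda>i. P j i + ?q i)"
    proof (rule slices_le_add[OF fin K0])
      fix s t :: real assume st: "0 \<le> s" "0 \<le> t"
      show "var_le T X K (\<lambda>i. s * P j i + t * ?q i)"
        unfolding K
      proof (rule var_le_merge)
        have total: "1 / real N * (sum (P j) T + sum ?q T) \<le> M"
          using nN nNM unfolding massq Suc.prems(5)[OF j] by (simp add: field_simps)
        show "1 / real N * (sum (P j) T + sum ?q T) \<le> sum (P j) T"
             "1 / real N * (sum (P j) T + sum ?q T) \<le> sum ?q T"
          using total nNM(2) unfolding massq Suc.prems(5)[OF j] by linarith+
        show "0 < sum (P j) T" "0 < sum ?q T"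
          using M nN unfolding massq Suc.prems(5)[OF j] by auto
        show "var_le T X e (\<lambda>i. P j i + ?q i)" using Suc.prems(8) unfolding split .
      qed (use Suc.prems j st vr nN in \<open>auto intro!: sum_nonneg\<close>)
    qed (use Suc.prems j sr in \<open>auto intro!: sum_nonneg\<close>)
    then show ?thesis unfolding split .
  qed
qed

text \<open>Dyadic cubes of generation \<open>m\<close> are indexed by integer vectors. The descendants of the cube \<open>l\<close>
  after \<open>r\<close> subdivisions are \<open>descendants (2 ^ r) l\<close>.\<close>

definition descendants :: "nat \<Rightarrow> ('n::finite \<Rightarrow> nat) \<Rightarrow> ('n \<Rightarrow> nat) set" where
  "descendants d l = {k. \<forall>i. k i div d = l i}"

lemma card_descendants:
  fixes l :: "'n::finite \<Rightarrow> nat"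
  assumes "0 < d"
  shows "finite (descendants d l)" "card (descendants d l) = d ^ CARD('n)"
proof -
  have eq: "{x. x div d = c} = {c * d..<c * d + d}" for c
  proof (intro equalityI subsetI)
    fix x assume "x \<in> {x. x div d = c}"
    then have "x = c * d + x mod d" by (auto simp: div_mult_mod_eq)
    then show "x \<in> {c * d..<c * d + d}" using mod_less_divisor[OF assms, of x] by auto
  next
    fix x assume x: "x \<in> {c * d..<c * d + d}"
    then have "x div d = c" by (intro div_nat_eqI) (auto simp: mult.commute)
    then show "x \<in> {x. x div d = c}" by simp
  qed
  have D: "descendants d l = (\<Pi>\<^sub>E i\<in>UNIV. {l i * d..<l i * d + d})"
  proof -
    have "x div d = c \<longleftrightarrow> x \<in> {c * d..<c * d + d}" for x c using eq[of c] by blast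
    then show ?thesis unfolding descendants_def PiE_UNIV_domain Pi_def by simp
  qed
  show "finite (descendants d l)" unfolding D by (intro finite_PiE) auto
  show "card (descendants d l) = d ^ CARD('n)" unfolding D by (subst card_PiE) auto
qed

lemma descendants_mult:
  "descendants (d * c) l = (\<Union>l'\<in>descendants c l. descendants d l')"
  unfolding descendants_def by (auto simp: div_mult2_eq)

lemma descendants_disjoint: "l \<noteq> l' \<Longrightarrow> descendants d l \<inter> descendants d l' = {}"
  by (auto simp: descendants_def)

text \<open>Induction over the generations: a single cube carries a constant, whose slices have variance
  \<open>0\<close>, and each cube is the union of \<open>2 ^ CARD('n)\<close> children with equally many descendants.\<close>

lemma slices_le_tree:
  fixes X :: "('n::finite \<Rightarrow> nat) \<Rightarrow> real"
  assumes fin: "finite T" and e: "0 \<le> e"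
    and K: "K = (1 + 1 / 2 ^ CARD('n))\<^sup>2 / (4 * (1 / 2 ^ CARD('n))) * e"
    and v: "\<And>r l. descendants (2 ^ r) l \<subseteq> T \<Longrightarrow> var_le T X e (indicator (descendants (2 ^ r) l))"
    and D: "descendants (2 ^ r) l \<subseteq> T"
  shows "slices_le T X K (indicator (descendants (2 ^ r) l))"
  using D
proof (induction r arbitrary: l)
  case 0
  have D: "descendants (2 ^ 0) l = {l}" by (auto simp: descendants_def)
  have K0: "0 \<le> K" unfolding K using e by simp
  have "(\<Sum>i\<in>T. indicator {l} i * w i * w' i * ((X i - X l)\<^sup>2 - K)) \<le> 0"
    if "lower_cut T X w" "upper_cut T X w'" for w w'
    using lower_cutD(1)[OF that(1)] lower_cutD(1)[OF that(2)[unfolded upper_cut_def]] K0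
    by (intro sum_nonpos) (auto simp: indicator_def mult_nonneg_nonpos)
  then show ?case unfolding D slices_le_def var_le_def by blast
next
  case (Suc r)
  let ?C = "descendants 2 l"
  have C: "finite ?C" "card ?C = 2 ^ CARD('n)" using card_descendants[of 2 l] by auto
  have U: "descendants (2 ^ Suc r) l = (\<Union>l'\<in>?C. descendants (2 ^ r) l')"
    using descendants_mult[of "2 ^ r" 2 l] by (simp add: mult.commute)
  have ind: "(\<Sum>l'\<in>?C. indicator (descendants (2 ^ r) l') i) = (indicator (descendants (2 ^ Suc r) l) i :: real)" for i
    unfolding U by (subst indicator_UN_disjoint) (auto simp: C disjoint_family_on_def descendants_disjoint)
  have sub: "descendants (2 ^ r) l' \<subseteq> T" if "l' \<in> ?C" for l'
    using Suc.prems that unfolding U by blast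
  have "slices_le T X K (\<lambda>i. \<Sum>l'\<in>?C. indicator (descendants (2 ^ r) l') i)"
  proof (rule slices_le_combine[OF fin e])
    show "(0::real) < (2 ^ r) ^ CARD('n)" by simp
    show "K = (1 + 1 / real (2 ^ CARD('n)))\<^sup>2 / (4 * (1 / real (2 ^ CARD('n)))) * e"
      unfolding K by simp
    show "?C \<noteq> {}" using C(2) by (metis card.empty power_not_zero zero_neq_numeral)
    show "sum (indicator (descendants (2 ^ r) l')) T = ((2 ^ r) ^ CARD('n) :: real)" if "l' \<in> ?C" for l'
    proof -
      have "sum (indicator (descendants (2 ^ r) l')) T = real (card (T \<inter> descendants (2 ^ r) l'))"
        using fin by (simp add: indicator_def sum.If_cases)
      then show ?thesis
        using sub[OF that] card_descendants(2)[of "2 ^ r" l'] by (simp add: Int_absorb1)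
    qed
    show "var_le T X e (indicator (descendants (2 ^ r) l'))" if "l' \<in> ?C" for l'
      by (rule v[OF sub[OF that]])
    show "slices_le T X K (indicator (descendants (2 ^ r) l'))" if "l' \<in> ?C" for l'
      by (rule Suc.IH[OF sub[OF that]])
    show "var_le T X e (\<lambda>i. \<Sum>l'\<in>?C. indicator (descendants (2 ^ r) l') i)"
      unfolding ind by (rule v[OF Suc.prems])
  qed (use C in auto)
  then show ?case unfolding ind .
qed

section \<open>Half-open dyadic cubes and averages over them\<close>

text \<open>Half-open cubes are disjoint and subdivide exactly; they differ from the closed dyadic cubes by
  null sets. The description by integer parts turns subdivision into integer division.\<close>

definition half_cube :: "nat \<Rightarrow> ('n::finite \<Rightarrow> nat) \<Rightarrow> (real^'n) set" where
  "half_cube m k = {x. \<forall>i. \<lfloor>2 ^ m * x $ i\<rfloor> = int (k i)}"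

abbreviation grid :: "nat \<Rightarrow> ('n::finite \<Rightarrow> nat) set" where
  "grid m \<equiv> descendants (2 ^ m) (\<lambda>_. 0)"

lemma grid_iff: "k \<in> grid m \<longleftrightarrow> (\<forall>i. k i < 2 ^ m)"
  by (simp add: descendants_def div_eq_0_iff)

lemma grid_finite [simp]: "finite (grid m)"
  by (simp add: card_descendants)

lemma card_grid: "card (grid m :: ('n::finite \<Rightarrow> nat) set) = (2 ^ m) ^ CARD('n)"
  by (simp add: card_descendants)

lemma half_cube_refine:
  "half_cube m l = (\<Union>k\<in>descendants (2 ^ r) l. half_cube (m + r) k)"
proof (intro equalityI subsetI)
  have fl: "\<lfloor>2 ^ m * y\<rfloor> = \<lfloor>2 ^ (m + r) * y\<rfloor> div 2 ^ r" for y :: real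
  proof -
    have "\<lfloor>(2 ^ (m + r) * y) / real_of_int (2 ^ r)\<rfloor> = \<lfloor>2 ^ (m + r) * y\<rfloor> div 2 ^ r"
      by (intro floor_divide_real_eq_div) simp
    then show ?thesis by (simp add: power_add)
  qed
  {
    fix x assume x: "x \<in> half_cube m l"
    define k where "k i = nat \<lfloor>2 ^ (m + r) * x $ i\<rfloor>" for i
    have nn: "0 \<le> \<lfloor>2 ^ (m + r) * x $ i\<rfloor>" for i
    proof -
      have "0 \<le> \<lfloor>2 ^ (m + r) * x $ i\<rfloor> div 2 ^ r" using x fl[of "x $ i"] by (auto simp: half_cube_def)
      then show ?thesis by (simp add: pos_imp_zdiv_nonneg_iff)
    qed
    have "k i div 2 ^ r = l i" for i
    proof -
      have "int (k i div 2 ^ r) = \<lfloor>2 ^ (m + r) * x $ i\<rfloor> div 2 ^ r"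
        using nn[of i] by (simp add: k_def zdiv_int)
      also have "\<dots> = int (l i)" using x fl[of "x $ i"] by (auto simp: half_cube_def)
      finally show ?thesis by simp
    qed
    moreover have "x \<in> half_cube (m + r) k" using nn by (auto simp: half_cube_def k_def)
    ultimately show "x \<in> (\<Union>k\<in>descendants (2 ^ r) l. half_cube (m + r) k)"
      by (auto simp: descendants_def)
  next
    fix x assume "x \<in> (\<Union>k\<in>descendants (2 ^ r) l. half_cube (m + r) k)"
    then obtain k where "\<And>i. k i div 2 ^ r = l i" "\<And>i. \<lfloor>2 ^ (m + r) * x $ i\<rfloor> = int (k i)"
      by (auto simp: descendants_def half_cube_def)
    then show "x \<in> half_cube m l"
      by (auto simp: half_cube_def fl simp flip: zdiv_int) (metis of_nat_numeral of_nat_power zdiv_int)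
  }
qed

lemma half_cube_disjoint: "k \<noteq> k' \<Longrightarrow> half_cube m k \<inter> half_cube m k' = {}"
  by (fastforce simp: half_cube_def)

lemma half_cube_iff:
  "x \<in> half_cube m k \<longleftrightarrow> (\<forall>i. real (k i) / 2 ^ m \<le> x $ i \<and> x $ i < (real (k i) + 1) / 2 ^ m)"
  by (simp add: half_cube_def floor_eq_iff field_simps)

lemma half_cube_cbox:
  fixes k :: "'n::finite \<Rightarrow> nat" and m :: nat
  defines "C \<equiv> cbox (\<chi> i. real (k i) / 2 ^ m) (\<chi> i. (real (k i) + 1) / 2 ^ m)"
  shows "half_cube m k \<subseteq> C" "C - half_cube m k \<in> null_sets lebesgue"
    "half_cube m k \<in> sets lebesgue" "emeasure lebesgue (half_cube m k) = ennreal ((1 / 2 ^ m) ^ CARD('n))"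
    "emeasure lebesgue C = ennreal ((1 / 2 ^ m) ^ CARD('n))"
proof -
  let ?a = "\<chi> i. real (k i) / 2 ^ m" and ?b = "\<chi> i. (real (k i) + 1) / 2 ^ m"
  show sub: "half_cube m k \<subseteq> C"
    by (auto simp: half_cube_iff C_def mem_box_cart less_imp_le)
  have "box ?a ?b \<subseteq> half_cube m k"
    by (auto simp: half_cube_iff mem_box_cart less_imp_le)
  then have "negligible (C - half_cube m k)"
    by (intro negligible_subset[OF negligible_frontier_interval[of ?a ?b]]) (auto simp: C_def)
  then show null: "C - half_cube m k \<in> null_sets lebesgue" by (simp add: negligible_iff_null_sets)
  have eq: "half_cube m k = C - (C - half_cube m k)" using sub by auto
  have C: "C \<in> sets lebesgue" by (simp add: C_def)
  show meas: "half_cube m k \<in> sets lebesgue"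
  proof -
    have "C - (C - half_cube m k) \<in> sets lebesgue" by (rule sets.Diff[OF C null_setsD2[OF null]])
    then show ?thesis by (simp only: eq[symmetric])
  qed
  have ne: "cbox ?a ?b \<noteq> {}"
    by (simp add: interval_ne_empty_cart field_simps)
  have "measure lborel C = (1 / 2 ^ m) ^ CARD('n)"
    unfolding C_def content_cbox_cart[OF ne] by (simp add: diff_divide_distrib[symmetric])
  then show eC: "emeasure lebesgue C = ennreal ((1 / 2 ^ m) ^ CARD('n))"
    using emeasure_eq_ennreal_measure[of lborel C] emeasure_lborel_cbox_finite[of ?a ?b]
    by (simp add: C_def)
  have "emeasure lebesgue C = emeasure lebesgue (half_cube m k \<union> (C - half_cube m k))"
    using sub by (simp add: Un_absorb1)
  also have "\<dots> = emeasure lebesgue (half_cube m k)"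
    using meas null by (rule emeasure_Un_null_set)
  finally show "emeasure lebesgue (half_cube m k) = ennreal ((1 / 2 ^ m) ^ CARD('n))" using eC by simp
qed

lemma measure_half_cube: "measure lebesgue (half_cube m (k :: 'n::finite \<Rightarrow> nat)) = (1 / 2 ^ m) ^ CARD('n)"
  by (simp add: measure_def half_cube_cbox(4))

abbreviation unit_half_cube :: "(real^'n::finite) set" where
  "unit_half_cube \<equiv> half_cube 0 (\<lambda>_. 0)"

lemma unit_half_cube_grid: "unit_half_cube = (\<Union>k\<in>grid m. half_cube m k)"
  using half_cube_refine[of 0 "\<lambda>_. 0" m] by simp

lemma half_cube_subset_unit: "k \<in> grid m \<Longrightarrow> half_cube m k \<subseteq> unit_half_cube"
  unfolding unit_half_cube_grid[of m] by blast

lemma set_integral_refine: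
  fixes f :: "real^'n::finite \<Rightarrow> real"
  assumes "set_integrable lebesgue (half_cube m l) f"
  shows "(LINT x:half_cube m l|lebesgue. f x)
    = (\<Sum>k\<in>descendants (2 ^ r) l. LINT x:half_cube (m + r) k|lebesgue. f x)"
  unfolding half_cube_refine[of m l r]
proof (rule set_integral_finite_Union)
  show "disjoint_family_on (half_cube (m + r)) (descendants (2 ^ r) l)"
    by (auto simp: disjoint_family_on_def half_cube_disjoint)
  show "set_integrable lebesgue (half_cube (m + r) k) f" if "k \<in> descendants (2 ^ r) l" for k
    using that half_cube_refine[of m l r] by (intro set_integrable_subset[OF assms half_cube_cbox(3)]) auto
qed (auto simp: card_descendants half_cube_cbox(3))

definition cube_avg :: "nat \<Rightarrow> (real^'n::finite \<Rightarrow> real) \<Rightarrow> ('n \<Rightarrow> nat) \<Rightarrow> real" where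
  "cube_avg m \<phi> k = (LINT x:half_cube m k|lebesgue. \<phi> x) * (2 ^ m) ^ CARD('n)"

lemma set_integrable_const_half_cube [simp]:
  "set_integrable lebesgue (half_cube m k) (\<lambda>_. c :: real)"
  using half_cube_cbox(3,4)[of m k] unfolding set_integrable_def
  by (cases "c = 0") auto

lemma set_integrable_sq_diff:
  fixes f :: "'a \<Rightarrow> real"
  assumes "set_integrable M A f" "set_integrable M A (\<lambda>x. (f x)\<^sup>2)" "set_integrable M A (\<lambda>_. 1 :: real)"
  shows "set_integrable M A (\<lambda>x. (f x - \<tau>)\<^sup>2)"
    "(LINT x:A|M. (f x - \<tau>)\<^sup>2) = (LINT x:A|M. (f x)\<^sup>2) - 2 * \<tau> * (LINT x:A|M. f x) + \<tau>\<^sup>2 * (LINT x:A|M. 1)"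
proof -
  have eq: "(f x - \<tau>)\<^sup>2 = ((f x)\<^sup>2 - (2 * \<tau>) * f x) + \<tau>\<^sup>2 * 1" for x
    by (simp add: power2_diff)
  have 1: "set_integrable M A (\<lambda>x. (2 * \<tau>) * f x)" "set_integrable M A (\<lambda>x. \<tau>\<^sup>2 * 1)"
    by (rule set_integrable_mult_right, rule assms)+
  show "set_integrable M A (\<lambda>x. (f x - \<tau>)\<^sup>2)"
    unfolding eq using assms 1 by (intro set_integral_add(1) set_integral_diff(1)) auto
  show "(LINT x:A|M. (f x - \<tau>)\<^sup>2) = (LINT x:A|M. (f x)\<^sup>2) - 2 * \<tau> * (LINT x:A|M. f x) + \<tau>\<^sup>2 * (LINT x:A|M. 1)"
    unfolding eq using assms 1
    by (simp only: set_integral_add(2) set_integral_diff set_integral_mult_right)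
qed

text \<open>The variance of \<open>\<phi>\<close> on the cube is nonnegative.\<close>

lemma cube_avg_jensen:
  fixes \<phi> :: "real^'n::finite \<Rightarrow> real"
  assumes "set_integrable lebesgue (half_cube m k) \<phi>" "set_integrable lebesgue (half_cube m k) (\<lambda>x. (\<phi> x)\<^sup>2)"
  shows "(cube_avg m \<phi> k - \<tau>)\<^sup>2 \<le> (LINT x:half_cube m k|lebesgue. (\<phi> x - \<tau>)\<^sup>2) * (2 ^ m) ^ CARD('n)"
proof -
  let ?H = "half_cube m k" and ?d = "(1 / 2 ^ m) ^ CARD('n) :: real" and ?D = "(2 ^ m) ^ CARD('n) :: real"
  have dD: "?d * ?D = 1" by (simp add: power_mult_distrib[symmetric])
  have one: "(LINT x:?H|lebesgue. 1) = ?d"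
    using half_cube_cbox(3,4)[of m k] by (subst set_integral_const) (auto simp: measure_half_cube)
  let ?I = "LINT x:?H|lebesgue. \<phi> x" and ?S = "LINT x:?H|lebesgue. (\<phi> x)\<^sup>2"
  have L: "(LINT x:?H|lebesgue. (\<phi> x - \<sigma>)\<^sup>2) = ?S - 2 * \<sigma> * ?I + \<sigma>\<^sup>2 * ?d" for \<sigma>
    using set_integrable_sq_diff(2)[OF assms, of \<sigma>] one by simp
  have "0 \<le> (LINT x:?H|lebesgue. (\<phi> x - ?I * ?D)\<^sup>2)"
    unfolding set_lebesgue_integral_def by (intro Bochner_Integration.integral_nonneg) auto
  then have "0 \<le> (?S - 2 * (?I * ?D) * ?I + (?I * ?D)\<^sup>2 * ?d) * ?D"
    unfolding L by (intro mult_nonneg_nonneg) auto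
  also have "\<dots> = ?S * ?D - (?I * ?D)\<^sup>2 * (2 - ?d * ?D)"
    by (simp add: power2_eq_square algebra_simps)
  finally have "(?I * ?D)\<^sup>2 \<le> ?S * ?D" using dD by simp
  moreover have "(?S - 2 * \<tau> * ?I + \<tau>\<^sup>2 * ?d) * ?D = ?S * ?D - 2 * \<tau> * (?I * ?D) + \<tau>\<^sup>2 * (?d * ?D)"
    by (simp add: algebra_simps)
  ultimately show ?thesis
    unfolding L cube_avg_def using dD by (simp add: power2_diff)
qed

text \<open>By \<open>cube_avg_jensen\<close> the averages over the cubes of generation \<open>m\<close> oscillate no more than \<open>\<phi>\<close>
  on each larger dyadic cube, so \<open>slices_le_tree\<close> applies to them.\<close>

lemma slices_le_cube_avg:
  fixes \<phi> :: "real^'n::finite \<Rightarrow> real"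
  assumes int: "set_integrable lebesgue unit_half_cube \<phi>" "set_integrable lebesgue unit_half_cube (\<lambda>x. (\<phi> x)\<^sup>2)"
    and e: "0 \<le> e"
    and osc: "\<And>j l. l \<in> grid j \<Longrightarrow> \<exists>\<tau>. (LINT x:half_cube j l|lebesgue. (\<phi> x - \<tau>)\<^sup>2) \<le> e * (1 / 2 ^ j) ^ CARD('n)"
    and K: "K = (1 + 1 / 2 ^ CARD('n))\<^sup>2 / (4 * (1 / 2 ^ CARD('n))) * e"
  shows "slices_le (grid m) (cube_avg m \<phi>) K (\<lambda>_. 1)"
proof -
  have int': "set_integrable lebesgue (half_cube j l) \<phi>" "set_integrable lebesgue (half_cube j l) (\<lambda>x. (\<phi> x)\<^sup>2)"
    if "l \<in> grid j" for j and l :: "'n \<Rightarrow> nat"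
    using int half_cube_subset_unit[OF that] half_cube_cbox(3) by (auto intro: set_integrable_subset)
  have "slices_le (grid m) (cube_avg m \<phi>) K (indicator (grid m))"
  proof (rule slices_le_tree[OF grid_finite e K])
    fix r and l :: "'n \<Rightarrow> nat"
    assume sub: "descendants (2 ^ r) l \<subseteq> grid m"
    \<comment> \<open>The last descendant of \<open>l\<close> still has index below \<open>2 ^ m\<close>, which bounds \<open>r\<close> and \<open>l\<close>.\<close>
    have mem: "(\<lambda>i. l i * 2 ^ r + (2 ^ r - 1)) \<in> descendants (2 ^ r) l"
    proof -
      have div: "(a * d + b) div d = a" if "b < d" for a b d :: nat
        using that by simp
      show ?thesis unfolding descendants_def mem_Collect_eq by (intro allI div) simp
    qed
    have last: "l i * 2 ^ r + (2 ^ r - 1) < 2 ^ m" for i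
      using subsetD[OF sub mem] unfolding grid_iff by blast
    then have "(l i + 1) * 2 ^ r \<le> 2 ^ m" for i
    proof -
      have "1 \<le> (2::nat) ^ r" by simp
      then show ?thesis using last[of i] unfolding add_mult_distrib by arith
    qed
    then have "(2::nat) ^ r \<le> 2 ^ m" by (metis add.commute le_add1 mult.commute mult_le_mono2 mult.right_neutral order_trans)
    then have rm: "r \<le> m" by simp
    define j where "j = m - r"
    have m: "m = j + r" using rm by (simp add: j_def)
    have lj: "l \<in> grid j"
      unfolding grid_iff
    proof
      fix i
      have "(l i + 1) * 2 ^ r \<le> 2 ^ j * 2 ^ r" using \<open>\<And>i. (l i + 1) * 2 ^ r \<le> 2 ^ m\<close> unfolding m power_add .
      then show "l i < 2 ^ j" unfolding mult_le_cancel2 by simp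
    qed
    let ?D = "(2 ^ m) ^ CARD('n) :: real"
    obtain \<tau> where \<tau>: "(LINT x:half_cube j l|lebesgue. (\<phi> x - \<tau>)\<^sup>2) \<le> e * (1 / 2 ^ j) ^ CARD('n)"
      using osc[OF lj] by blast
    have "(\<Sum>k\<in>grid m. indicator (descendants (2 ^ r) l) k * ((cube_avg m \<phi> k - \<tau>)\<^sup>2 - e))
        = (\<Sum>k\<in>descendants (2 ^ r) l. (cube_avg m \<phi> k - \<tau>)\<^sup>2 - e)"
      using sub by (simp add: sum.inter_restrict[symmetric] Int_absorb1 indicator_def if_distrib[of "\<lambda>x. x * _"] cong: if_cong)
    also have "\<dots> = (\<Sum>k\<in>descendants (2 ^ r) l. (cube_avg m \<phi> k - \<tau>)\<^sup>2) - e * (2 ^ r) ^ CARD('n)"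
      by (simp add: sum_subtractf card_descendants)
    also have "\<dots> \<le> (\<Sum>k\<in>descendants (2 ^ r) l. (LINT x:half_cube (j + r) k|lebesgue. (\<phi> x - \<tau>)\<^sup>2) * ?D) - e * (2 ^ r) ^ CARD('n)"
    proof (intro diff_right_mono sum_mono)
      fix k assume "k \<in> descendants (2 ^ r) l"
      then have "k \<in> grid m" using sub by blast
      then show "(cube_avg m \<phi> k - \<tau>)\<^sup>2 \<le> (LINT x:half_cube (j + r) k|lebesgue. (\<phi> x - \<tau>)\<^sup>2) * ?D"
        using cube_avg_jensen[OF int'] m by metis
    qed
    also have "\<dots> = (LINT x:half_cube j l|lebesgue. (\<phi> x - \<tau>)\<^sup>2) * ?D - e * (2 ^ r) ^ CARD('n)"
      unfolding sum_distrib_right[symmetric]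
      by (subst set_integral_refine[symmetric]) (auto intro: set_integrable_sq_diff int'[OF lj])
    also have "\<dots> \<le> e * (1 / 2 ^ j) ^ CARD('n) * ?D - e * (2 ^ r) ^ CARD('n)"
      using \<tau> by (intro diff_right_mono mult_right_mono) auto
    also have "\<dots> = 0"
      unfolding m power_add by (simp add: power_mult_distrib power_divide)
    finally show "var_le (grid m) (cube_avg m \<phi>) e (indicator (descendants (2 ^ r) l))"
      unfolding var_le_def by blast
  qed simp
  then show ?thesis
    by (rule slices_le_cong[THEN iffD1, rotated]) simp
qed

section \<open>Slices of a monotone function\<close>

lemma antimono_level_interval:
  fixes h :: "real \<Rightarrow> real"
  assumes "antimono_on {0<..<1} h"
  shows "is_interval {s \<in> {0<..<1}. h s = v}"
  unfolding is_interval_1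
proof (intro ballI allI impI)
  fix a b x assume ab: "a \<in> {s \<in> {0<..<1}. h s = v}" "b \<in> {s \<in> {0<..<1}. h s = v}" and x: "a \<le> x \<and> x \<le> b"
  then have "x \<in> {0<..<1}" by auto
  moreover have "h b \<le> h x" "h x \<le> h a"
    using ab x \<open>x \<in> {0<..<1}\<close> monotone_onD[OF assms, of x b] monotone_onD[OF assms, of a x] by auto
  ultimately show "x \<in> {s \<in> {0<..<1}. h s = v}" using ab by auto
qed

text \<open>Up to a null set the level sets \<open>L v\<close> are intervals that decompose \<open>{0<..<1}\<close>. Give each value the
  fraction of its level set that lies to the right of \<open>a\<close>, respectively to the left of \<open>b\<close>. As \<open>h\<close> is
  non-increasing, these fractions form a lower and an upper cut. Their product is the fraction inside
  \<open>{a<..<b}\<close>, unless one level set reaches beyond both ends; then \<open>h\<close> is constant on \<open>{a<..<b}\<close>.\<close>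

lemma antimono_slice:
  fixes h :: "real \<Rightarrow> real" and X :: "'i \<Rightarrow> real"
  assumes fin: "finite T" and K: "0 \<le> K" and \<delta>: "0 < \<delta>" "\<delta> * real (card T) = 1"
    and slices: "slices_le T X K (\<lambda>_. 1)"
    and h: "antimono_on {0<..<1} h"
    and law: "\<And>v. measure lebesgue {s \<in> {0<..<1}. h s = v} = \<delta> * real (card {k \<in> T. X k = v})"
    and ab: "0 \<le> a" "a < b" "b \<le> 1"
  shows "\<exists>\<tau>. (\<integral>\<^sup>+s. ennreal ((h s - \<tau>)\<^sup>2) * indicator {a<..<b} s \<partial>lebesgue) \<le> ennreal (K * (b - a))"
proof -
  let ?E = "{a<..<b}"
  define L where "L v = {s \<in> {0<..<1}. h s = v}" for v
  define V where "V = X ` T"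
  have V: "finite V" using fin by (simp add: V_def)
  have L: "L v \<in> sets lebesgue" for v
    unfolding L_def using real_interval_borel_measurable[OF antimono_level_interval[OF h]] by (auto intro: sets_completionI_sets)
  have Lfin: "A \<in> lmeasurable" if "A \<subseteq> L v" "A \<in> sets lebesgue" for A v
  proof (rule fmeasurableI2[of "{0..1}"])
    show "A \<subseteq> {0..1}" using that(1) by (auto simp: L_def)
  qed (use that in \<open>auto simp flip: box_real\<close>)
  have mL: "measure lebesgue (L v) = \<delta> * real (card {k \<in> T. X k = v})" for v
    using law by (simp add: L_def)
  have mLpos: "0 < measure lebesgue (L (X k))" if "k \<in> T" for k
    unfolding mL using \<delta>(1) fin that by (intro mult_pos_pos) (auto simp: card_gt_0_iff)
  show ?thesis
  proof (cases "\<exists>v. \<not> L v \<subseteq> {0<..<b} \<and> \<not> L v \<subseteq> {a<..<1}")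
    case True
    then obtain v s t where st: "s \<in> L v" "b \<le> s" "t \<in> L v" "t \<le> a"
      by (auto simp: L_def subset_eq not_less)
    have hv: "h x = v" if "x \<in> ?E" for x
    proof -
      have "h s \<le> h x" "h x \<le> h t"
        using st that ab monotone_onD[OF h, of x s] monotone_onD[OF h, of t x] by (auto simp: L_def)
      then show ?thesis using st by (auto simp: L_def)
    qed
    have "(\<integral>\<^sup>+s. ennreal ((h s - v)\<^sup>2) * indicator ?E s \<partial>lebesgue) = (\<integral>\<^sup>+s. 0 \<partial>(lebesgue :: real measure))"
      by (rule nn_integral_cong) (use hv in \<open>auto simp: indicator_def\<close>)
    then show ?thesis by (intro exI[of _ v]) simp
  next
    case False
    then have cover: "L v \<subseteq> {0<..<b} \<or> L v \<subseteq> {a<..<1}" for v by blast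
    define w' where "w' k = measure lebesgue (L (X k) \<inter> {0<..<b}) / measure lebesgue (L (X k))" for k
    define w where "w k = measure lebesgue (L (X k) \<inter> {a<..<1}) / measure lebesgue (L (X k))" for k
    have part: "0 \<le> measure lebesgue (L (X k) \<inter> A) / measure lebesgue (L (X k))"
       "measure lebesgue (L (X k) \<inter> A) / measure lebesgue (L (X k)) \<le> 1"
      if "k \<in> T" "A \<in> sets lebesgue" for k A
    proof -
      have "measure lebesgue (L (X k) \<inter> A) \<le> measure lebesgue (L (X k))"
        using L that by (intro measure_mono_fmeasurable Lfin) auto
      then show "measure lebesgue (L (X k) \<inter> A) / measure lebesgue (L (X k)) \<le> 1"
        using mLpos[OF that(1)] by simp
    qed simp
    have w1: "w k = 1" if "k \<in> T" "L (X k) \<subseteq> {a<..<1}" for k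
      using that mLpos[OF that(1)] by (simp add: w_def Int_absorb2)
    have w'1: "w' k = 1" if "k \<in> T" "L (X k) \<subseteq> {0<..<b}" for k
      using that mLpos[OF that(1)] by (simp add: w'_def Int_absorb2)
    have "lower_cut T X w"
    proof -
      have "w i = 1" if ij: "i \<in> T" "j \<in> T" "X i < X j" "0 < w j" for i j
      proof (rule w1[OF ij(1)])
        obtain s where s: "s \<in> L (X j)" "a < s"
          using ij(4) by (cases "L (X j) \<inter> {a<..<1} = {}") (auto simp: w_def)
        show "L (X i) \<subseteq> {a<..<1}"
        proof
          fix t assume t: "t \<in> L (X i)"
          have "\<not> t \<le> s"
          proof
            assume "t \<le> s"
            then have "h s \<le> h t" using s t monotone_onD[OF h, of t s] by (auto simp: L_def)
            then show False using s t ij(3) by (auto simp: L_def)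
          qed
          then show "t \<in> {a<..<1}" using s t by (auto simp: L_def)
        qed
      qed
      moreover have "0 \<le> w k \<and> w k \<le> 1" if "k \<in> T" for k
        using part[OF that] by (simp add: w_def)
      ultimately show ?thesis unfolding lower_cut_def by blast
    qed
    moreover have "upper_cut T X w'"
    proof -
      have "w' i = 1" if ij: "i \<in> T" "j \<in> T" "- X i < - X j" "0 < w' j" for i j
      proof (rule w'1[OF ij(1)])
        obtain s where s: "s \<in> L (X j)" "s < b"
          using ij(4) by (cases "L (X j) \<inter> {0<..<b} = {}") (auto simp: w'_def)
        show "L (X i) \<subseteq> {0<..<b}"
        proof
          fix t assume t: "t \<in> L (X i)"
          have "\<not> s \<le> t"
          proof
            assume "s \<le> t"
            then have "h t \<le> h s" using s t monotone_onD[OF h, of s t] by (auto simp: L_def)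
            then show False using s t ij(3) by (auto simp: L_def)
          qed
          then show "t \<in> {0<..<b}" using s t by (auto simp: L_def)
        qed
      qed
      moreover have "0 \<le> w' k \<and> w' k \<le> 1" if "k \<in> T" for k
        using part[OF that] by (simp add: w'_def)
      ultimately show ?thesis unfolding upper_cut_def lower_cut_def by blast
    qed
    ultimately obtain \<tau> where \<tau>: "(\<Sum>k\<in>T. 1 * w k * w' k * ((X k - \<tau>)\<^sup>2 - K)) \<le> 0"
      using slices unfolding slices_le_def var_le_def by blast
    have E: "measure lebesgue (L (X k) \<inter> ?E) = w k * w' k * measure lebesgue (L (X k))" if k: "k \<in> T" for k
      using cover[of "X k"]
    proof
      assume *: "L (X k) \<subseteq> {0<..<b}"
      then have "L (X k) \<inter> ?E = L (X k) \<inter> {a<..<1}" using ab by (auto simp: L_def)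
      then show ?thesis using w'1[OF k *] mLpos[OF k] by (simp add: w_def)
    next
      assume *: "L (X k) \<subseteq> {a<..<1}"
      then have "L (X k) \<inter> ?E = L (X k) \<inter> {0<..<b}" using ab by (auto simp: L_def)
      then show ?thesis using w1[OF k *] mLpos[OF k] by (simp add: w'_def)
    qed
    have group: "(\<Sum>v\<in>V. F v * measure lebesgue (L v \<inter> ?E)) = \<delta> * (\<Sum>k\<in>T. w k * w' k * F (X k))" for F
    proof -
      have "F v * measure lebesgue (L v \<inter> ?E) = (\<Sum>k\<in>{k \<in> T. X k = v}. \<delta> * (w k * w' k * F (X k)))" if "v \<in> V" for v
      proof -
        obtain k0 where k0: "k0 \<in> T" "X k0 = v" using \<open>v \<in> V\<close> by (auto simp: V_def)
        have "w k * w' k = w k0 * w' k0" if "X k = v" for k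
          using that k0 by (simp add: w_def w'_def)
        then have "(\<Sum>k\<in>{k \<in> T. X k = v}. \<delta> * (w k * w' k * F (X k))) = (\<Sum>k\<in>{k \<in> T. X k = v}. \<delta> * (w k0 * w' k0 * F v))"
          by (intro sum.cong) auto
        also have "\<dots> = F v * (w k0 * w' k0 * measure lebesgue (L v))"
          by (simp add: mL)
        also have "\<dots> = F v * measure lebesgue (L v \<inter> ?E)"
          using E[OF k0(1)] k0(2) by simp
        finally show ?thesis by simp
      qed
      then have "(\<Sum>v\<in>V. F v * measure lebesgue (L v \<inter> ?E)) = (\<Sum>v\<in>V. \<Sum>k\<in>{k \<in> T. X k = v}. \<delta> * (w k * w' k * F (X k)))"
        by (intro sum.cong) auto
      also have "\<dots> = (\<Sum>k\<in>T. \<delta> * (w k * w' k * F (X k)))"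
        unfolding V_def by (rule sum.image_gen[symmetric, OF fin])
      finally show ?thesis by (simp add: sum_distrib_left)
    qed
    have disj: "disjoint_family_on L A" for A by (auto simp: disjoint_family_on_def L_def)
    have "(\<Sum>v\<in>V. measure lebesgue (L v)) = 1"
    proof -
      have "(\<Sum>v\<in>V. measure lebesgue (L v)) = \<delta> * (\<Sum>v\<in>V. \<Sum>k\<in>{k \<in> T. X k = v}. 1)"
        unfolding mL by (simp add: sum_distrib_left)
      also have "\<dots> = \<delta> * (\<Sum>k\<in>T. 1)"
        unfolding V_def using sum.image_gen[OF fin, of "\<lambda>_. 1::real" X] by simp
      finally show ?thesis using \<delta> by simp
    qed
    then have mU: "measure lebesgue (\<Union>v\<in>V. L v) = 1"
      using measure_finite_Union[OF V, of L lebesgue] disj L Lfin by (auto simp: fmeasurable_def image_subset_iff less_top[symmetric])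
    define N where "N = {0<..<1} - (\<Union>v\<in>V. L v)"
    have N: "N \<in> null_sets lebesgue"
    proof -
      have U: "(\<Union>v\<in>V. L v) \<in> lmeasurable"
        using V Lfin[of "L v" v for v] L by (intro fmeasurable.finite_UN) auto
      have sub: "(\<Union>v\<in>V. L v) \<subseteq> {0<..<1}" by (auto simp: L_def)
      have I: "{0<..<1::real} \<in> lmeasurable" by (simp flip: box_real)
      have "measure lebesgue N = measure lebesgue {0<..<1::real} - 1"
        unfolding N_def using measurable_measure_Diff[OF I fmeasurableD[OF U] sub] mU by simp
      then have "measure lebesgue N = 0" by simp
      moreover have "N \<in> lmeasurable" unfolding N_def using I U by (intro fmeasurable_Diff) auto
      ultimately show ?thesis using negligible_iff_measure negligible_iff_null_sets by blast
    qed
    have Efin: "L v \<inter> ?E \<in> lmeasurable" for v using L by (intro Lfin[of _ v]) auto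
    have "(\<integral>\<^sup>+s. ennreal ((h s - \<tau>)\<^sup>2) * indicator ?E s \<partial>lebesgue)
        = (\<integral>\<^sup>+s. (\<Sum>v\<in>V. ennreal ((v - \<tau>)\<^sup>2) * indicator (L v \<inter> ?E) s) \<partial>lebesgue)"
    proof (rule nn_integral_cong_AE, rule AE_mp[OF AE_not_in[OF N]], rule AE_I2, rule impI)
      fix s assume s: "s \<notin> N"
      show "ennreal ((h s - \<tau>)\<^sup>2) * indicator ?E s = (\<Sum>v\<in>V. ennreal ((v - \<tau>)\<^sup>2) * indicator (L v \<inter> ?E) s)"
      proof (cases "s \<in> ?E")
        case True
        then have "s \<in> {0<..<1}" using ab by auto
        then have hs: "h s \<in> V" "s \<in> L (h s)" using s by (auto simp: N_def L_def)
        have "(\<Sum>v\<in>V. ennreal ((v - \<tau>)\<^sup>2) * indicator (L v \<inter> ?E) s) = (\<Sum>v\<in>{h s}. ennreal ((v - \<tau>)\<^sup>2) * indicator (L v \<inter> ?E) s)"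
          using V hs by (intro sum.mono_neutral_right) (auto simp: L_def indicator_def)
        also have "\<dots> = ennreal ((h s - \<tau>)\<^sup>2) * indicator (L (h s) \<inter> ?E) s"
          using sum.insert[of "{}" "h s" "\<lambda>v. ennreal ((v - \<tau>)\<^sup>2) * indicator (L v \<inter> ?E) s"] by simp
        also have "indicator (L (h s) \<inter> ?E) s = (indicator ?E s :: ennreal)"
          using hs(2) by (simp add: indicator_def)
        finally show ?thesis ..
      qed simp
    qed
    also have "\<dots> = (\<Sum>v\<in>V. ennreal ((v - \<tau>)\<^sup>2) * emeasure lebesgue (L v \<inter> ?E))"
    proof (subst nn_integral_sum)
      show "(\<lambda>s. ennreal ((v - \<tau>)\<^sup>2) * indicator (L v \<inter> ?E) s) \<in> borel_measurable lebesgue" for v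
        by (intro borel_measurable_times_ennreal borel_measurable_const borel_measurable_indicator fmeasurableD Efin)
    qed (simp only: nn_integral_cmult_indicator[OF fmeasurableD[OF Efin]])
    also have "\<dots> = ennreal (\<Sum>v\<in>V. (v - \<tau>)\<^sup>2 * measure lebesgue (L v \<inter> ?E))"
      using Efin by (subst sum_ennreal[symmetric]) (auto simp: emeasure_eq_measure2 ennreal_mult)
    also have "(\<Sum>v\<in>V. (v - \<tau>)\<^sup>2 * measure lebesgue (L v \<inter> ?E)) \<le> K * (b - a)"
    proof -
      have "(\<Sum>v\<in>V. ((v - \<tau>)\<^sup>2 - K) * measure lebesgue (L v \<inter> ?E)) \<le> 0"
        unfolding group using \<tau> \<delta> by (simp add: mult_nonneg_nonpos)
      then have "(\<Sum>v\<in>V. (v - \<tau>)\<^sup>2 * measure lebesgue (L v \<inter> ?E)) \<le> K * (\<Sum>v\<in>V. measure lebesgue (L v \<inter> ?E))"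
        by (simp add: algebra_simps sum_subtractf sum_distrib_left)
      also have "(\<Sum>v\<in>V. measure lebesgue (L v \<inter> ?E)) \<le> b - a"
      proof -
        have "(\<Sum>v\<in>V. measure lebesgue (L v \<inter> ?E)) = measure lebesgue (\<Union>v\<in>V. L v \<inter> ?E)"
        proof (rule measure_finite_Union[symmetric, OF V])
          show "(\<lambda>v. L v \<inter> ?E) ` V \<subseteq> sets lebesgue" using fmeasurableD[OF Efin] by blast
          show "disjoint_family_on (\<lambda>v. L v \<inter> ?E) V" using disj by (auto simp: disjoint_family_on_def)
          show "emeasure lebesgue (L v \<inter> ?E) \<noteq> \<infinity>" for v
            using fmeasurableD2[OF Efin, of v] unfolding infinity_ennreal_def .
        qed
        also have "\<dots> \<le> measure lebesgue ?E"
          using V Efin by (intro measure_mono_fmeasurable fmeasurable.finite_UN[THEN fmeasurableD]) (auto simp flip: box_real)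
        finally show ?thesis using ab by simp
      qed
      finally show ?thesis using K by (simp add: mult_left_mono)
    qed
    finally show ?thesis by (auto intro: ennreal_leI)
  qed
qed

section \<open>Convergence of rearrangements\<close>

lemma antimono_vimage_borel:
  fixes h :: "real \<Rightarrow> real"
  assumes h: "antimono_on {0<..<1} h" and A: "A \<in> sets borel"
  shows "{s \<in> {0<..<1}. h s \<in> A} \<in> sets borel"
proof -
  have "mono_on {0<..<1} (\<lambda>s. - h s)"
    using h by (auto simp: monotone_on_def)
  then have "(\<lambda>s. - h s) \<in> borel_measurable (restrict_space borel {0<..<1})"
    by (rule borel_measurable_mono_on_fnc)
  then have "(\<lambda>s. - (- h s)) \<in> borel_measurable (restrict_space borel {0<..<1})"
    by (rule borel_measurable_uminus)
  then have "h -` A \<inter> space (restrict_space borel {0<..<1}) \<in> sets (restrict_space borel {0<..<1::real})"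
    using A by (intro measurable_sets[of h]) simp
  then show ?thesis
    by (simp add: sets_restrict_space_iff space_restrict_space vimage_def Int_def conj_commute)
qed

text \<open>If \<open>h m s\<close> exceeded \<open>g (s - \<eta>)\<close> by more than \<open>\<delta>\<close>, then \<open>h m\<close> would do so on all of \<open>{0<..s}\<close>. Hence
  \<open>F m > g (s - \<eta>) + \<delta>\<close> on a set of measure at least \<open>s\<close>, whereas \<open>f > g (s - \<eta>)\<close> on a set of measure at most
  \<open>s - \<eta>\<close>; this contradicts convergence in measure. The lower estimate is symmetric.\<close>

lemma antimono_converges_at:
  fixes g :: "real \<Rightarrow> real" and h :: "nat \<Rightarrow> real \<Rightarrow> real"
  assumes M: "finite_measure M" and f: "f \<in> borel_measurable M" and F: "\<And>m. F m \<in> borel_measurable M"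
    and g: "antimono_on {0<..<1} g" and h: "\<And>m. antimono_on {0<..<1} (h m)"
    and lawg: "\<And>A. A \<in> sets borel \<Longrightarrow> measure lebesgue {s \<in> {0<..<1}. g s \<in> A} = measure M {x \<in> space M. f x \<in> A}"
    and lawh: "\<And>m A. A \<in> sets borel \<Longrightarrow> measure lebesgue {s \<in> {0<..<1}. h m s \<in> A} = measure M {x \<in> space M. F m x \<in> A}"
    and conv: "\<And>\<delta>. 0 < \<delta> \<Longrightarrow> (\<lambda>m. measure M {x \<in> space M. \<delta> < \<bar>F m x - f x\<bar>}) \<longlonglongrightarrow> 0"
    and s: "0 < s" "s < 1" and cont: "isCont g s"
  shows "(\<lambda>m. h m s) \<longlonglongrightarrow> g s"
proof -
  interpret finite_measure M by (rule M)
  note [measurable] = f F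
  have open_int: "{a<..<b} \<in> lmeasurable" for a b :: real
    using lmeasurable_box[of a b] by simp
  have lm: "{t \<in> {0<..<1}. k t \<in> A} \<in> lmeasurable" if "antimono_on {0<..<1} k" "A \<in> sets borel" for k :: "real \<Rightarrow> real" and A
  proof (rule fmeasurableI2[of "{0<..<1}"])
    show "{t \<in> {0<..<1}. k t \<in> A} \<in> sets lebesgue"
      using antimono_vimage_borel[OF that] by (auto intro: sets_completionI_sets)
  qed (auto intro: open_int)
  have mono: "measure lebesgue A \<le> measure lebesgue B" if "A \<subseteq> B" "A \<in> sets borel" "B \<in> lmeasurable" for A B :: "real set"
    using that by (intro measure_mono_fmeasurable) (auto intro: sets_completionI_sets)
  have "\<forall>\<^sub>F m in sequentially. dist (h m s) (g s) < e" if "0 < e" for e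
  proof -
    define \<delta> where "\<delta> = e / 2"
    have \<delta>: "0 < \<delta>" using that by (simp add: \<delta>_def)
    obtain d where d: "0 < d" "\<And>t. dist t s < d \<Longrightarrow> dist (g t) (g s) < \<delta>"
      using cont \<delta> unfolding continuous_at_eps_delta by metis
    define \<eta> where "\<eta> = min (d / 2) (min (s / 2) ((1 - s) / 2))"
    have \<eta>: "0 < \<eta>" "\<eta> < s" "s + \<eta> < 1" "\<eta> < d" using d s by (auto simp: \<eta>_def min_def field_simps)
    have gl: "g (s - \<eta>) < g s + \<delta>" and gr: "g s - \<delta> < g (s + \<eta>)"
      using d(2)[of "s - \<eta>"] d(2)[of "s + \<eta>"] \<eta> by (auto simp: dist_real_def)
    have "\<forall>\<^sub>F m in sequentially. measure M {x \<in> space M. \<delta> < \<bar>F m x - f x\<bar>} < \<eta>"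
      using conv[OF \<delta>] \<eta>(1) by (rule order_tendstoD(2))
    then show ?thesis
    proof eventually_elim
      case (elim m)
      have up: "h m s < g s + e"
      proof (rule ccontr)
        assume "\<not> ?thesis"
        then have hs: "g (s - \<eta>) + \<delta> < h m s" using gl by (simp add: \<delta>_def)
        have "measure lebesgue {0<..s} \<le> measure lebesgue {t \<in> {0<..<1}. h m t \<in> {g (s - \<eta>) + \<delta> <..}}"
        proof (rule mono[OF _ _ lm[OF h]])
          show "{0<..s} \<subseteq> {t \<in> {0<..<1}. h m t \<in> {g (s - \<eta>) + \<delta> <..}}"
          proof
            fix t assume t: "t \<in> {0<..s}"
            then have "h m s \<le> h m t" using s monotone_onD[OF h, of t s m] by auto
            then show "t \<in> {t \<in> {0<..<1}. h m t \<in> {g (s - \<eta>) + \<delta> <..}}" using hs t s by auto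
          qed
        qed auto
        also have "\<dots> = measure M {x \<in> space M. F m x \<in> {g (s - \<eta>) + \<delta> <..}}" by (rule lawh) simp
        also have "\<dots> \<le> measure M ({x \<in> space M. f x \<in> {g (s - \<eta>) <..}} \<union> {x \<in> space M. \<delta> < \<bar>F m x - f x\<bar>})"
          by (intro finite_measure_mono) auto
        also have "\<dots> \<le> measure M {x \<in> space M. f x \<in> {g (s - \<eta>) <..}} + measure M {x \<in> space M. \<delta> < \<bar>F m x - f x\<bar>}"
          by (intro measure_Un_le) auto
        also have "measure M {x \<in> space M. f x \<in> {g (s - \<eta>) <..}} = measure lebesgue {t \<in> {0<..<1}. g t \<in> {g (s - \<eta>) <..}}"
          by (rule lawg[symmetric]) simp
        also have "\<dots> \<le> measure lebesgue {0<..<s - \<eta>}"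
        proof (rule mono)
          show "{t \<in> {0<..<1}. g t \<in> {g (s - \<eta>) <..}} \<subseteq> {0<..<s - \<eta>}"
          proof
            fix t assume t: "t \<in> {t \<in> {0<..<1}. g t \<in> {g (s - \<eta>) <..}}"
            have "\<not> s - \<eta> \<le> t" using t \<eta> s monotone_onD[OF g, of "s - \<eta>" t] by auto
            then show "t \<in> {0<..<s - \<eta>}" using t by auto
          qed
        qed (rule antimono_vimage_borel[OF g], simp, rule open_int)
        finally show False using elim s \<eta> by simp
      qed
      have down: "g s - e < h m s"
      proof (rule ccontr)
        assume "\<not> ?thesis"
        then have hs: "h m s < g (s + \<eta>) - \<delta>" using gr by (simp add: \<delta>_def)
        have "measure lebesgue {s..<1} \<le> measure lebesgue {t \<in> {0<..<1}. h m t \<in> {..<g (s + \<eta>) - \<delta>}}"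
        proof (rule mono[OF _ _ lm[OF h]])
          show "{s..<1} \<subseteq> {t \<in> {0<..<1}. h m t \<in> {..<g (s + \<eta>) - \<delta>}}"
          proof
            fix t assume t: "t \<in> {s..<1}"
            then have "h m t \<le> h m s" using s monotone_onD[OF h, of s t m] by auto
            then show "t \<in> {t \<in> {0<..<1}. h m t \<in> {..<g (s + \<eta>) - \<delta>}}" using hs t s by auto
          qed
        qed auto
        also have "\<dots> = measure M {x \<in> space M. F m x \<in> {..<g (s + \<eta>) - \<delta>}}" by (rule lawh) simp
        also have "\<dots> \<le> measure M ({x \<in> space M. f x \<in> {..<g (s + \<eta>)}} \<union> {x \<in> space M. \<delta> < \<bar>F m x - f x\<bar>})"
          by (intro finite_measure_mono) auto
        also have "\<dots> \<le> measure M {x \<in> space M. f x \<in> {..<g (s + \<eta>)}} + measure M {x \<in> space M. \<delta> < \<bar>F m x - f x\<bar>}"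
          by (intro measure_Un_le) auto
        also have "measure M {x \<in> space M. f x \<in> {..<g (s + \<eta>)}} = measure lebesgue {t \<in> {0<..<1}. g t \<in> {..<g (s + \<eta>)}}"
          by (rule lawg[symmetric]) simp
        also have "\<dots> \<le> measure lebesgue {s + \<eta><..<1}"
        proof (rule mono)
          show "{t \<in> {0<..<1}. g t \<in> {..<g (s + \<eta>)}} \<subseteq> {s + \<eta><..<1}"
          proof
            fix t assume t: "t \<in> {t \<in> {0<..<1}. g t \<in> {..<g (s + \<eta>)}}"
            have "\<not> t \<le> s + \<eta>" using t \<eta> s monotone_onD[OF g, of t "s + \<eta>"] by auto
            then show "t \<in> {s + \<eta><..<1}" using t by auto
          qed
        qed (rule antimono_vimage_borel[OF g], simp, rule open_int)
        finally show False using elim s \<eta> by simp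
      qed
      show "dist (h m s) (g s) < e" using up down by (auto simp: dist_real_def)
    qed
  qed
  then show ?thesis by (auto simp: tendsto_iff)
qed

lemma antimono_AE_isCont:
  fixes g :: "real \<Rightarrow> real"
  assumes "antimono_on {0<..<1} g"
  shows "AE s in lebesgue. s \<in> {0<..<1} \<longrightarrow> isCont g s"
proof -
  have "mono_on {0<..<1} (\<lambda>s. - g s)" using assms by (auto simp: monotone_on_def)
  then have "countable {s \<in> {0<..<1}. \<not> isCont (\<lambda>s. - g s) s}"
    by (intro mono_on_ctble_discont_open) auto
  then have "countable {s \<in> {0<..<1}. \<not> isCont g s}"
  proof (rule countable_subset[rotated], safe)
    fix s assume "isCont (\<lambda>s. - g s) s" "\<not> isCont g s"
    then show False using isCont_minus[of s "\<lambda>s. - g s"] by simp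
  qed
  then have "{s \<in> {0<..<1}. \<not> isCont g s} \<in> null_sets lebesgue"
    by (intro null_sets_completionI countable_imp_null_set_lborel)
  then show ?thesis by (rule AE_I') auto
qed

section \<open>Approximation by dyadic averages\<close>

text \<open>The conditional expectation of \<open>\<phi>\<close> with respect to the cubes of generation \<open>m\<close>.\<close>

definition dyadic_step :: "nat \<Rightarrow> (real^'n::finite \<Rightarrow> real) \<Rightarrow> real^'n \<Rightarrow> real" where
  "dyadic_step m \<phi> x = (\<Sum>k\<in>grid m. cube_avg m \<phi> k * indicator (half_cube m k) x)"

lemma dyadic_step_eq:
  assumes "k \<in> grid m" "x \<in> half_cube m k"
  shows "dyadic_step m \<phi> x = cube_avg m \<phi> k"
proof -
  have "dyadic_step m \<phi> x = (\<Sum>k'\<in>grid m. if k' = k then cube_avg m \<phi> k else 0)"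
    unfolding dyadic_step_def using assms half_cube_disjoint[of _ k m]
    by (intro sum.cong) (auto simp: indicator_def)
  then show ?thesis using assms by simp
qed

lemma dyadic_step_measurable: "dyadic_step m \<phi> \<in> borel_measurable lebesgue"
  unfolding dyadic_step_def[abs_def]
  by (intro borel_measurable_sum borel_measurable_times borel_measurable_const borel_measurable_indicator half_cube_cbox(3))

lemma dyadic_step_integrable:
  fixes \<phi> :: "real^'n::finite \<Rightarrow> real"
  shows "set_integrable lebesgue unit_half_cube (dyadic_step m \<phi>)"
proof -
  have "set_integrable lebesgue unit_half_cube (\<lambda>x. cube_avg m \<phi> k * indicator (half_cube m k) x)" for k :: "'n \<Rightarrow> nat"
  proof -
    have "integrable lebesgue (\<lambda>x. indicator (half_cube m k) x *\<^sub>R (indicator unit_half_cube x *\<^sub>R (1::real)))"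
      by (rule integrable_mult_indicator[OF half_cube_cbox(3) set_integrable_const_half_cube[unfolded set_integrable_def]])
    then have "integrable lebesgue (\<lambda>x. cube_avg m \<phi> k * (indicator (half_cube m k) x * indicator unit_half_cube x))"
      by (intro integrable_mult_right) simp
    then show ?thesis unfolding set_integrable_def by (simp add: mult_ac)
  qed
  then show ?thesis
    unfolding set_integrable_def dyadic_step_def[abs_def] scaleR_sum_right
    by (intro Bochner_Integration.integrable_sum)
qed

lemma set_integrable_half_cube:
  fixes f :: "real^'n::finite \<Rightarrow> real"
  assumes "set_integrable lebesgue unit_half_cube f" "k \<in> grid m"
  shows "set_integrable lebesgue (half_cube m k) f"
  using half_cube_subset_unit[OF assms(2)] half_cube_cbox(3) by (auto intro: set_integrable_subset[OF assms(1)])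

lemma cube_scale: "(1 / 2 ^ m) ^ d * (2 ^ m) ^ d = (1 :: real)"
  by (simp add: power_mult_distrib[symmetric])

lemma cube_avg_between:
  fixes f :: "real^'n::finite \<Rightarrow> real"
  assumes f: "set_integrable lebesgue (half_cube m k) f"
    and b: "\<And>y. y \<in> half_cube m k \<Longrightarrow> \<bar>f y - c\<bar> \<le> e"
  shows "\<bar>cube_avg m f k - c\<bar> \<le> e"
proof -
  let ?H = "half_cube m k" and ?d = "(1 / 2 ^ m) ^ CARD('n) :: real" and ?D = "(2 ^ m) ^ CARD('n) :: real"
  have const: "(LINT x:?H|lebesgue. a) = ?d * a" for a :: real
    using half_cube_cbox(3,4)[of m k] by (subst set_integral_const) (auto simp: measure_half_cube)
  have dD: "?d * ?D = 1" by (rule cube_scale)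
  have "(LINT x:?H|lebesgue. f x) \<le> (LINT x:?H|lebesgue. c + e)"
    using b by (intro set_integral_mono f) (fastforce simp: abs_le_iff)+
  moreover have "(LINT x:?H|lebesgue. c - e) \<le> (LINT x:?H|lebesgue. f x)"
    using b by (intro set_integral_mono f) (fastforce simp: abs_le_iff)+
  ultimately have "cube_avg m f k \<le> ?d * (c + e) * ?D" "?d * (c - e) * ?D \<le> cube_avg m f k"
    unfolding cube_avg_def const by (auto intro!: mult_right_mono)
  moreover have "?d * a * ?D = a" for a using dD by (metis mult.assoc mult.commute mult.right_neutral)
  ultimately show ?thesis by (simp add: abs_le_iff)
qed

lemma dyadic_step_contraction:
  fixes f :: "real^'n::finite \<Rightarrow> real"
  assumes f: "set_integrable lebesgue unit_half_cube f"
  shows "(LINT x:unit_half_cube|lebesgue. \<bar>dyadic_step m f x\<bar>) \<le> (LINT x:unit_half_cube|lebesgue. \<bar>f x\<bar>)"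
proof -
  let ?d = "(1 / 2 ^ m) ^ CARD('n) :: real" and ?D = "(2 ^ m) ^ CARD('n) :: real"
  have split: "(LINT x:unit_half_cube|lebesgue. u x) = (\<Sum>k\<in>grid m. LINT x:half_cube m k|lebesgue. u x)"
    if "set_integrable lebesgue unit_half_cube u" for u :: "real^'n \<Rightarrow> real"
    using set_integral_refine[OF that, of m] by simp
  have "(LINT x:unit_half_cube|lebesgue. \<bar>dyadic_step m f x\<bar>) = (\<Sum>k\<in>grid m. LINT x:half_cube m k|lebesgue. \<bar>dyadic_step m f x\<bar>)"
    by (rule split) (intro set_integrable_abs dyadic_step_integrable)
  also have "\<dots> \<le> (\<Sum>k\<in>grid m. LINT x:half_cube m k|lebesgue. \<bar>f x\<bar>)"
  proof (rule sum_mono)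
    fix k :: "'n \<Rightarrow> nat" assume k: "k \<in> grid m"
    have "(LINT x:half_cube m k|lebesgue. \<bar>dyadic_step m f x\<bar>) = (LINT x:half_cube m k|lebesgue. \<bar>cube_avg m f k\<bar>)"
      using half_cube_cbox(3) by (intro set_lebesgue_integral_cong) (auto simp: dyadic_step_eq[OF k])
    also have "\<dots> = ?d * \<bar>cube_avg m f k\<bar>"
      using half_cube_cbox(3,4)[of m k] by (subst set_integral_const) (auto simp: measure_half_cube)
    also have "\<dots> = \<bar>LINT x:half_cube m k|lebesgue. f x\<bar>"
      unfolding cube_avg_def abs_mult using cube_scale[of m "CARD('n)"] by (simp add: mult.left_commute)
    also have "\<dots> \<le> (LINT x:half_cube m k|lebesgue. \<bar>f x\<bar>)"
      using set_integral_norm_bound[OF set_integrable_half_cube[OF f k]] by simp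
    finally show "(LINT x:half_cube m k|lebesgue. \<bar>dyadic_step m f x\<bar>) \<le> (LINT x:half_cube m k|lebesgue. \<bar>f x\<bar>)" .
  qed
  also have "\<dots> = (LINT x:unit_half_cube|lebesgue. \<bar>f x\<bar>)"
    by (rule split[symmetric]) (intro set_integrable_abs f)
  finally show ?thesis .
qed

lemma dyadic_step_diff:
  assumes "set_integrable lebesgue unit_half_cube f" "set_integrable lebesgue unit_half_cube g"
  shows "dyadic_step m (\<lambda>x. f x - g x) x = dyadic_step m f x - dyadic_step m g x"
  unfolding dyadic_step_def sum_subtractf[symmetric]
  by (rule sum.cong)
     (auto simp: cube_avg_def set_integral_diff set_integrable_half_cube[OF assms(1)] set_integrable_half_cube[OF assms(2)] algebra_simps)

lemma dyadic_step_uniform: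
  fixes h :: "real^'n::finite \<Rightarrow> real"
  assumes h: "continuous_on UNIV h" and e: "0 < e"
  shows "\<exists>m0. \<forall>m\<ge>m0. \<forall>x\<in>unit_half_cube. \<bar>dyadic_step m h x - h x\<bar> \<le> e"
proof -
  have hi: "set_integrable lebesgue unit_half_cube h"
  proof (rule set_integrable_subset)
    show "set_integrable lebesgue (cbox 0 (\<chi> i. 1)) h"
      using h by (intro absolutely_integrable_continuous) (auto intro: continuous_on_subset)
    show "unit_half_cube \<subseteq> cbox 0 (\<chi> i. 1)"
      using half_cube_cbox(1)[of 0 "\<lambda>_. 0"] by (simp add: zero_vec_def)
  qed (rule half_cube_cbox(3))
  have "uniformly_continuous_on (cbox 0 (\<chi> i. 1)) h"
    using h by (intro compact_uniformly_continuous) (auto intro: continuous_on_subset)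
  then obtain d where d: "0 < d" "\<And>x y. x \<in> cbox 0 (\<chi> i. 1) \<Longrightarrow> y \<in> cbox 0 (\<chi> i. 1) \<Longrightarrow> dist y x < d \<Longrightarrow> dist (h y) (h x) < e"
    unfolding uniformly_continuous_on_def using e by metis
  obtain m0 where m0: "real CARD('n) / 2 ^ m0 < d"
  proof -
    obtain m0 where "real CARD('n) / d < 2 ^ m0" using real_arch_pow[of 2] by auto
    then show ?thesis using that d(1) by (simp add: field_simps)
  qed
  show ?thesis
  proof (intro exI allI impI ballI)
    fix m x assume m: "m0 \<le> m" and x: "x \<in> (unit_half_cube :: (real^'n) set)"
    obtain k where k: "k \<in> grid m" "x \<in> half_cube m k" using x unfolding unit_half_cube_grid[of m] by blast
    have "\<bar>h y - h x\<bar> \<le> e" if y: "y \<in> half_cube m k" for y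
    proof -
      have "dist y x \<le> (\<Sum>i\<in>UNIV. \<bar>(y - x) $ i\<bar>)" unfolding dist_norm by (rule norm_le_l1_cart)
      also have "\<dots> \<le> (\<Sum>i\<in>(UNIV :: 'n set). 1 / 2 ^ m)"
      proof (rule sum_mono)
        fix i
        have "real (k i) / 2 ^ m \<le> x $ i" "x $ i < real (k i) / 2 ^ m + 1 / 2 ^ m"
          "real (k i) / 2 ^ m \<le> y $ i" "y $ i < real (k i) / 2 ^ m + 1 / 2 ^ m"
          using k(2) y by (auto simp: half_cube_iff add_divide_distrib)
        then show "\<bar>(y - x) $ i\<bar> \<le> 1 / 2 ^ m" by simp
      qed
      also have "\<dots> = real CARD('n) / 2 ^ m" by simp
      also have "\<dots> \<le> real CARD('n) / 2 ^ m0" using m by (simp add: frac_le)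
      finally have "dist y x < d" using m0 by simp
      moreover have "half_cube m k \<subseteq> cbox 0 (\<chi> i. 1)"
        using half_cube_subset_unit[OF k(1)] half_cube_cbox(1)[of 0 "\<lambda>_::'n. 0"] by (auto simp: zero_vec_def)
      ultimately have "dist (h y) (h x) < e" using y k(2) by (intro d(2)) auto
      then show ?thesis by (simp add: dist_real_def)
    qed
    then show "\<bar>dyadic_step m h x - h x\<bar> \<le> e"
      unfolding dyadic_step_eq[OF k] by (intro cube_avg_between set_integrable_half_cube[OF hi k(1)]) auto
  qed
qed

text \<open>A truncation of \<open>f\<close> is close to \<open>f\<close> in \<open>L\<^sup>1\<close>. A measurable function is an almost everywhere limit
  of continuous functions, and these may be truncated at the same level, so that dominated
  convergence applies.\<close>

lemma continuous_L1_dense: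
  fixes f :: "'a::euclidean_space \<Rightarrow> real"
  assumes U: "U \<in> lmeasurable" and f: "set_integrable lebesgue U f" and e: "0 < e"
  shows "\<exists>h. continuous_on UNIV h \<and> set_integrable lebesgue U h \<and> (LINT x:U|lebesgue. \<bar>f x - h x\<bar>) < e"
proof -
  define clip where "clip B y = max (- B) (min B y)" for B y :: real
  have clip_cont: "continuous_on A (clip B)" for A B unfolding clip_def by (intro continuous_intros)
  have clip_le: "\<bar>clip B y\<bar> \<le> B" if "0 \<le> B" for B y using that by (auto simp: clip_def)
  define F where "F x = indicator U x * f x" for x
  have Fint: "integrable lebesgue F" using f by (simp add: set_integrable_def F_def[abs_def])
  have ind: "integrable lebesgue (\<lambda>x. B * indicator U x)" for B :: real
    using U by (intro integrable_mult_right integrable_real_indicator) (auto simp: fmeasurable_def)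
  have clipF: "(\<lambda>x. clip B (F x)) \<in> borel_measurable lebesgue" for B
    by (rule borel_measurable_continuous_on[OF clip_cont]) (rule borel_measurable_integrable[OF Fint])
  have "(\<lambda>n. LINT x|lebesgue. \<bar>F x - clip (real n) (F x)\<bar>) \<longlonglongrightarrow> (LINT x|(lebesgue :: 'a measure). 0)"
  proof (rule integral_dominated_convergence[where w = "\<lambda>x. \<bar>F x\<bar>"])
    show "AE x in lebesgue. (\<lambda>n. \<bar>F x - clip (real n) (F x)\<bar>) \<longlonglongrightarrow> 0"
    proof (rule AE_I2)
      fix x
      have "\<forall>\<^sub>F n in sequentially. \<bar>F x\<bar> \<le> real n"
        using eventually_ge_at_top[of "nat \<lceil>\<bar>F x\<bar>\<rceil>"] by eventually_elim linarith
      then have "\<forall>\<^sub>F n in sequentially. \<bar>F x - clip (real n) (F x)\<bar> = 0"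
        by eventually_elim (auto simp: clip_def)
      then show "(\<lambda>n. \<bar>F x - clip (real n) (F x)\<bar>) \<longlonglongrightarrow> 0" by (rule tendsto_eventually)
    qed
    show "AE x in lebesgue. norm \<bar>F x - clip (real n) (F x)\<bar> \<le> \<bar>F x\<bar>" for n
      by (rule AE_I2) (auto simp: clip_def)
  qed (use Fint clipF in \<open>auto intro!: borel_measurable_abs borel_measurable_diff borel_measurable_integrable\<close>)
  then have "\<forall>\<^sub>F n in sequentially. (LINT x|lebesgue. \<bar>F x - clip (real n) (F x)\<bar>) < e / 2"
    by (intro order_tendstoD(2)) (use e in auto)
  then obtain n where n: "(LINT x|lebesgue. \<bar>F x - clip (real n) (F x)\<bar>) < e / 2"
    by (auto simp: eventually_sequentially)
  define B where "B = real n"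
  have B: "0 \<le> B" by (simp add: B_def)
  define G where "G x = clip B (F x)" for x
  have Gm: "G \<in> borel_measurable lebesgue" unfolding G_def[abs_def] by (rule clipF)
  have "G measurable_on UNIV" by (rule lebesgue_measurable_imp_measurable_on) (use Gm in auto)
  then obtain N g where N: "negligible N" and g: "\<And>n. continuous_on UNIV (g n)"
    and lim: "\<And>x. x \<notin> N \<Longrightarrow> (\<lambda>n. g n x) \<longlonglongrightarrow> G x"
    by (auto simp: measurable_on_def)
  define h where "h n x = clip B (g n x)" for n x
  have hc: "continuous_on UNIV (h n)" for n
    unfolding h_def[abs_def] using continuous_on_compose2[OF clip_cont g] by blast
  have hm: "h n \<in> borel_measurable lebesgue" for n
    using borel_measurable_continuous_onI[OF hc] by (simp add: measurable_completion)
  have hint: "integrable lebesgue (\<lambda>x. indicator U x * h n x)" for n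
  proof (rule Bochner_Integration.integrable_bound[OF ind[of B]])
    show "AE x in lebesgue. norm (indicator U x * h n x) \<le> norm (B * indicator U x)"
      using clip_le[OF B] B by (auto simp: h_def indicator_def)
  qed (use U hm in \<open>auto intro!: borel_measurable_times\<close>)
  have Gint: "integrable lebesgue (\<lambda>x. indicator U x * G x)"
  proof (rule Bochner_Integration.integrable_bound[OF ind[of B]])
    show "AE x in lebesgue. norm (indicator U x * G x) \<le> norm (B * indicator U x)"
      using clip_le[OF B] B by (auto simp: G_def indicator_def)
  qed (use U Gm in \<open>auto intro!: borel_measurable_times\<close>)
  have "(\<lambda>n. LINT x|lebesgue. \<bar>indicator U x * G x - indicator U x * h n x\<bar>) \<longlonglongrightarrow> (LINT x|(lebesgue :: 'a measure). 0)"
  proof (rule integral_dominated_convergence[where w = "\<lambda>x. (2 * B) * indicator U x"])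
    have "AE x in lebesgue. x \<notin> N" using N by (simp add: negligible_iff_null_sets AE_not_in)
    then show "AE x in lebesgue. (\<lambda>n. \<bar>indicator U x * G x - indicator U x * h n x\<bar>) \<longlonglongrightarrow> 0"
    proof eventually_elim
      case (elim x)
      have "isCont (clip B) (G x)" using clip_cont[of UNIV B] by (simp add: continuous_on_eq_continuous_at)
      then have "(\<lambda>n. h n x) \<longlonglongrightarrow> clip B (G x)"
        unfolding h_def by (rule isCont_tendsto_compose) (rule lim[OF elim])
      moreover have "clip B (G x) = G x" using B by (auto simp: G_def clip_def)
      ultimately have "(\<lambda>n. \<bar>indicator U x * G x - indicator U x * h n x\<bar>) \<longlonglongrightarrow> \<bar>indicator U x * G x - indicator U x * G x\<bar>"
        by (intro tendsto_intros) simp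
      then show ?case by simp
    qed
    show "AE x in lebesgue. norm \<bar>indicator U x * G x - indicator U x * h n x\<bar> \<le> (2 * B) * indicator U x" for n
    proof (rule AE_I2)
      fix x
      have "\<bar>G x\<bar> \<le> B" "\<bar>h n x\<bar> \<le> B" using clip_le[OF B] by (auto simp: G_def h_def)
      then show "norm \<bar>indicator U x * G x - indicator U x * h n x\<bar> \<le> (2 * B) * indicator U x"
        by (auto simp: indicator_def)
    qed
  qed (use ind[of "2 * B"] Gint hint in \<open>auto intro!: borel_measurable_abs borel_measurable_diff borel_measurable_integrable\<close>)
  then have "\<forall>\<^sub>F n in sequentially. (LINT x|lebesgue. \<bar>indicator U x * G x - indicator U x * h n x\<bar>) < e / 2"
    by (intro order_tendstoD(2)) (use e in auto)
  then obtain k where k: "(LINT x|lebesgue. \<bar>indicator U x * G x - indicator U x * h k x\<bar>) < e / 2"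
    by (auto simp: eventually_sequentially)
  have GF: "indicator U x * G x = clip B (F x)" for x
    using B by (auto simp: G_def F_def clip_def indicator_def)
  have cint: "integrable lebesgue (\<lambda>x. clip B (F x))" using Gint unfolding GF .
  have "(LINT x:U|lebesgue. \<bar>f x - h k x\<bar>) = (LINT x|lebesgue. \<bar>F x - indicator U x * h k x\<bar>)"
    unfolding set_lebesgue_integral_def by (rule Bochner_Integration.integral_cong) (auto simp: F_def indicator_def)
  also have "\<dots> \<le> (LINT x|lebesgue. \<bar>F x - clip B (F x)\<bar> + \<bar>clip B (F x) - indicator U x * h k x\<bar>)"
    by (intro Bochner_Integration.integral_mono) (auto intro!: Bochner_Integration.integrable_add Bochner_Integration.integrable_diff integrable_abs Fint cint hint)
  also have "\<dots> = (LINT x|lebesgue. \<bar>F x - clip B (F x)\<bar>) + (LINT x|lebesgue. \<bar>clip B (F x) - indicator U x * h k x\<bar>)"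
    by (intro Bochner_Integration.integral_add) (auto intro!: Bochner_Integration.integrable_diff integrable_abs Fint cint hint)
  also have "\<dots> < e" using n k unfolding GF B_def by simp
  finally have "(LINT x:U|lebesgue. \<bar>f x - h k x\<bar>) < e" .
  moreover have "set_integrable lebesgue U (h k)" using hint[of k] by (simp add: set_integrable_def)
  ultimately show ?thesis using hc by blast
qed

text \<open>Dyadic averages of a continuous function converge uniformly, and averaging is a contraction in
  \<open>L\<^sup>1\<close>, so a continuous approximation of \<open>\<phi>\<close> transfers the convergence.\<close>

lemma dyadic_step_L1:
  fixes \<phi> :: "real^'n::finite \<Rightarrow> real"
  assumes \<phi>: "set_integrable lebesgue unit_half_cube \<phi>"
  shows "(\<lambda>m. LINT x:unit_half_cube|lebesgue. \<bar>dyadic_step m \<phi> x - \<phi> x\<bar>) \<longlonglongrightarrow> 0"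
proof (rule LIMSEQ_I)
  fix e :: real assume e: "0 < e"
  let ?U = "unit_half_cube :: (real^'n) set"
  have U: "?U \<in> lmeasurable" using half_cube_cbox(3,4)[of 0 "\<lambda>_::'n. 0"] by (auto simp: fmeasurable_def)
  have mU: "measure lebesgue ?U = 1" using measure_half_cube[of 0 "\<lambda>_::'n. 0"] by simp
  obtain h where h: "continuous_on UNIV h" "set_integrable lebesgue ?U h" "(LINT x:?U|lebesgue. \<bar>\<phi> x - h x\<bar>) < e / 3"
    using continuous_L1_dense[OF U \<phi>, of "e / 3"] e by auto
  obtain m0 where m0: "\<And>m x. m0 \<le> m \<Longrightarrow> x \<in> ?U \<Longrightarrow> \<bar>dyadic_step m h x - h x\<bar> \<le> e / 3"
    using dyadic_step_uniform[OF h(1), of "e / 3"] e by auto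
  show "\<exists>m0. \<forall>m\<ge>m0. norm ((LINT x:?U|lebesgue. \<bar>dyadic_step m \<phi> x - \<phi> x\<bar>) - 0) < e"
  proof (intro exI allI impI)
    fix m assume m: "m0 \<le> m"
    note ints = set_integral_diff(1) set_integral_add(1) set_integrable_abs dyadic_step_integrable \<phi> h(2)
    have "(LINT x:?U|lebesgue. \<bar>dyadic_step m \<phi> x - \<phi> x\<bar>) \<le>
       (LINT x:?U|lebesgue. \<bar>dyadic_step m \<phi> x - dyadic_step m h x\<bar> + (\<bar>dyadic_step m h x - h x\<bar> + \<bar>\<phi> x - h x\<bar>))"
      by (intro set_integral_mono ints) auto
    also have "\<dots> = (LINT x:?U|lebesgue. \<bar>dyadic_step m \<phi> x - dyadic_step m h x\<bar>) +
        ((LINT x:?U|lebesgue. \<bar>dyadic_step m h x - h x\<bar>) + (LINT x:?U|lebesgue. \<bar>\<phi> x - h x\<bar>))"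
      by (subst set_integral_add(2), (intro ints)+, subst set_integral_add(2), (intro ints)+, rule refl)
    also have "(LINT x:?U|lebesgue. \<bar>dyadic_step m \<phi> x - dyadic_step m h x\<bar>) \<le> (LINT x:?U|lebesgue. \<bar>\<phi> x - h x\<bar>)"
      using dyadic_step_contraction[of "\<lambda>x. \<phi> x - h x" m] set_integral_diff(1)[OF \<phi> h(2)]
      by (simp add: dyadic_step_diff[OF \<phi> h(2)])
    also have "(LINT x:?U|lebesgue. \<bar>dyadic_step m h x - h x\<bar>) \<le> (LINT x:?U|lebesgue. e / 3)"
      by (intro set_integral_mono ints m0 m set_integrable_const_half_cube)
    also have "\<dots> = e / 3"
      using U mU by (subst set_integral_const) (auto simp: fmeasurable_def)
    finally have "(LINT x:?U|lebesgue. \<bar>dyadic_step m \<phi> x - \<phi> x\<bar>) < e" using h(3) by linarith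
    moreover have "0 \<le> (LINT x:?U|lebesgue. \<bar>dyadic_step m \<phi> x - \<phi> x\<bar>)"
      unfolding set_lebesgue_integral_def by (intro Bochner_Integration.integral_nonneg) auto
    ultimately show "norm ((LINT x:?U|lebesgue. \<bar>dyadic_step m \<phi> x - \<phi> x\<bar>) - 0) < e" by simp
  qed
qed

section \<open>Averages over closed dyadic cubes\<close>

lemma abs_le_one_plus_sq: "\<bar>y\<bar> \<le> 1 + y\<^sup>2" for y :: real
proof -
  have "0 \<le> (\<bar>y\<bar> - 1)\<^sup>2" by simp
  then have "2 * \<bar>y\<bar> \<le> 1 + y\<^sup>2" by (simp add: power2_diff)
  then show ?thesis by simp
qed

lemma integrable_of_sq_diff:
  fixes f :: "'a \<Rightarrow> real"
  assumes M: "finite_measure M" and f: "f \<in> borel_measurable M"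
    and sq: "(\<integral>\<^sup>+x. ennreal ((f x - \<tau>)\<^sup>2) \<partial>M) < \<infinity>"
  shows "integrable M f" "integrable M (\<lambda>x. (f x)\<^sup>2)"
proof -
  interpret finite_measure M by (rule M)
  have sq': "integrable M (\<lambda>x. (f x - \<tau>)\<^sup>2)"
    using f sq by (intro integrableI_bounded) auto
  have bound: "integrable M (\<lambda>x. 1 + (f x - \<tau>)\<^sup>2 + \<bar>\<tau>\<bar>)"
    using sq' by simp
  show f1: "integrable M f"
  proof (rule Bochner_Integration.integrable_bound[OF bound f], rule AE_I2)
    fix x
    have "\<bar>f x\<bar> \<le> \<bar>f x - \<tau>\<bar> + \<bar>\<tau>\<bar>" by simp
    also have "\<bar>f x - \<tau>\<bar> \<le> 1 + (f x - \<tau>)\<^sup>2" by (rule abs_le_one_plus_sq)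
    finally show "norm (f x) \<le> norm (1 + (f x - \<tau>)\<^sup>2 + \<bar>\<tau>\<bar>)" by simp
  qed
  have "integrable M (\<lambda>x. (f x - \<tau>)\<^sup>2 + (2 * \<tau>) * f x - \<tau>\<^sup>2)"
    using sq' f1 by (intro Bochner_Integration.integrable_diff Bochner_Integration.integrable_add integrable_mult_right) auto
  then show "integrable M (\<lambda>x. (f x)\<^sup>2)" by (simp add: power2_diff)
qed

lemma integral_sq_diff:
  fixes f :: "'a \<Rightarrow> real"
  assumes M: "finite_measure M" and "integrable M f" "integrable M (\<lambda>x. (f x)\<^sup>2)"
  shows "integrable M (\<lambda>x. (f x - \<tau>)\<^sup>2)"
    "(LINT x|M. (f x - \<tau>)\<^sup>2) = (LINT x|M. (f x)\<^sup>2) - 2 * \<tau> * (LINT x|M. f x) + \<tau>\<^sup>2 * measure M (space M)"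
proof -
  interpret finite_measure M by (rule M)
  have eq: "(f x - \<tau>)\<^sup>2 = ((f x)\<^sup>2 - (2 * \<tau>) * f x) + \<tau>\<^sup>2" for x
    by (simp add: power2_diff)
  show "integrable M (\<lambda>x. (f x - \<tau>)\<^sup>2)" unfolding eq using assms by simp
  show "(LINT x|M. (f x - \<tau>)\<^sup>2) = (LINT x|M. (f x)\<^sup>2) - 2 * \<tau> * (LINT x|M. f x) + \<tau>\<^sup>2 * measure M (space M)"
    unfolding eq using assms by simp
qed

lemma average_variance_eq:
  fixes f :: "'a::euclidean_space \<Rightarrow> real"
  assumes "0 < measure lebesgue C" "integrable (lebesgue_on C) (\<lambda>x. (f x)\<^sup>2)"
  shows "average_sq f C - ereal ((average f C)\<^sup>2) =
    ereal ((LINT x|lebesgue_on C. (f x)\<^sup>2) / measure lebesgue C - ((LINT x|lebesgue_on C. f x) / measure lebesgue C)\<^sup>2)"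
proof -
  have "(\<integral>\<^sup>+x. ennreal ((f x)\<^sup>2) \<partial>lebesgue_on C) = ennreal (LINT x|lebesgue_on C. (f x)\<^sup>2)"
    using assms(2) by (intro nn_integral_eq_integral) auto
  then show ?thesis using assms(1) by (simp add: average_sq_def average_def)
qed

lemma average_variance_le:
  fixes f :: "'a::euclidean_space \<Rightarrow> real"
  assumes C: "C \<in> lmeasurable" "0 < measure lebesgue C" and f: "f \<in> borel_measurable (lebesgue_on C)"
    and c: "0 \<le> c" and sq: "(\<integral>\<^sup>+x. ennreal ((f x - \<tau>)\<^sup>2) \<partial>lebesgue_on C) \<le> ennreal (c * measure lebesgue C)"
  shows "average_sq f C - ereal ((average f C)\<^sup>2) \<le> ereal c"
proof -
  let ?m = "measure lebesgue C"
  have fin: "finite_measure (lebesgue_on C)" by (rule finite_measure_lebesgue_on[OF C(1)])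
  have "(\<integral>\<^sup>+x. ennreal ((f x - \<tau>)\<^sup>2) \<partial>lebesgue_on C) < \<infinity>"
    using sq by (rule order_le_less_trans) simp
  note int = integrable_of_sq_diff[OF fin f this]
  have sp: "measure (lebesgue_on C) (space (lebesgue_on C)) = ?m"
    using C by (simp add: measure_restrict_space space_restrict_space)
  have "ennreal (LINT x|lebesgue_on C. (f x - \<tau>)\<^sup>2) \<le> ennreal (c * ?m)"
    using sq nn_integral_eq_integral[OF integral_sq_diff(1)[OF fin int, of \<tau>]] by simp
  then have le: "(LINT x|lebesgue_on C. (f x - \<tau>)\<^sup>2) \<le> c * ?m"
    using c C by (simp add: ennreal_le_iff)
  let ?S = "LINT x|lebesgue_on C. (f x)\<^sup>2" and ?I = "LINT x|lebesgue_on C. f x"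
  have "(?S - 2 * \<tau> * ?I + \<tau>\<^sup>2 * ?m) / ?m \<le> c"
    using le C unfolding integral_sq_diff(2)[OF fin int] sp by (simp add: divide_le_eq)
  then have "?S / ?m - 2 * \<tau> * (?I / ?m) + \<tau>\<^sup>2 \<le> c"
    using C by (simp add: add_divide_distrib diff_divide_distrib)
  moreover have "0 \<le> (?I / ?m - \<tau>)\<^sup>2" by simp
  ultimately have "?S / ?m - (?I / ?m)\<^sup>2 \<le> c"
    by (simp add: power2_diff algebra_simps)
  then show ?thesis unfolding average_variance_eq[OF C(2) int(2)] by simp
qed

lemma average_variance_leD:
  fixes f :: "'a::euclidean_space \<Rightarrow> real"
  assumes C: "C \<in> lmeasurable" "0 < measure lebesgue C" and f: "integrable (lebesgue_on C) f"
    and le: "average_sq f C - ereal ((average f C)\<^sup>2) \<le> ereal c"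
  shows "integrable (lebesgue_on C) (\<lambda>x. (f x)\<^sup>2)"
    "(LINT x|lebesgue_on C. (f x - average f C)\<^sup>2) \<le> c * measure lebesgue C"
    "0 \<le> c"
proof -
  let ?m = "measure lebesgue C"
  have fin: "finite_measure (lebesgue_on C)" by (rule finite_measure_lebesgue_on[OF C(1)])
  show sq: "integrable (lebesgue_on C) (\<lambda>x. (f x)\<^sup>2)"
  proof (rule integrableI_bounded)
    show "(\<integral>\<^sup>+x. ennreal (norm ((f x)\<^sup>2)) \<partial>lebesgue_on C) < \<infinity>"
    proof (rule ccontr)
      assume "\<not> ?thesis"
      then have "(\<integral>\<^sup>+x. ennreal ((f x)\<^sup>2) \<partial>lebesgue_on C) = \<infinity>" by (simp add: less_top[symmetric])
      then have "average_sq f C = \<infinity>" using C by (simp add: average_sq_def)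
      then show False using le by simp
    qed
  qed (use f in auto)
  have sp: "measure (lebesgue_on C) (space (lebesgue_on C)) = ?m"
    using C by (simp add: measure_restrict_space space_restrict_space)
  let ?S = "LINT x|lebesgue_on C. (f x)\<^sup>2" and ?I = "LINT x|lebesgue_on C. f x"
  have "?S / ?m - (?I / ?m)\<^sup>2 \<le> c"
    using le unfolding average_variance_eq[OF C(2) sq] by simp
  then have "(?S / ?m - (?I / ?m)\<^sup>2) * ?m \<le> c * ?m"
    using C by (intro mult_right_mono) auto
  moreover have "(?S / ?m - (?I / ?m)\<^sup>2) * ?m = (LINT x|lebesgue_on C. (f x - average f C)\<^sup>2)"
    unfolding integral_sq_diff(2)[OF fin f sq] sp average_def
    using C by (simp add: field_simps power2_eq_square)
  ultimately show *: "(LINT x|lebesgue_on C. (f x - average f C)\<^sup>2) \<le> c * ?m" by simp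
  have "0 \<le> (LINT x|lebesgue_on C. (f x - average f C)\<^sup>2)" by simp
  then show "0 \<le> c" using * C by (metis order_trans zero_le_mult_iff not_less)
qed

definition closed_cube :: "nat \<Rightarrow> ('n::finite \<Rightarrow> nat) \<Rightarrow> (real^'n) set" where
  "closed_cube m k = cbox (\<chi> i. real (k i) / 2 ^ m) (\<chi> i. (real (k i) + 1) / 2 ^ m)"

lemma dyadic_cubes_eq: "dyadic_cubes = {closed_cube m k | m k. k \<in> grid m}"
  unfolding dyadic_cubes_def closed_cube_def grid_iff by blast

lemma unit_cube_eq: "unit_cube = closed_cube 0 (\<lambda>_. 0)"
  by (simp add: unit_cube_def closed_cube_def zero_vec_def one_vec_def)

lemma closed_cube_half_cube:
  "half_cube m k \<subseteq> closed_cube m k" "closed_cube m k - half_cube m k \<in> null_sets lebesgue"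
  "closed_cube m k \<in> lmeasurable" "0 < measure lebesgue (closed_cube m k)"
  "measure lebesgue (closed_cube m (k :: 'n::finite \<Rightarrow> nat)) = (1 / 2 ^ m) ^ CARD('n)"
proof -
  note H = half_cube_cbox[where m = m and k = k, folded closed_cube_def]
  show "half_cube m k \<subseteq> closed_cube m k" "closed_cube m k - half_cube m k \<in> null_sets lebesgue"
    by (rule H)+
  show "closed_cube m k \<in> lmeasurable" by (simp add: closed_cube_def)
  show "measure lebesgue (closed_cube m k) = (1 / 2 ^ m) ^ CARD('n)"
    using H(5) by (simp add: measure_def)
  then show "0 < measure lebesgue (closed_cube m k)" by simp
qed

lemma AE_closed_cube: "AE x in lebesgue. x \<in> closed_cube m k \<longleftrightarrow> x \<in> half_cube m k"
  using AE_not_in[OF closed_cube_half_cube(2)[of m k]] closed_cube_half_cube(1)[of m k] by (auto elim: eventually_mono)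

lemma closed_cube_subset:
  assumes "k \<in> grid m" shows "closed_cube m k \<subseteq> unit_cube"
proof
  fix x assume x: "x \<in> closed_cube m k"
  have "0 \<le> x $ i \<and> x $ i \<le> 1" for i
  proof -
    have "real (k i) / 2 ^ m \<le> x $ i" "x $ i \<le> (real (k i) + 1) / 2 ^ m"
      using x by (auto simp: closed_cube_def mem_box_cart)
    moreover have "0 \<le> real (k i) / 2 ^ m" by simp
    moreover have "(real (k i) + 1) / 2 ^ m \<le> 1"
    proof -
      have "k i + 1 \<le> 2 ^ m" using assms by (simp add: grid_iff Suc_leI)
      then have "real (k i + 1) \<le> real (2 ^ m)" by (rule of_nat_mono)
      then show ?thesis by simp
    qed
    ultimately show ?thesis by linarith
  qed
  then show "x \<in> unit_cube" by (simp add: unit_cube_def mem_box_cart)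
qed

lemma integral_closed_half_cube:
  fixes f :: "real^'n::finite \<Rightarrow> real"
  assumes "integrable (lebesgue_on (closed_cube m k)) f"
  shows "set_integrable lebesgue (half_cube m k) f"
    "(LINT x:half_cube m k|lebesgue. f x) = (LINT x|lebesgue_on (closed_cube m k). f x)"
proof -
  have C: "closed_cube m k \<in> sets lebesgue" using closed_cube_half_cube(3) by blast
  have i: "set_integrable lebesgue (closed_cube m k) f"
    using assms C by (simp add: integrable_restrict_space set_integrable_def)
  show h: "set_integrable lebesgue (half_cube m k) f"
    using closed_cube_half_cube(1) half_cube_cbox(3) by (rule set_integrable_subset[OF i, rotated])
  have "(LINT x:half_cube m k|lebesgue. f x) = (LINT x:closed_cube m k|lebesgue. f x)"
    using i h by (intro set_integral_cong_set) (auto simp: set_borel_measurable_def set_integrable_def AE_closed_cube intro: borel_measurable_integrable)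
  also have "\<dots> = (LINT x|lebesgue_on (closed_cube m k). f x)"
    using C by (simp add: integral_restrict_space set_lebesgue_integral_def)
  finally show "(LINT x:half_cube m k|lebesgue. f x) = (LINT x|lebesgue_on (closed_cube m k). f x)" .
qed

text \<open>The unit cube is itself dyadic, so finiteness of the seminorm forces \<open>\<phi>\<close> to be square integrable.\<close>

lemma bmo_dyadic_oscillation:
  fixes \<phi> :: "real^'n::finite \<Rightarrow> real"
  assumes \<phi>: "\<phi> \<in> BMO_dyadic" and e: "bmo_sup dyadic_cubes \<phi> = ereal e"
  shows "set_integrable lebesgue unit_half_cube \<phi>" "set_integrable lebesgue unit_half_cube (\<lambda>x. (\<phi> x)\<^sup>2)"
    "0 \<le> e"
    "\<And>j l. l \<in> grid j \<Longrightarrow> \<exists>\<tau>. (LINT x:half_cube j l|lebesgue. (\<phi> x - \<tau>)\<^sup>2) \<le> e * (1 / 2 ^ j) ^ CARD('n)"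
proof -
  have int: "integrable (lebesgue_on unit_cube) \<phi>"
    using \<phi> by (simp add: BMO_dyadic_def bmo_space_def)
  have cube: "integrable (lebesgue_on (closed_cube j l)) \<phi>"
     "average_sq \<phi> (closed_cube j l) - ereal ((average \<phi> (closed_cube j l))\<^sup>2) \<le> ereal e"
    if l: "l \<in> grid j" for j and l :: "'n \<Rightarrow> nat"
  proof -
    have C: "closed_cube j l \<in> sets lebesgue" "unit_cube \<in> sets (lebesgue :: (real^'n) measure)"
      using closed_cube_half_cube(3) unfolding unit_cube_eq by blast+
    have "set_integrable lebesgue unit_cube \<phi>"
      using int C by (simp add: integrable_restrict_space set_integrable_def)
    then have "set_integrable lebesgue (closed_cube j l) \<phi>"
      by (rule set_integrable_subset[OF _ C(1) closed_cube_subset[OF l]])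
    then show "integrable (lebesgue_on (closed_cube j l)) \<phi>"
      using C by (simp add: integrable_restrict_space set_integrable_def)
    show "average_sq \<phi> (closed_cube j l) - ereal ((average \<phi> (closed_cube j l))\<^sup>2) \<le> ereal e"
      unfolding e[symmetric] bmo_sup_def dyadic_cubes_eq using l by (intro SUP_upper) auto
  qed
  note D = average_variance_leD[OF closed_cube_half_cube(3,4) cube]
  have 0: "(\<lambda>_::'n. 0) \<in> grid 0" by (simp add: descendants_def)
  show "set_integrable lebesgue unit_half_cube \<phi>" "set_integrable lebesgue unit_half_cube (\<lambda>x. (\<phi> x)\<^sup>2)"
    by (rule integral_closed_half_cube(1), rule cube(1)[OF 0] D(1)[OF 0 0])+
  show "0 \<le> e" using D(3)[OF 0 0] .
  show "\<exists>\<tau>. (LINT x:half_cube j l|lebesgue. (\<phi> x - \<tau>)\<^sup>2) \<le> e * (1 / 2 ^ j) ^ CARD('n)" if l: "l \<in> grid j" for j l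
  proof -
    have "integrable (lebesgue_on (closed_cube j l)) (\<lambda>x. (\<phi> x - average \<phi> (closed_cube j l))\<^sup>2)"
      by (rule integral_sq_diff(1)[OF finite_measure_lebesgue_on[OF closed_cube_half_cube(3)] cube(1)[OF l] D(1)[OF l l]])
    from integral_closed_half_cube(2)[OF this] D(2)[OF l l] show ?thesis
      by (intro exI[of _ "average \<phi> (closed_cube j l)"]) (simp add: closed_cube_half_cube(5))
  qed
qed

section \<open>The upper bound\<close>

lemma is_monotonic_rearrangementD:
  fixes \<phi> :: "real^'n::finite \<Rightarrow> real"
  assumes R: "is_monotonic_rearrangement \<phi> g" and \<phi>: "\<phi> \<in> borel_measurable (lebesgue_on unit_cube)"
  shows "antimono_on {0<..<1} g" "g \<in> borel_measurable (lebesgue_on {0..1})"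
    "\<And>F. F \<in> borel_measurable borel \<Longrightarrow>
      (\<integral>\<^sup>+s. F (g s) \<partial>lebesgue_on {0..1}) = (\<integral>\<^sup>+x. F (\<phi> x) \<partial>lebesgue_on unit_cube)"
    "\<And>A. A \<in> sets borel \<Longrightarrow> measure lebesgue {s \<in> {0<..<1}. g s \<in> A}
      = measure (lebesgue_on unit_half_cube) {x \<in> space (lebesgue_on unit_half_cube). \<phi> x \<in> A}"
proof -
  have g: "antimono_on {0<..<1} g" and law: "distr (lebesgue_on {0..1}) borel g = distr (lebesgue_on unit_cube) borel \<phi>"
    using R by (auto simp: is_monotonic_rearrangement_def)
  show "antimono_on {0<..<1} g" by (rule g)
  have ends: "g -` A \<inter> {0, 1} \<in> null_sets lebesgue" for A
    by (intro null_sets_completionI finite_imp_null_set_lborel) simp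
  have split: "g -` A \<inter> {0..1} = {s \<in> {0<..<1}. g s \<in> A} \<union> (g -` A \<inter> {0, 1})" for A
    by auto
  have mid: "{s \<in> {0<..<1}. g s \<in> A} \<in> sets lebesgue" if "A \<in> sets borel" for A
    using antimono_vimage_borel[OF g that] by (auto intro: sets_completionI_sets)
  show gm: "g \<in> borel_measurable (lebesgue_on {0..1})"
  proof (rule measurableI)
    fix A :: "real set" assume A: "A \<in> sets borel"
    have "g -` A \<inter> {0..1} \<in> sets lebesgue"
      unfolding split using mid[OF A] ends[of A] by blast
    then show "g -` A \<inter> space (lebesgue_on {0..1}) \<in> sets (lebesgue_on {0..1})"
      by (simp add: sets_restrict_space_iff)
  qed simp
  show "(\<integral>\<^sup>+s. F (g s) \<partial>lebesgue_on {0..1}) = (\<integral>\<^sup>+x. F (\<phi> x) \<partial>lebesgue_on unit_cube)"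
    if F: "F \<in> borel_measurable borel" for F
    using nn_integral_distr[OF gm, of F] nn_integral_distr[OF \<phi>, of F] F law by simp
  show "measure lebesgue {s \<in> {0<..<1}. g s \<in> A}
      = measure (lebesgue_on unit_half_cube) {x \<in> space (lebesgue_on unit_half_cube). \<phi> x \<in> A}"
    if A: "A \<in> sets borel" for A
  proof -
    have Q: "unit_cube \<in> sets (lebesgue :: (real^'n) measure)"
      using closed_cube_half_cube(3)[of 0] unfolding unit_cube_eq by blast
    have pre: "\<phi> -` A \<inter> unit_cube \<in> sets lebesgue"
      using measurable_sets[OF \<phi> A] Q by (simp add: sets_restrict_space_iff space_restrict_space)
    have "emeasure lebesgue {s \<in> {0<..<1}. g s \<in> A} = emeasure lebesgue (g -` A \<inter> {0..1})"
      unfolding split using mid[OF A] ends[of A] by (rule emeasure_Un_null_set[symmetric])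
    also have "\<dots> = emeasure (distr (lebesgue_on {0..1}) borel g) A"
      using A gm by (simp add: emeasure_distr emeasure_restrict_space space_restrict_space)
    also have "\<dots> = emeasure lebesgue (\<phi> -` A \<inter> unit_cube)"
      unfolding law using A \<phi> Q by (simp add: emeasure_distr emeasure_restrict_space space_restrict_space)
    also have "\<dots> = emeasure lebesgue (\<phi> -` A \<inter> unit_half_cube)"
    proof (rule emeasure_eq_AE)
      show "AE x in lebesgue. x \<in> \<phi> -` A \<inter> unit_cube \<longleftrightarrow> x \<in> \<phi> -` A \<inter> unit_half_cube"
        using AE_closed_cube[of 0 "\<lambda>_. 0"] unfolding unit_cube_eq by (auto elim: eventually_mono)
      have "\<phi> -` A \<inter> unit_half_cube = (\<phi> -` A \<inter> unit_cube) \<inter> unit_half_cube"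
        using closed_cube_half_cube(1)[of 0 "\<lambda>_. 0"] unfolding unit_cube_eq by blast
      then show "\<phi> -` A \<inter> unit_half_cube \<in> sets lebesgue"
        using sets.Int[OF pre half_cube_cbox(3)[of 0 "\<lambda>_. 0"]] by (simp only:)
    qed (rule pre)
    also have "\<phi> -` A \<inter> unit_half_cube = {x \<in> space (lebesgue_on unit_half_cube). \<phi> x \<in> A}"
      by (auto simp: space_restrict_space)
    finally show ?thesis
      using half_cube_cbox(3)[of 0 "\<lambda>_. 0"]
      by (subst measure_restrict_space) (auto simp: measure_def space_restrict_space)
  qed
qed

lemma dyadic_step_level_measure:
  fixes \<phi> :: "real^'n::finite \<Rightarrow> real"
  shows "measure lebesgue {x \<in> unit_half_cube. dyadic_step m \<phi> x = v}
    = (1 / 2 ^ m) ^ CARD('n) * real (card {k \<in> grid m. cube_avg m \<phi> k = v})"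
proof -
  have "{x \<in> unit_half_cube. dyadic_step m \<phi> x = v} = (\<Union>k\<in>{k \<in> grid m. cube_avg m \<phi> k = v}. half_cube m k)"
    unfolding unit_half_cube_grid[of m] using dyadic_step_eq by fastforce
  also have "measure lebesgue \<dots> = (\<Sum>k\<in>{k \<in> grid m. cube_avg m \<phi> k = v}. measure lebesgue (half_cube m k))"
    by (rule measure_finite_Union)
       (auto simp: half_cube_cbox(3,4) disjoint_family_on_def half_cube_disjoint)
  finally show ?thesis by (simp add: measure_half_cube)
qed

lemma unit_subinterval_endpoints:
  assumes "I \<in> unit_subintervals"
  obtains a b where "0 \<le> a" "a < b" "b \<le> 1" "{a<..<b} \<subseteq> I" "I \<subseteq> {a..b}" "I \<in> lmeasurable" "measure lebesgue I = b - a"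
proof -
  have I: "is_interval I" "I \<subseteq> {0..1}" "0 < measure lebesgue I"
    using assms by (auto simp: unit_subintervals_def)
  define a b where "a = Inf I" and "b = Sup I"
  have ne: "I \<noteq> {}" using I(3) by auto
  have bd: "bdd_below I" "bdd_above I" using I(2) by (meson bdd_above_mono bdd_above_Icc bdd_below_mono bdd_below_Icc)+
  have sub: "I \<subseteq> {a..b}" using cInf_lower[OF _ bd(1)] cSup_upper[OF _ bd(2)] by (auto simp: a_def b_def)
  have inner: "{a<..<b} \<subseteq> I"
  proof
    fix x assume x: "x \<in> {a<..<b}"
    obtain y where "y \<in> I" "y < x" using x cInf_less_iff[OF ne bd(1)] by (auto simp: a_def)
    moreover obtain z where "z \<in> I" "x < z" using x less_cSup_iff[OF ne bd(2)] by (auto simp: b_def)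
    ultimately show "x \<in> I" using I(1) unfolding is_interval_1 by (meson less_imp_le)
  qed
  have sets: "I \<in> sets lebesgue" using real_interval_borel_measurable[OF I(1)] by (auto intro: sets_completionI_sets)
  have lm: "I \<in> lmeasurable" by (rule fmeasurableI2[OF _ sub sets]) (metis box_real(2) lmeasurable_cbox)
  have le: "measure lebesgue I \<le> measure lebesgue {a..b}"
    using sub sets by (intro measure_mono_fmeasurable) (auto simp: lmeasurable_cbox simp flip: box_real)
  have ab: "a < b"
  proof (rule ccontr)
    assume "\<not> a < b"
    then have "measure lebesgue {a..b} = 0" by (simp add: content_real_if)
    then show False using le I(3) by simp
  qed
  have "measure lebesgue {a<..<b} \<le> measure lebesgue I"
    using inner lm by (intro measure_mono_fmeasurable) auto
  then have "measure lebesgue I = b - a" using le ab by simp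
  moreover have "0 \<le> a" unfolding a_def using I(2) ne by (intro cInf_greatest) auto
  moreover have "b \<le> 1" unfolding b_def using I(2) ne by (intro cSup_least) auto
  ultimately show thesis using that ab inner sub lm by blast
qed

lemma nn_integral_unit_cube:
  fixes f :: "real^'n::finite \<Rightarrow> real"
  assumes "set_integrable lebesgue unit_half_cube f"
  shows "(\<integral>\<^sup>+x. ennreal \<bar>f x\<bar> \<partial>lebesgue_on unit_cube) = ennreal (LINT x:unit_half_cube|lebesgue. \<bar>f x\<bar>)"
proof -
  have Q: "unit_cube \<in> sets (lebesgue :: (real^'n) measure)"
    using closed_cube_half_cube(3)[of 0] unfolding unit_cube_eq by blast
  have "(\<integral>\<^sup>+x. ennreal \<bar>f x\<bar> \<partial>lebesgue_on unit_cube) = (\<integral>\<^sup>+x. ennreal \<bar>f x\<bar> * indicator unit_cube x \<partial>lebesgue)"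
    using Q by (simp add: nn_integral_restrict_space)
  also have "\<dots> = (\<integral>\<^sup>+x. ennreal (indicator unit_half_cube x *\<^sub>R \<bar>f x\<bar>) \<partial>lebesgue)"
    by (rule nn_integral_cong_AE)
       (use AE_closed_cube[of 0 "\<lambda>_. 0"] in \<open>auto simp: unit_cube_eq indicator_def elim: eventually_mono\<close>)
  also have "\<dots> = ennreal (LINT x:unit_half_cube|lebesgue. \<bar>f x\<bar>)"
    unfolding set_lebesgue_integral_def using set_integrable_abs[OF assms]
    by (intro nn_integral_eq_integral) (auto simp: set_integrable_def)
  finally show ?thesis .
qed

text \<open>The rearrangements \<open>h m\<close> of the dyadic averages satisfy the bound on \<open>{a<..<b}\<close> with some centres
  \<open>\<tau> m\<close>, and they converge almost everywhere to \<open>g\<close>. The centres stay bounded because the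
  \<open>L\<^sup>1\<close> norms of the \<open>h m\<close> do, so a subsequence converges, and Fatou's lemma gives the bound for \<open>g\<close>.\<close>

lemma rearrangement_variance_le:
  fixes \<phi> :: "real^'n::finite \<Rightarrow> real"
  assumes \<phi>: "\<phi> \<in> BMO_dyadic" and e: "bmo_sup dyadic_cubes \<phi> = ereal e"
    and g: "is_monotonic_rearrangement \<phi> g" and I: "I \<in> unit_subintervals"
  shows "average_sq g I - ereal ((average g I)\<^sup>2) \<le> ereal ((1 + 1 / 2 ^ CARD('n))\<^sup>2 / (4 * (1 / 2 ^ CARD('n))) * e)"
proof -
  let ?U = "unit_half_cube :: (real^'n) set"
  let ?M = "lebesgue_on ?U"
  define c where "c = (1 + 1 / 2 ^ CARD('n))\<^sup>2 / (4 * (1 / 2 ^ CARD('n))) * e"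
  note osc = bmo_dyadic_oscillation[OF \<phi> e]
  have c0: "0 \<le> c" using osc(3) by (simp add: c_def)
  have U: "?U \<in> lmeasurable" using half_cube_cbox(3,4)[of 0 "\<lambda>_::'n. 0"] by (auto simp: fmeasurable_def)
  have \<phi>m: "\<phi> \<in> borel_measurable (lebesgue_on unit_cube)"
    using \<phi> by (auto simp: BMO_dyadic_def bmo_space_def)
  define F where "F m = dyadic_step m \<phi>" for m
  have FL: "F m \<in> borel_measurable lebesgue" for m unfolding F_def by (rule dyadic_step_measurable)
  have "\<forall>m. \<exists>k. is_monotonic_rearrangement (F m) k"
    using ex_monotonic_rearrangement measurable_restrict_space1[OF FL] by blast
  then obtain h where hr: "\<And>m. is_monotonic_rearrangement (F m) (h m)" by metis
  note H = is_monotonic_rearrangementD[OF hr measurable_restrict_space1[OF FL]]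
  note G = is_monotonic_rearrangementD[OF g \<phi>m]
  obtain a b where ab: "0 \<le> a" "a < b" "b \<le> 1" "{a<..<b} \<subseteq> I" "I \<subseteq> {a..b}"
    and Im: "I \<in> lmeasurable" "measure lebesgue I = b - a"
    using unit_subinterval_endpoints[OF I] .
  let ?E = "{a<..<b}" and ?L = "lebesgue_on {a<..<b}"
  have Lnn: "nn_integral ?L f = (\<integral>\<^sup>+s. f s * indicator ?E s \<partial>lebesgue)" for f
    by (simp add: nn_integral_restrict_space)
  have sub01: "?E \<subseteq> {0..1}" using ab by auto
  have hL: "h m \<in> borel_measurable ?L" for m by (rule measurable_restrict_mono[OF H(2) sub01])
  have "\<exists>\<tau>. (\<integral>\<^sup>+s. ennreal ((h m s - \<tau>)\<^sup>2) \<partial>?L) \<le> ennreal (c * (b - a))" for m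
    unfolding Lnn
  proof (rule antimono_slice[OF grid_finite c0 _ _ _ H(1) _ ab(1-3)])
    show "(0::real) < (1 / 2 ^ m) ^ CARD('n)" by simp
    show "(1 / 2 ^ m) ^ CARD('n) * real (card (grid m :: ('n \<Rightarrow> nat) set)) = 1"
      using cube_scale[of m "CARD('n)"] by (simp add: card_grid)
    show "slices_le (grid m) (cube_avg m \<phi>) c (\<lambda>_. 1)"
      by (rule slices_le_cube_avg[OF osc(1-4) c_def])
    show "measure lebesgue {s \<in> {0<..<1}. h m s = v}
        = (1 / 2 ^ m) ^ CARD('n) * real (card {k \<in> grid m. cube_avg m \<phi> k = v})" for v
      using H(4)[of "{v}" m] dyadic_step_level_measure[of m \<phi> v] U
      by (simp add: F_def measure_restrict_space space_restrict_space)
  qed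
  then obtain \<tau> where \<tau>: "\<And>m. (\<integral>\<^sup>+s. ennreal ((h m s - \<tau> m)\<^sup>2) \<partial>?L) \<le> ennreal (c * (b - a))"
    by metis
  have \<tau>_bound: "\<bar>\<tau> m\<bar> \<le> 1 + c + (LINT x:?U|lebesgue. \<bar>\<phi> x\<bar>) / (b - a)" for m
  proof -
    let ?P = "LINT x:?U|lebesgue. \<bar>\<phi> x\<bar>"
    have P0: "0 \<le> ?P" unfolding set_lebesgue_integral_def by (intro Bochner_Integration.integral_nonneg) auto
    have point: "\<bar>\<tau> m\<bar> \<le> 1 + (h m s - \<tau> m)\<^sup>2 + \<bar>h m s\<bar>" for s
      using abs_le_one_plus_sq[of "h m s - \<tau> m"] by linarith
    have "ennreal (\<bar>\<tau> m\<bar> * (b - a)) = (\<integral>\<^sup>+s. ennreal \<bar>\<tau> m\<bar> \<partial>?L)"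
      using ab by (simp add: emeasure_restrict_space ennreal_mult)
    also have "\<dots> \<le> (\<integral>\<^sup>+s. (1 + ennreal ((h m s - \<tau> m)\<^sup>2)) + ennreal \<bar>h m s\<bar> \<partial>?L)"
    proof (rule nn_integral_mono)
      fix s
      have "ennreal \<bar>\<tau> m\<bar> \<le> ennreal (1 + (h m s - \<tau> m)\<^sup>2 + \<bar>h m s\<bar>)" by (rule ennreal_leI[OF point])
      then show "ennreal \<bar>\<tau> m\<bar> \<le> (1 + ennreal ((h m s - \<tau> m)\<^sup>2)) + ennreal \<bar>h m s\<bar>"
        by (simp add: ennreal_plus)
    qed
    also have "\<dots> = ((\<integral>\<^sup>+s. 1 \<partial>?L) + (\<integral>\<^sup>+s. ennreal ((h m s - \<tau> m)\<^sup>2) \<partial>?L)) + (\<integral>\<^sup>+s. ennreal \<bar>h m s\<bar> \<partial>?L)"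
      using hL[of m] by (simp add: nn_integral_add)
    also have "\<dots> \<le> (ennreal (b - a) + ennreal (c * (b - a))) + ennreal ?P"
    proof (intro add_mono \<tau>)
      show "(\<integral>\<^sup>+s. 1 \<partial>?L) \<le> ennreal (b - a)" using ab by (simp add: emeasure_restrict_space)
      have "(\<integral>\<^sup>+s. ennreal \<bar>h m s\<bar> \<partial>?L) \<le> (\<integral>\<^sup>+s. ennreal \<bar>h m s\<bar> \<partial>lebesgue_on {0..1})"
        unfolding Lnn using sub01
        by (simp add: nn_integral_restrict_space) (intro nn_integral_mono, auto simp: indicator_def)
      also have "\<dots> = (\<integral>\<^sup>+x. ennreal \<bar>F m x\<bar> \<partial>lebesgue_on unit_cube)"
        using H(3)[of "\<lambda>y. ennreal \<bar>y\<bar>" m] by simp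
      also have "\<dots> = ennreal (LINT x:?U|lebesgue. \<bar>F m x\<bar>)"
        unfolding F_def by (rule nn_integral_unit_cube[OF dyadic_step_integrable])
      also have "\<dots> \<le> ennreal ?P"
        unfolding F_def by (rule ennreal_leI[OF dyadic_step_contraction[OF osc(1)]])
      finally show "(\<integral>\<^sup>+s. ennreal \<bar>h m s\<bar> \<partial>?L) \<le> ennreal ?P" .
    qed
    also have "\<dots> = ennreal ((b - a) + c * (b - a) + ?P)"
      using ab c0 P0 by (simp add: ennreal_plus)
    finally have "ennreal (\<bar>\<tau> m\<bar> * (b - a)) \<le> ennreal ((b - a) + c * (b - a) + ?P)" .
    moreover have "0 \<le> (b - a) + c * (b - a) + ?P" using ab c0 P0 by simp
    ultimately have "\<bar>\<tau> m\<bar> * (b - a) \<le> (b - a) + c * (b - a) + ?P"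
      using ennreal_le_iff by blast
    then show ?thesis using ab by (simp add: field_simps)
  qed
  define R where "R = 1 + c + (LINT x:?U|lebesgue. \<bar>\<phi> x\<bar>) / (b - a)"
  have "\<forall>m. \<tau> m \<in> {- R..R}" using \<tau>_bound unfolding R_def[symmetric] by (auto simp: abs_le_iff) (metis minus_le_iff)
  then obtain \<sigma> r where r: "strict_mono (r :: nat \<Rightarrow> nat)" "(\<tau> \<circ> r) \<longlonglongrightarrow> \<sigma>"
    using compact_Icc[of "- R" R] unfolding compact_def by blast
  have conv: "(\<lambda>m. measure ?M {x \<in> space ?M. \<delta> < \<bar>F m x - \<phi> x\<bar>}) \<longlonglongrightarrow> 0" if \<delta>: "0 < \<delta>" for \<delta>
  proof (rule Lim_null_comparison)
    show "\<forall>\<^sub>F m in sequentially. norm (measure ?M {x \<in> space ?M. \<delta> < \<bar>F m x - \<phi> x\<bar>})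
        \<le> (LINT x:?U|lebesgue. \<bar>F m x - \<phi> x\<bar>) / \<delta>"
    proof (rule always_eventually, rule allI)
      fix m
      have "set_integrable lebesgue ?U (\<lambda>x. \<bar>F m x - \<phi> x\<bar>)"
        unfolding F_def by (intro set_integrable_abs set_integral_diff(1) dyadic_step_integrable osc(1))
      then have int: "integrable ?M (\<lambda>x. \<bar>F m x - \<phi> x\<bar>)"
        using U by (simp add: integrable_restrict_space set_integrable_def)
      interpret finite_measure ?M by (rule finite_measure_lebesgue_on[OF U])
      have "measure ?M {x \<in> space ?M. \<delta> < \<bar>F m x - \<phi> x\<bar>} \<le> measure ?M {x \<in> space ?M. \<delta> \<le> \<bar>F m x - \<phi> x\<bar>}"
        using borel_measurable_integrable[OF int]
        by (intro finite_measure_mono) (auto simp: borel_measurable_iff_ge)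
      also have "\<dots> \<le> (LINT x|?M. \<bar>F m x - \<phi> x\<bar>) / \<delta>"
        using \<delta> by (intro integral_Markov_inequality_measure[OF int, of "space ?M"]) auto
      also have "(LINT x|?M. \<bar>F m x - \<phi> x\<bar>) = (LINT x:?U|lebesgue. \<bar>F m x - \<phi> x\<bar>)"
        using U by (simp add: integral_restrict_space set_lebesgue_integral_def)
      finally show "norm (measure ?M {x \<in> space ?M. \<delta> < \<bar>F m x - \<phi> x\<bar>})
        \<le> (LINT x:?U|lebesgue. \<bar>F m x - \<phi> x\<bar>) / \<delta>" by simp
    qed
    have "(\<lambda>m. (LINT x:?U|lebesgue. \<bar>F m x - \<phi> x\<bar>) / \<delta>) \<longlonglongrightarrow> 0 / \<delta>"
      unfolding F_def using \<delta> by (intro tendsto_divide dyadic_step_L1 osc(1)) auto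
    then show "(\<lambda>m. (LINT x:?U|lebesgue. \<bar>F m x - \<phi> x\<bar>) / \<delta>) \<longlonglongrightarrow> 0" by simp
  qed
  have lim: "(\<lambda>m. h m s) \<longlonglongrightarrow> g s" if "0 < s" "s < 1" "isCont g s" for s
  proof (rule antimono_converges_at[OF finite_measure_lebesgue_on[OF U] _ _ G(1) H(1) G(4) H(4) conv that])
    have "?U \<subseteq> unit_cube" using closed_cube_half_cube(1)[of 0 "\<lambda>_. 0"] unfolding unit_cube_eq .
    then show "\<phi> \<in> borel_measurable ?M" by (rule measurable_restrict_mono[OF \<phi>m])
    show "F m \<in> borel_measurable ?M" for m by (rule measurable_restrict_space1[OF FL])
  qed
  have "(\<integral>\<^sup>+s. ennreal ((g s - \<sigma>)\<^sup>2) \<partial>?L) = (\<integral>\<^sup>+s. liminf (\<lambda>i. ennreal ((h (r i) s - \<tau> (r i))\<^sup>2)) \<partial>?L)"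
  proof (rule nn_integral_cong_AE)
    have "AE s in ?L. s \<in> {0<..<1} \<longrightarrow> isCont g s"
      using antimono_AE_isCont[OF G(1)] by (simp add: AE_restrict_space_iff) (auto elim: eventually_mono)
    then show "AE s in ?L. ennreal ((g s - \<sigma>)\<^sup>2) = liminf (\<lambda>i. ennreal ((h (r i) s - \<tau> (r i))\<^sup>2))"
    proof (rule AE_mp, intro AE_I2 impI)
      fix s assume "s \<in> space ?L" and cont: "s \<in> {0<..<1} \<longrightarrow> isCont g s"
      then have s: "0 < s" "s < 1" using ab by (auto simp: space_restrict_space)
      have "(\<lambda>i. h (r i) s) \<longlonglongrightarrow> g s"
        using LIMSEQ_subseq_LIMSEQ[OF lim r(1)] s cont by (simp add: comp_def)
      then have "(\<lambda>i. ennreal ((h (r i) s - \<tau> (r i))\<^sup>2)) \<longlonglongrightarrow> ennreal ((g s - \<sigma>)\<^sup>2)"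
        using r(2) by (intro tendsto_ennrealI tendsto_intros) (simp_all add: comp_def)
      then show "ennreal ((g s - \<sigma>)\<^sup>2) = liminf (\<lambda>i. ennreal ((h (r i) s - \<tau> (r i))\<^sup>2))"
        by (intro lim_imp_Liminf[symmetric]) auto
    qed
  qed
  also have "\<dots> \<le> liminf (\<lambda>i. \<integral>\<^sup>+s. ennreal ((h (r i) s - \<tau> (r i))\<^sup>2) \<partial>?L)"
    using hL by (intro nn_integral_liminf) auto
  also have "\<dots> \<le> liminf (\<lambda>i::nat. ennreal (c * (b - a)))"
    by (intro Liminf_mono always_eventually allI \<tau>)
  also have "\<dots> = ennreal (c * (b - a))" by (rule Liminf_const) simp
  finally have E: "(\<integral>\<^sup>+s. ennreal ((g s - \<sigma>)\<^sup>2) \<partial>?L) \<le> ennreal (c * (b - a))" .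
  have "(\<integral>\<^sup>+s. ennreal ((g s - \<sigma>)\<^sup>2) \<partial>lebesgue_on I) = (\<integral>\<^sup>+s. ennreal ((g s - \<sigma>)\<^sup>2) \<partial>?L)"
  proof -
    have "AE s in lebesgue. s \<notin> {a, b}"
      by (rule AE_not_in, rule null_sets_completionI, rule finite_imp_null_set_lborel) simp
    then have "AE s in lebesgue. s \<in> I \<longleftrightarrow> s \<in> ?E"
    proof eventually_elim
      case (elim s)
      have "s \<in> I \<Longrightarrow> a \<le> s \<and> s \<le> b" using ab(5) by auto
      moreover have "s \<in> ?E \<Longrightarrow> s \<in> I" using ab(4) by blast
      ultimately show ?case using elim by (cases "s \<in> I") auto
    qed
    then show ?thesis
      unfolding Lnn using Im(1)
      by (simp add: nn_integral_restrict_space fmeasurableD) (rule nn_integral_cong_AE, auto elim!: eventually_mono simp: indicator_def)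
  qed
  then have "(\<integral>\<^sup>+s. ennreal ((g s - \<sigma>)\<^sup>2) \<partial>lebesgue_on I) \<le> ennreal (c * measure lebesgue I)"
    using E Im(2) by simp
  moreover have "I \<subseteq> {0..1}" using ab by auto
  ultimately show ?thesis
    unfolding c_def[symmetric] using Im ab
    by (intro average_variance_le[OF Im(1) _ measurable_restrict_mono[OF G(2)] c0]) auto
qed

section \<open>An extremal function\<close>

definition left_half :: "'n::finite \<Rightarrow> (real^'n) set" where
  "left_half i = {x \<in> half_cube 1 (\<lambda>_. 0). x $ i < 1 / 4}"

definition right_half :: "'n::finite \<Rightarrow> (real^'n) set" where
  "right_half i = {x \<in> half_cube 1 (\<lambda>_. 0). 1 / 4 \<le> x $ i}"

text \<open>The two halves are translates of each other.\<close>

lemma halves_measure: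
  fixes i :: "'n::finite"
  shows "left_half i \<in> lmeasurable" "right_half i \<in> lmeasurable"
    "measure lebesgue (left_half i) = 1 / 2 ^ CARD('n) / 2" "measure lebesgue (right_half i) = 1 / 2 ^ CARD('n) / 2"
proof -
  let ?A = "half_cube 1 (\<lambda>_. 0) :: (real^'n) set"
  have A: "?A \<in> lmeasurable" using half_cube_cbox(3,4)[of 1 "\<lambda>_::'n. 0"] by (auto simp: fmeasurable_def)
  have half: "{x :: real^'n. x $ i < 1 / 4} \<in> sets lebesgue"
    by (intro sets_completionI_sets) (simp add: open_halfspace_component_lt_cart)
  show L: "left_half i \<in> lmeasurable"
    using A half by (simp add: left_half_def fmeasurable_Int_fmeasurable Collect_conj_eq Int_def[symmetric] conj_commute)
  have R: "right_half i = ?A - left_half i" by (auto simp: left_half_def right_half_def)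
  show "right_half i \<in> lmeasurable" unfolding R using A L by (intro fmeasurable_Diff) auto
  have "right_half i = (+) (axis i (1 / 4)) ` left_half i"
  proof (intro equalityI subsetI)
    fix x :: "real^'n" assume x: "x \<in> right_half i"
    then have h: "0 \<le> x $ j" "x $ j < 1 / 2" for j by (auto simp: right_half_def half_cube_iff)
    have xi: "1 / 4 \<le> x $ i" using x by (simp add: right_half_def)
    have "0 \<le> (x - axis i (1 / 4)) $ j \<and> (x - axis i (1 / 4)) $ j < 1 / 2" for j
      by (cases "j = i") (use h[of j] h[of i] xi in \<open>auto simp: axis_def\<close>)
    moreover have "(x - axis i (1 / 4)) $ i < 1 / 4" using h(2)[of i] by (simp add: axis_def)
    ultimately have "x - axis i (1 / 4) \<in> left_half i"
      by (simp add: left_half_def half_cube_iff)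
    then show "x \<in> (+) (axis i (1 / 4)) ` left_half i" by (intro image_eqI[of _ _ "x - axis i (1 / 4)"]) auto
  next
    fix x :: "real^'n" assume "x \<in> (+) (axis i (1 / 4)) ` left_half i"
    then obtain y where y: "y \<in> left_half i" "x = axis i (1 / 4) + y" by blast
    then have h: "0 \<le> y $ j" "y $ j < 1 / 2" for j by (auto simp: left_half_def half_cube_iff)
    have yi: "y $ i < 1 / 4" using y by (simp add: left_half_def)
    have "0 \<le> x $ j \<and> x $ j < 1 / 2" for j
      by (cases "j = i") (use h[of j] h[of i] yi in \<open>auto simp: y(2) axis_def\<close>)
    moreover have "1 / 4 \<le> x $ i" using h(1)[of i] by (simp add: y(2) axis_def)
    ultimately show "x \<in> right_half i"
      by (simp add: right_half_def half_cube_iff)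
  qed
  then have eq: "measure lebesgue (right_half i) = measure lebesgue (left_half i)"
    by (simp add: measure_translation)
  have "left_half i \<subseteq> ?A" by (auto simp: left_half_def)
  then have "measure lebesgue (right_half i) = measure lebesgue ?A - measure lebesgue (left_half i)"
    unfolding R using A L by (intro measurable_measure_Diff) auto
  then show "measure lebesgue (left_half i) = 1 / 2 ^ CARD('n) / 2" "measure lebesgue (right_half i) = 1 / 2 ^ CARD('n) / 2"
    using eq measure_half_cube[of 1 "\<lambda>_::'n. 0"] by (simp_all add: power_one_over)
qed

text \<open>One child of the unit cube carries mean \<open>sqrt N\<close> and variance \<open>1\<close>, where \<open>N\<close> is the number of
  children, and the function vanishes on the others. The jump \<open>sqrt N\<close> is chosen to make the variance on
  the unit cube equal to \<open>1\<close> as well.\<close>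

definition extremal :: "'n::finite \<Rightarrow> real^'n \<Rightarrow> real" where
  "extremal i x = (sqrt (2 ^ CARD('n)) + 1) * indicator (left_half i) x
    + (sqrt (2 ^ CARD('n)) - 1) * indicator (right_half i) x"

lemma halves_integral:
  fixes i :: "'n::finite"
  shows "set_integrable lebesgue unit_half_cube (\<lambda>x. p * indicator (left_half i) x + q * indicator (right_half i) x :: real)"
    "(LINT x:unit_half_cube|lebesgue. p * indicator (left_half i) x + q * indicator (right_half i) x) = (p + q) / (2 * 2 ^ CARD('n))"
proof -
  let ?f = "\<lambda>x. p * indicator (left_half i) x + q * indicator (right_half i) x :: real"
  have "half_cube 1 (\<lambda>_. 0) \<subseteq> (unit_half_cube :: (real^'n) set)"
    by (rule half_cube_subset_unit) (simp add: descendants_def)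
  then have f: "indicator unit_half_cube x *\<^sub>R ?f x = ?f x" for x
    by (auto simp: indicator_def left_half_def right_half_def)
  have int: "integrable lebesgue (\<lambda>x. c * indicator (left_half i) x)" "integrable lebesgue (\<lambda>x. c * indicator (right_half i) x)" for c :: real
    using halves_measure(1,2)[of i] by (auto intro!: integrable_mult_right integrable_real_indicator simp: fmeasurable_def)
  show "set_integrable lebesgue unit_half_cube ?f"
    unfolding set_integrable_def f by (intro Bochner_Integration.integrable_add int)
  show "(LINT x:unit_half_cube|lebesgue. ?f x) = (p + q) / (2 * 2 ^ CARD('n))"
    unfolding set_lebesgue_integral_def f
    by (subst Bochner_Integration.integral_add[OF int]) (simp add: halves_measure add_divide_distrib)
qed

lemma extremal_sq: "(extremal i x)\<^sup>2 = (sqrt (2 ^ CARD('n)) + 1)\<^sup>2 * indicator (left_half i) x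
    + (sqrt (2 ^ CARD('n)) - 1)\<^sup>2 * indicator (right_half (i :: 'n::finite)) x"
  by (auto simp: extremal_def indicator_def left_half_def right_half_def)

lemma extremal_integrals:
  fixes i :: "'n::finite"
  shows "set_integrable lebesgue unit_half_cube (extremal i)" "set_integrable lebesgue unit_half_cube (\<lambda>x. (extremal i x)\<^sup>2)"
    "(LINT x:unit_half_cube|lebesgue. extremal i x) = 1 / sqrt (2 ^ CARD('n))"
    "(LINT x:unit_half_cube|lebesgue. (extremal i x)\<^sup>2) = 1 + 1 / 2 ^ CARD('n)"
proof -
  let ?r = "sqrt (2 ^ CARD('n)) :: real"
  have r: "?r * ?r = 2 ^ CARD('n)" "0 < ?r" by simp_all
  show "set_integrable lebesgue unit_half_cube (extremal i)" "set_integrable lebesgue unit_half_cube (\<lambda>x. (extremal i x)\<^sup>2)"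
    unfolding extremal_sq unfolding extremal_def[abs_def] by (rule halves_integral(1))+
  show "(LINT x:unit_half_cube|lebesgue. extremal i x) = 1 / ?r"
  proof -
    have "(?r + 1 + (?r - 1)) / (2 * (?r * ?r)) = 1 / ?r" using r(2) by (simp add: field_simps)
    then show ?thesis unfolding extremal_def halves_integral(2) r(1) .
  qed
  show "(LINT x:unit_half_cube|lebesgue. (extremal i x)\<^sup>2) = 1 + 1 / 2 ^ CARD('n)"
    unfolding extremal_sq halves_integral(2) by (simp add: power2_eq_square field_simps)
qed

lemma extremal_nonneg: "0 \<le> extremal i x"
proof -
  have "1 \<le> sqrt (2 ^ CARD('a) :: real)" by simp
  then show ?thesis by (auto simp: extremal_def)
qed

lemma extremal_measurable: "extremal i \<in> borel_measurable lebesgue"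
  unfolding extremal_def[abs_def]
  by (intro borel_measurable_add borel_measurable_times borel_measurable_const borel_measurable_indicator
      fmeasurableD halves_measure)

text \<open>On the unit cube the variance is computed. Any smaller dyadic cube lies in a single child;
  there the function is at distance exactly \<open>1\<close> from \<open>sqrt N\<close>, or it vanishes.\<close>

lemma extremal_variance_le:
  fixes i :: "'n::finite"
  assumes k: "k \<in> grid m"
  shows "average_sq (extremal i) (closed_cube m k) - ereal ((average (extremal i) (closed_cube m k))\<^sup>2) \<le> ereal 1"
proof -
  let ?r = "sqrt (2 ^ CARD('n)) :: real"
  let ?C = "closed_cube m k"
  have C: "?C \<in> sets lebesgue" using closed_cube_half_cube(3) by blast
  have "\<exists>\<tau>. (\<integral>\<^sup>+x. ennreal ((extremal i x - \<tau>)\<^sup>2) \<partial>lebesgue_on ?C) \<le> ennreal (1 * measure lebesgue ?C)"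
  proof (cases m)
    case 0
    then have k0: "k = (\<lambda>_. 0)" using k by (auto simp: descendants_def)
    have CU: "?C = unit_cube" unfolding unit_cube_eq k0 0 ..
    have int: "set_integrable lebesgue unit_half_cube (\<lambda>x. (extremal i x - 1 / ?r)\<^sup>2)"
      by (rule set_integrable_sq_diff(1)[OF extremal_integrals(1,2) set_integrable_const_half_cube])
    have one: "(LINT x:(unit_half_cube :: (real^'n) set)|lebesgue. 1) = (1::real)"
      using half_cube_cbox(3,4)[of 0 "\<lambda>_::'n. 0"] measure_half_cube[of 0 "\<lambda>_::'n. 0"]
      by (subst set_integral_const) auto
    have "(LINT x:unit_half_cube|lebesgue. (extremal i x - 1 / ?r)\<^sup>2)
        = 1 + 1 / 2 ^ CARD('n) - 2 * (1 / ?r) * (1 / ?r) + (1 / ?r)\<^sup>2"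
      using set_integrable_sq_diff(2)[OF extremal_integrals(1)[of i] extremal_integrals(2)[of i] set_integrable_const_half_cube, where \<tau> = "1 / ?r"]
      unfolding extremal_integrals one by simp
    also have "\<dots> = 1" by (simp add: power_divide power2_eq_square)
    finally have L: "(LINT x:unit_half_cube|lebesgue. (extremal i x - 1 / ?r)\<^sup>2) = 1" .
    have "measure lebesgue ?C = 1" unfolding CU by (simp add: measure_def emeasure_lebesgue_unit_cube)
    then show ?thesis
      using nn_integral_unit_cube[OF int] unfolding CU by (intro exI[of _ "1 / ?r"]) (simp add: L)
  next
    case (Suc j)
    let ?l = "\<lambda>i. k i div 2 ^ j"
    have "half_cube m k \<subseteq> half_cube 1 ?l"
      using half_cube_refine[of 1 ?l j] Suc by (auto simp: descendants_def)
    then consider "half_cube m k \<subseteq> half_cube 1 (\<lambda>_. 0)" | "half_cube m k \<inter> half_cube 1 (\<lambda>_. 0) = {}"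
      using half_cube_disjoint[of ?l "\<lambda>_. 0" 1] by fastforce
    then have "\<exists>\<tau>. \<forall>x\<in>half_cube m k. (extremal i x - \<tau>)\<^sup>2 \<le> 1"
    proof cases
      case 1
      have "(extremal i x - ?r)\<^sup>2 \<le> 1" if "x \<in> half_cube 1 (\<lambda>_. 0)" for x
        using that by (auto simp: extremal_def left_half_def right_half_def indicator_def)
      then show ?thesis using 1 by blast
    next
      case 2
      then have "(extremal i x - 0)\<^sup>2 \<le> 1" if "x \<in> half_cube m k" for x
        using that by (auto simp: extremal_def left_half_def right_half_def indicator_def)
      then show ?thesis by blast
    qed
    then obtain \<tau> where \<tau>: "\<And>x. x \<in> half_cube m k \<Longrightarrow> (extremal i x - \<tau>)\<^sup>2 \<le> 1" by blast
    have "(\<integral>\<^sup>+x. ennreal ((extremal i x - \<tau>)\<^sup>2) \<partial>lebesgue_on ?C) \<le> (\<integral>\<^sup>+x. 1 \<partial>lebesgue_on ?C)"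
    proof (rule nn_integral_mono_AE)
      show "AE x in lebesgue_on ?C. ennreal ((extremal i x - \<tau>)\<^sup>2) \<le> 1"
        using AE_closed_cube[of m k] C by (simp add: AE_restrict_space_iff) (auto elim!: eventually_mono intro: \<tau>)
    qed
    also have "\<dots> = ennreal (1 * measure lebesgue ?C)"
      using C closed_cube_half_cube(3)[of m k]
      by (simp add: emeasure_restrict_space space_restrict_space emeasure_eq_measure2)
    finally show ?thesis by blast
  qed
  then show ?thesis
    using average_variance_le[OF closed_cube_half_cube(3,4) measurable_restrict_space1[OF extremal_measurable], of 1]
    by auto
qed

lemma extremal_BMO:
  fixes i :: "'n::finite"
  shows "extremal i \<in> BMO_dyadic" "bmo_sup dyadic_cubes (extremal i) \<le> 1"
proof -
  show le: "bmo_sup dyadic_cubes (extremal i) \<le> 1"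
    unfolding bmo_sup_def dyadic_cubes_eq using extremal_variance_le
    by (auto intro!: SUP_least simp: one_ereal_def)
  have "integrable (lebesgue_on unit_cube) (extremal i)"
  proof (rule integrableI_bounded)
    show "extremal i \<in> borel_measurable (lebesgue_on unit_cube)"
      by (rule measurable_restrict_space1[OF extremal_measurable])
    show "(\<integral>\<^sup>+x. ennreal (norm (extremal i x)) \<partial>lebesgue_on unit_cube) < \<infinity>"
      using nn_integral_unit_cube[OF extremal_integrals(1)[of i]] by simp
  qed
  then show "extremal i \<in> BMO_dyadic"
    using order_le_less_trans[OF le, of \<infinity>] by (simp add: BMO_dyadic_def bmo_space_def)
qed

lemma extremal_pos_measure:
  fixes i :: "'n::finite"
  shows "measure (lebesgue_on unit_half_cube) {x \<in> space (lebesgue_on unit_half_cube). extremal i x \<in> {0<..}} = 1 / 2 ^ CARD('n)"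
proof -
  define r where "r = sqrt (2 ^ CARD('n) :: real)"
  have r: "1 < r" by (simp add: r_def)
  have ext: "extremal i x = (r + 1) * indicator (left_half i) x + (r - 1) * indicator (right_half i) x" for x
    by (simp add: extremal_def r_def)
  have S: "{x \<in> space (lebesgue_on unit_half_cube). extremal i x \<in> {0<..}} = half_cube 1 (\<lambda>_. 0)"
    using half_cube_subset_unit[of "\<lambda>_::'n. 0" 1] r
    by (auto simp: ext indicator_def left_half_def right_half_def descendants_def space_restrict_space split: if_splits)
  have "measure (lebesgue_on unit_half_cube) (half_cube 1 (\<lambda>_::'n. 0)) = measure lebesgue (half_cube 1 (\<lambda>_::'n. 0))"
    using half_cube_cbox(3)[of 0 "\<lambda>_::'n. 0"] half_cube_subset_unit[of "\<lambda>_::'n. 0" 1]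
    by (intro measure_restrict_space) (auto simp: descendants_def)
  also have "\<dots> = 1 / 2 ^ CARD('n)" by (simp only: measure_half_cube power_one_over power_one_right)
  finally show ?thesis unfolding S .
qed

text \<open>The function is nonnegative, and it is positive on a set of measure \<open>1 / 2 ^ CARD('n)\<close>, so its
  rearrangement lives on an initial interval of that length.\<close>

lemma extremal_rearrangement_support:
  fixes i :: "'n::finite"
  assumes g: "is_monotonic_rearrangement (extremal i) g" and s: "0 < s" "s < 1"
  shows "0 \<le> g s" "1 / 2 ^ CARD('n) < s \<Longrightarrow> g s = 0"
proof -
  note G = is_monotonic_rearrangementD[OF g measurable_restrict_space1[OF extremal_measurable]]
  have fin: "{t \<in> {0<..<1}. g t \<in> A} \<in> lmeasurable" if "A \<in> sets borel" for A
  proof (rule fmeasurableI2[of "{0<..<1}"])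
    show "{0<..<1::real} \<in> lmeasurable" using lmeasurable_box[of 0 "1::real"] by simp
    show "{t \<in> {0<..<1}. g t \<in> A} \<in> sets lebesgue"
      using antimono_vimage_borel[OF G(1) that] by (auto intro: sets_completionI_sets)
  qed auto
  show nn: "0 \<le> g s"
  proof (rule ccontr)
    assume neg: "\<not> 0 \<le> g s"
    have "{s..<1} \<subseteq> {t \<in> {0<..<1}. g t \<in> {..<0}}"
    proof
      fix t assume t: "t \<in> {s..<1}"
      then have "g t \<le> g s" using s monotone_onD[OF G(1), of s t] by auto
      then show "t \<in> {t \<in> {0<..<1}. g t \<in> {..<0}}" using t s neg by auto
    qed
    then have "measure lebesgue {s..<1} \<le> measure lebesgue {t \<in> {0<..<1}. g t \<in> {..<0}}"
      by (intro measure_mono_fmeasurable fin) auto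
    also have "\<dots> = measure (lebesgue_on unit_half_cube) {x \<in> space (lebesgue_on unit_half_cube). extremal i x \<in> {..<0}}"
      by (rule G(4)) simp
    also have "{x \<in> space (lebesgue_on unit_half_cube). extremal i x \<in> {..<0}} = {}"
      using extremal_nonneg[of i] by (auto simp: not_less[symmetric])
    finally show False using s by simp
  qed
  show "g s = 0" if "1 / 2 ^ CARD('n) < s"
  proof (rule ccontr)
    assume "g s \<noteq> 0"
    then have pos: "0 < g s" using nn by simp
    have "{0<..s} \<subseteq> {t \<in> {0<..<1}. g t \<in> {0<..}}"
    proof
      fix t assume t: "t \<in> {0<..s}"
      then have "g s \<le> g t" using s monotone_onD[OF G(1), of t s] by auto
      then show "t \<in> {t \<in> {0<..<1}. g t \<in> {0<..}}" using t s pos by auto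
    qed
    then have "measure lebesgue {0<..s} \<le> measure lebesgue {t \<in> {0<..<1}. g t \<in> {0<..}}"
      by (intro measure_mono_fmeasurable fin) auto
    also have "\<dots> = measure (lebesgue_on unit_half_cube) {x \<in> space (lebesgue_on unit_half_cube). extremal i x \<in> {0<..}}"
      by (rule G(4)) simp
    also have "\<dots> = 1 / 2 ^ CARD('n)" by (rule extremal_pos_measure)
    finally show False using s that by simp
  qed
qed

text \<open>The interval \<open>{0..b}\<close> contains the support of the rearrangement, hence the first two moments over it
  equal those of the function on the unit cube. The length \<open>b\<close> makes the support occupy the fraction
  \<open>(1 + 1 / N) / 2\<close> of the interval, where \<open>N = 2 ^ CARD('n)\<close>: the maximiser found in \<open>chord_bound\<close>.\<close>

lemma extremal_rearrangement_variance:
  fixes i :: "'n::finite"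
  assumes g: "is_monotonic_rearrangement (extremal i) g"
  defines "b \<equiv> 2 / (1 + 2 ^ CARD('n) :: real)"
  shows "{0..b} \<in> unit_subintervals"
    "average_sq g {0..b} - ereal ((average g {0..b})\<^sup>2) = ereal ((1 + 1 / 2 ^ CARD('n))\<^sup>2 / (4 * (1 / 2 ^ CARD('n))))"
proof -
  note G = is_monotonic_rearrangementD[OF g measurable_restrict_space1[OF extremal_measurable]]
  let ?N = "2 ^ CARD('n) :: real"
  have N: "1 < ?N" by simp
  have b: "0 < b" "b < 1" "1 / ?N < b"
  proof -
    have "0 < 2 / (1 + M) \<and> 2 / (1 + M) < 1 \<and> 1 / M < 2 / (1 + M)" if "1 < M" for M :: real
      using that by (simp add: field_simps)
    from this[OF N] show "0 < b" "b < 1" "1 / ?N < b" by (auto simp only: b_def)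
  qed
  have mb: "measure lebesgue {0..b} = b" using b by simp
  show I: "{0..b} \<in> unit_subintervals" using b by (auto simp: unit_subintervals_def is_interval_cc)
  have whole: "(\<integral>\<^sup>+s. F (g s) \<partial>lebesgue_on {0..b}) = (\<integral>\<^sup>+x. F (extremal i x) \<partial>lebesgue_on unit_cube)"
    if F: "F \<in> borel_measurable borel" "F 0 = 0" for F :: "real \<Rightarrow> ennreal"
  proof -
    have "AE s in lebesgue. s \<notin> {1}"
      by (rule AE_not_in, rule null_sets_completionI, rule finite_imp_null_set_lborel) simp
    then have "AE s in lebesgue. F (g s) * indicator {0..b} s = F (g s) * indicator {0..1} s"
    proof eventually_elim
      case (elim s)
      show ?case
      proof (cases "b < s \<and> s < 1")
        case True
        then have "g s = 0" using b by (intro extremal_rearrangement_support(2)[OF g]) auto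
        then show ?thesis using F by simp
      next
        case False
        then show ?thesis using elim b by (auto simp: indicator_def)
      qed
    qed
    then have "(\<integral>\<^sup>+s. F (g s) \<partial>lebesgue_on {0..b}) = (\<integral>\<^sup>+s. F (g s) \<partial>lebesgue_on {0..1})"
      by (simp add: nn_integral_restrict_space) (rule nn_integral_cong_AE)
    then show ?thesis using G(3)[OF F(1)] by simp
  qed
  have sq: "(\<integral>\<^sup>+s. ennreal ((g s)\<^sup>2) \<partial>lebesgue_on {0..b}) = ennreal (1 + 1 / ?N)"
  proof -
    have "(\<integral>\<^sup>+s. ennreal ((g s)\<^sup>2) \<partial>lebesgue_on {0..b}) = (\<integral>\<^sup>+x. ennreal ((extremal i x)\<^sup>2) \<partial>lebesgue_on unit_cube)"
      by (rule whole) auto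
    also have "\<dots> = ennreal (1 + 1 / ?N)"
      using nn_integral_unit_cube[OF extremal_integrals(2)[of i]] by (simp add: extremal_integrals)
    finally show ?thesis .
  qed
  have "(\<integral>\<^sup>+s. ennreal (g s) \<partial>lebesgue_on {0..b}) = (\<integral>\<^sup>+x. ennreal (extremal i x) \<partial>lebesgue_on unit_cube)"
    by (rule whole) auto
  also have "\<dots> = ennreal (1 / sqrt ?N)"
    using nn_integral_unit_cube[OF extremal_integrals(1)[of i]] by (simp add: extremal_integrals extremal_nonneg)
  finally have first: "(\<integral>\<^sup>+s. ennreal (g s) \<partial>lebesgue_on {0..b}) = ennreal (1 / sqrt ?N)" .
  have "(LINT s|lebesgue_on {0..b}. g s) = enn2real (\<integral>\<^sup>+s. ennreal (g s) \<partial>lebesgue_on {0..b})"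
  proof (rule integral_eq_nn_integral)
    show "g \<in> borel_measurable (lebesgue_on {0..b})"
      by (rule measurable_restrict_mono[OF G(2)]) (use b in auto)
    have "AE s in lebesgue. s \<notin> {0}"
      by (rule AE_not_in, rule null_sets_completionI, rule finite_imp_null_set_lborel) simp
    then have "AE s in lebesgue. s \<in> {0..b} \<longrightarrow> 0 \<le> g s"
    proof eventually_elim
      case (elim s)
      then show ?case using extremal_rearrangement_support(1)[OF g, of s] b by auto
    qed
    then show "AE s in lebesgue_on {0..b}. 0 \<le> g s" by (simp add: AE_restrict_space_iff)
  qed
  then have int: "(LINT s|lebesgue_on {0..b}. g s) = 1 / sqrt ?N" using first by simp
  have A: "average_sq g {0..b} = ereal ((1 + 1 / ?N) / b)"
    unfolding average_sq_def sq mb using b by (subst enn2ereal_ennreal) auto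
  have B: "(average g {0..b})\<^sup>2 = 1 / ?N / b\<^sup>2"
    unfolding average_def int mb by (simp add: power_divide power_mult_distrib)
  have id: "(1 + 1 / ?N) / b - 1 / ?N / b\<^sup>2 = (1 + 1 / ?N)\<^sup>2 / (4 * (1 / ?N))"
  proof -
    have "(1 + 1 / M) / (2 / (1 + M)) - 1 / M / (2 / (1 + M))\<^sup>2 = (1 + 1 / M)\<^sup>2 / (4 * (1 / M))"
      if "1 < M" for M :: real
      using that by (simp add: divide_simps) (simp add: power2_eq_square algebra_simps)
    from this[OF N] show ?thesis unfolding b_def .
  qed
  show "average_sq g {0..b} - ereal ((average g {0..b})\<^sup>2) = ereal ((1 + 1 / ?N)\<^sup>2 / (4 * (1 / ?N)))"
    unfolding A B ereal_minus(1) id ..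
qed

section \<open>The norm of the rearrangement operator\<close>

lemma bmo_sup_dyadic_real:
  fixes \<phi> :: "real^'n::finite \<Rightarrow> real"
  assumes "\<phi> \<in> BMO_dyadic"
  obtains e where "bmo_sup dyadic_cubes \<phi> = ereal e"
proof -
  have fin: "bmo_sup dyadic_cubes \<phi> \<noteq> \<infinity>" using assms by (auto simp: BMO_dyadic_def bmo_space_def)
  have "closed_cube 0 (\<lambda>_. 0) \<in> (dyadic_cubes :: (real^'n) set set)"
    unfolding dyadic_cubes_eq by (force simp: descendants_def)
  then have le: "average_sq \<phi> (closed_cube 0 (\<lambda>_. 0)) - ereal ((average \<phi> (closed_cube 0 (\<lambda>_. 0)))\<^sup>2) \<le> bmo_sup dyadic_cubes \<phi>"
    unfolding bmo_sup_def by (rule SUP_upper)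
  have "0 \<le> average_sq \<phi> (closed_cube 0 (\<lambda>_. 0))"
    unfolding average_sq_def by (simp add: zero_le_divide_ereal)
  then have "bmo_sup dyadic_cubes \<phi> \<noteq> - \<infinity>"
    using le by (cases "average_sq \<phi> (closed_cube 0 (\<lambda>_. 0))") auto
  then show thesis using fin that by (cases "bmo_sup dyadic_cubes \<phi>") auto
qed

lemma norm_constant_sq:
  "((1 + 2 ^ n) / 2 powr (1 + real n / 2))\<^sup>2 = (1 + 1 / 2 ^ n)\<^sup>2 / (4 * (1 / 2 ^ n) :: real)"
proof -
  have "((2::real) powr (1 + real n / 2))\<^sup>2 = 2 powr (2 + real n)"
    by (simp add: power2_eq_square powr_add[symmetric])
  also have "\<dots> = 4 * 2 ^ n" by (simp add: powr_add powr_realpow)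
  finally show ?thesis by (simp add: power_divide divide_simps) (simp add: power2_eq_square algebra_simps)
qed

theorem corollary1:
  shows "(\<forall>\<phi> \<in> (BMO_dyadic :: (real^'n \<Rightarrow> real) set). monotonic_rearrangement \<phi> \<in> BMO_unit)
    \<and> (\<forall>\<phi> \<in> (BMO_dyadic :: (real^'n \<Rightarrow> real) set).
          bmo_seminorm unit_subintervals (monotonic_rearrangement \<phi>)
            \<le> (1 + 2 ^ CARD('n)) / 2 powr (1 + real CARD('n) / 2)
                * bmo_seminorm dyadic_cubes \<phi>)
    \<and> (\<forall>c. (\<forall>\<phi> \<in> (BMO_dyadic :: (real^'n \<Rightarrow> real) set).
               bmo_seminorm unit_subintervals (monotonic_rearrangement \<phi>)
                 \<le> c * bmo_seminorm dyadic_cubes \<phi>)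
          \<longrightarrow> (1 + 2 ^ CARD('n)) / 2 powr (1 + real CARD('n) / 2) \<le> c)"
proof -
  define c0 :: real where "c0 = (1 + 2 ^ CARD('n)) / 2 powr (1 + real CARD('n) / 2)"
  have c0: "0 < c0" unfolding c0_def by (intro divide_pos_pos add_pos_pos) auto
  have K: "(1 + 1 / 2 ^ CARD('n))\<^sup>2 / (4 * (1 / 2 ^ CARD('n))) = c0\<^sup>2"
    unfolding c0_def by (rule norm_constant_sq[symmetric])
  have R: "is_monotonic_rearrangement \<phi> (monotonic_rearrangement \<phi>)" if "\<phi> \<in> BMO_dyadic" for \<phi> :: "real^'n \<Rightarrow> real"
    using that by (intro monotonic_rearrangement) (simp add: BMO_dyadic_def bmo_space_def)
  have sup_le: "bmo_sup unit_subintervals (monotonic_rearrangement \<phi>) \<le> ereal (c0\<^sup>2 * e)"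
    if "\<phi> \<in> BMO_dyadic" "bmo_sup dyadic_cubes \<phi> = ereal e" for \<phi> :: "real^'n \<Rightarrow> real" and e
    unfolding bmo_sup_def[of unit_subintervals]
    using rearrangement_variance_le[OF that R[OF that(1)]] unfolding K by (intro SUP_least) auto
  have mem: "monotonic_rearrangement \<phi> \<in> BMO_unit" if \<phi>: "\<phi> \<in> BMO_dyadic" for \<phi> :: "real^'n \<Rightarrow> real"
  proof -
    obtain e where e: "bmo_sup dyadic_cubes \<phi> = ereal e" using bmo_sup_dyadic_real[OF \<phi>] .
    have int: "integrable (lebesgue_on unit_cube) \<phi>" using \<phi> by (simp add: BMO_dyadic_def bmo_space_def)
    note G = is_monotonic_rearrangementD[OF R[OF \<phi>] borel_measurable_integrable[OF int]]
    have "integrable (lebesgue_on {0..1}) (monotonic_rearrangement \<phi>)"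
    proof (rule integrableI_bounded[OF G(2)])
      have "(\<integral>\<^sup>+s. ennreal (norm (monotonic_rearrangement \<phi> s)) \<partial>lebesgue_on {0..1})
          = (\<integral>\<^sup>+x. ennreal (norm (\<phi> x)) \<partial>lebesgue_on unit_cube)"
        by (rule G(3)) simp
      also have "\<dots> < \<infinity>" using int by (simp add: integrable_iff_bounded)
      finally show "(\<integral>\<^sup>+s. ennreal (norm (monotonic_rearrangement \<phi> s)) \<partial>lebesgue_on {0..1}) < \<infinity>" .
    qed
    then show ?thesis
      using order_le_less_trans[OF sup_le[OF \<phi> e], of \<infinity>] by (simp add: BMO_unit_def bmo_space_def)
  qed
  have bound: "bmo_seminorm unit_subintervals (monotonic_rearrangement \<phi>) \<le> c0 * bmo_seminorm dyadic_cubes \<phi>"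
    if \<phi>: "\<phi> \<in> BMO_dyadic" for \<phi> :: "real^'n \<Rightarrow> real"
  proof -
    obtain e where e: "bmo_sup dyadic_cubes \<phi> = ereal e" using bmo_sup_dyadic_real[OF \<phi>] .
    have e0: "0 \<le> e" by (rule bmo_dyadic_oscillation(3)[OF \<phi> e])
    have "real_of_ereal (bmo_sup unit_subintervals (monotonic_rearrangement \<phi>)) \<le> c0\<^sup>2 * e"
      using sup_le[OF \<phi> e] e0 by (cases "bmo_sup unit_subintervals (monotonic_rearrangement \<phi>)") auto
    then have "bmo_seminorm unit_subintervals (monotonic_rearrangement \<phi>) \<le> sqrt (c0\<^sup>2 * e)"
      unfolding bmo_seminorm_def by (rule real_sqrt_le_mono)
    also have "\<dots> = c0 * bmo_seminorm dyadic_cubes \<phi>"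
      using c0 by (simp add: bmo_seminorm_def e real_sqrt_mult)
    finally show ?thesis .
  qed
  have sharp: "c0 \<le> c"
    if c: "\<forall>\<phi> \<in> (BMO_dyadic :: (real^'n \<Rightarrow> real) set).
      bmo_seminorm unit_subintervals (monotonic_rearrangement \<phi>) \<le> c * bmo_seminorm dyadic_cubes \<phi>" for c
  proof -
    let ?\<phi> = "extremal (undefined :: 'n)"
    let ?g = "monotonic_rearrangement ?\<phi>"
    note \<phi> = extremal_BMO[of "undefined :: 'n"]
    obtain e where e: "bmo_sup dyadic_cubes ?\<phi> = ereal e" using bmo_sup_dyadic_real[OF \<phi>(1)] .
    have e01: "0 \<le> e" "e \<le> 1"
      using bmo_dyadic_oscillation(3)[OF \<phi>(1) e] \<phi>(2) e by (auto simp: one_ereal_def)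
    note V = extremal_rearrangement_variance[OF R[OF \<phi>(1)]]
    have lower: "ereal (c0\<^sup>2) \<le> bmo_sup unit_subintervals ?g"
      unfolding bmo_sup_def[of unit_subintervals] using V(1)
      by (rule SUP_upper2) (simp only: V(2) K order_refl)
    moreover have "bmo_sup unit_subintervals ?g < \<infinity>"
      using mem[OF \<phi>(1)] by (simp add: BMO_unit_def bmo_space_def)
    ultimately have "c0\<^sup>2 \<le> real_of_ereal (bmo_sup unit_subintervals ?g)"
      by (cases "bmo_sup unit_subintervals ?g") auto
    then have "c0 \<le> bmo_seminorm unit_subintervals ?g"
      unfolding bmo_seminorm_def using c0 by (simp add: real_le_rsqrt)
    also have "\<dots> \<le> c * sqrt e"
      using c \<phi>(1) by (auto simp: bmo_seminorm_def e)
    finally have le: "c0 \<le> c * sqrt e" .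
    then have "0 \<le> c" using c0 e01 by (smt (verit) mult_nonpos_nonneg real_sqrt_ge_zero)
    then have "c * sqrt e \<le> c" using e01 by (simp add: mult_left_le)
    then show ?thesis using le by simp
  qed
  show ?thesis unfolding c0_def[symmetric] using mem bound sharp by blast
qed

end
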